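(* There exists a randomized algorithm that, given an $n$-vertex labeled graph $G=(V,E)$ specified via adjacency-list access to its $(+)$-subgraph $G^+$, with high probability (i.e., with probability at least $1-1/\mathrm{poly}(n)$) outputs a clustering of $V$ whose correlation clustering cost is at most $O(1)$ times the minimum possible cost, using $O(n\log n)$ queries and $O(n\log^2 n)$ time.
   Context: A labeled graph $G=(V,E)$ is a complete undirected graph on $n$ vertices in which every edge is labeled $+1$ or $-1$; $G^+$ (resp. $G^-$) is the subgraph of $(+)$-labeled (resp. $(-)$-labeled) edges, and $N^+(v)$, $\deg^+(v)$ denote the neighborhood and degree of $v$ in $G^+$. For a clustering $\mathcal{C}$ (partition of $V$), the cost of an edge $e=(u,v)$ is $1$ if $e$ is a $(+)$-edge whose endpoints are in different clusters, $1$ if $e$ is a $(-)$-edge whose endpoints are in the same cluster, and $0$ otherwise; the cost of $\mathcal{C}$ is the sum of costs of all edges. Correlation clustering asks for a clustering minimizing this cost; an $O(1)$-approximation is a clustering of cost at most a constant times the optimum. Adjacency-list access to $G^+$ means the algorithm can, in $O(1)$ time per query, ask (i) degree queries: the value $\deg^+(v)$ for a given $v$; (ii) neighbor queries: the $i$-th vertex of $N^+(v)$ for given $v$ and $i\le \deg^+(v)$. *)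

theory Defs
  imports
    "HOL-Probability.Probability"
    "HOL-Library.Landau_Symbols"
    "HOL-Library.Disjoint_Sets"
    "HOL-Library.Log_Nat"
begin

section \<open>Correlation clustering\<close>

datatype label = Plus | Minus

text \<open>
  The complete graph on a vertex set \<open>V\<close> has as edges the two-element subsets of \<open>V\<close>.  A labeled
  graph is given by \<open>V\<close> and a function \<open>lab\<close> whose values on sets that are not edges are never used.
\<close>

definition edges :: "'a set \<Rightarrow> 'a set set" where
  "edges V = {e. e \<subseteq> V \<and> card e = 2}"

definition pos_nbrs :: "'a set \<Rightarrow> ('a set \<Rightarrow> label) \<Rightarrow> 'a \<Rightarrow> 'a set" where
  "pos_nbrs V lab v = {u. {u, v} \<in> edges V \<and> lab {u, v} = Plus}"

definition same_cluster :: "'a set set \<Rightarrow> 'a set \<Rightarrow> bool" where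
  "same_cluster C e \<longleftrightarrow> (\<exists>K\<in>C. e \<subseteq> K)"

definition edge_cost :: "('a set \<Rightarrow> label) \<Rightarrow> 'a set set \<Rightarrow> 'a set \<Rightarrow> nat" where
  "edge_cost lab C e =
     (if lab e = Plus \<and> \<not> same_cluster C e then 1
      else if lab e = Minus \<and> same_cluster C e then 1
      else 0)"

definition cc_cost :: "'a set \<Rightarrow> ('a set \<Rightarrow> label) \<Rightarrow> 'a set set \<Rightarrow> nat" where
  "cc_cost V lab C = (\<Sum>e\<in>edges V. edge_cost lab C e)"

definition cc_opt :: "'a set \<Rightarrow> ('a set \<Rightarrow> label) \<Rightarrow> nat" where
  "cc_opt V lab = Min {cc_cost V lab C | C. partition_on V C}"

lemma finite_cc_costs:
  assumes "finite V"
  shows "finite {cc_cost V lab C | C. partition_on V C}"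
proof -
  have "{C. partition_on V C} \<subseteq> Pow (Pow V)"
    by (auto simp: partition_on_def)
  then have "finite {C. partition_on V C}"
    using assms by (meson finite_Pow_iff finite_subset)
  then show ?thesis by simp
qed

lemma cc_opt_le:
  assumes "finite V" "partition_on V C"
  shows "cc_opt V lab \<le> cc_cost V lab C"
  unfolding cc_opt_def using assms by (intro Min_le finite_cc_costs) auto

lemma cc_opt_attained:
  assumes "finite V"
  shows "\<exists>C. partition_on V C \<and> cc_cost V lab C = cc_opt V lab"
proof -
  have "partition_on V ((\<lambda>v. {v}) ` V)"
    by (auto simp: partition_on_def disjoint_def)
  then have "{cc_cost V lab C | C. partition_on V C} \<noteq> {}" by blast
  from Min_in[OF finite_cc_costs[OF assms] this] show ?thesis
    unfolding cc_opt_def by auto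
qed

section \<open>Adjacency lists of the positive subgraph\<close>

text \<open>
  The vertices of an \<open>n\<close>-vertex input are \<open>0, \<dots>, n - 1\<close>.  The order of each neighbor list is
  arbitrary.
\<close>

definition adjacency_lists :: "nat \<Rightarrow> (nat set \<Rightarrow> label) \<Rightarrow> (nat \<Rightarrow> nat list) \<Rightarrow> bool" where
  "adjacency_lists n lab adj \<longleftrightarrow>
     (\<forall>v<n. distinct (adj v) \<and> set (adj v) = pos_nbrs {..<n} lab v)"

section \<open>A randomized word RAM with adjacency-list access\<close>

text \<open>
  Algorithms are programs of a unit-cost word RAM.  Registers, memory cells and addresses are
  \<open>w\<close>-bit words, i.e. natural numbers below \<open>2 ^ w\<close>; every result is reduced modulo \<open>2 ^ w\<close>.
  The only operands of commands are registers and literal constants, so that a program, being a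
  finite term, uses finitely many registers and is independent of the input and of its size.
\<close>

type_synonym reg = nat

datatype binop = Add | Sub | Mul | Div | Mod | Less | Eq

text \<open>Subtraction is truncated at \<open>0\<close>; division and remainder by \<open>0\<close> are those of type \<open>nat\<close>.\<close>

fun apply_binop :: "binop \<Rightarrow> nat \<Rightarrow> nat \<Rightarrow> nat" where
  "apply_binop Add x y = x + y"
| "apply_binop Sub x y = x - y"
| "apply_binop Mul x y = x * y"
| "apply_binop Div x y = x div y"
| "apply_binop Mod x y = x mod y"
| "apply_binop Less x y = (if x < y then 1 else 0)"
| "apply_binop Eq x y = (if x = y then 1 else 0)"

datatype com =
    Skip
  | Imm reg nat              \<comment> \<open>load a literal constant\<close>
  | Binop binop reg reg reg  \<comment> \<open>target register first\<close>
  | Load reg reg             \<comment> \<open>target register, register holding the address\<close>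
  | Store reg reg            \<comment> \<open>register holding the address, source register\<close>
  | Rand reg reg             \<comment> \<open>uniform element of \<open>{0..<b}\<close>, \<open>b\<close> the content of the second register\<close>
  | Degree reg reg           \<comment> \<open>degree query; target register, vertex\<close>
  | Neighbor reg reg reg     \<comment> \<open>neighbor query; target register, vertex, index\<close>
  | Seq com com
  | Cond reg com com         \<comment> \<open>branch on whether the register is nonzero\<close>
  | While reg com            \<comment> \<open>iterate as long as the register is nonzero\<close>

record state =
  regs :: "reg \<Rightarrow> nat"
  mem :: "nat \<Rightarrow> nat"
  queries :: nat

text \<open>
  A configuration consists of the stack of commands still to be executed and the state.
  The machine has halted when the stack is empty.
\<close>

type_synonym config = "com list \<times> state"

definition halted :: "config \<Rightarrow> bool" where
  "halted \<sigma> \<longleftrightarrow> fst \<sigma> = []"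

definition set_reg :: "nat \<Rightarrow> reg \<Rightarrow> nat \<Rightarrow> state \<Rightarrow> state" where
  "set_reg w r x s = s\<lparr>regs := (regs s)(r := x mod 2 ^ w)\<rparr>"

definition set_mem :: "nat \<Rightarrow> nat \<Rightarrow> state \<Rightarrow> state" where
  "set_mem a x s = s\<lparr>mem := (mem s)(a := x)\<rparr>"

definition count_query :: "state \<Rightarrow> state" where
  "count_query s = s\<lparr>queries := queries s + 1\<rparr>"

text \<open>Neighbor lists are indexed from \<open>0\<close>.  Ill-formed queries are answered by \<open>0\<close>.\<close>

definition degree_answer :: "nat \<Rightarrow> (nat \<Rightarrow> nat list) \<Rightarrow> nat \<Rightarrow> nat" where
  "degree_answer n adj v = (if v < n then length (adj v) else 0)"

definition neighbor_answer :: "nat \<Rightarrow> (nat \<Rightarrow> nat list) \<Rightarrow> nat \<Rightarrow> nat \<Rightarrow> nat" where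
  "neighbor_answer n adj v i = (if v < n \<and> i < length (adj v) then adj v ! i else 0)"

text \<open>
  One time step, for word length \<open>w\<close> and a graph with vertices \<open>0, \<dots>, n - 1\<close>.  A random choice from
  an empty range yields \<open>0\<close>.
\<close>

fun step :: "nat \<Rightarrow> nat \<Rightarrow> (nat \<Rightarrow> nat list) \<Rightarrow> config \<Rightarrow> config pmf" where
  "step w n adj ([], s) = return_pmf ([], s)"
| "step w n adj (Skip # cs, s) = return_pmf (cs, s)"
| "step w n adj (Imm r k # cs, s) = return_pmf (cs, set_reg w r k s)"
| "step w n adj (Binop f r a b # cs, s) =
     return_pmf (cs, set_reg w r (apply_binop f (regs s a) (regs s b)) s)"
| "step w n adj (Load r a # cs, s) = return_pmf (cs, set_reg w r (mem s (regs s a)) s)"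
| "step w n adj (Store a r # cs, s) = return_pmf (cs, set_mem (regs s a) (regs s r) s)"
| "step w n adj (Rand r b # cs, s) =
     (if regs s b = 0 then return_pmf (cs, set_reg w r 0 s)
      else map_pmf (\<lambda>x. (cs, set_reg w r x s)) (pmf_of_set {..<regs s b}))"
| "step w n adj (Degree r v # cs, s) =
     return_pmf (cs, count_query (set_reg w r (degree_answer n adj (regs s v)) s))"
| "step w n adj (Neighbor r v i # cs, s) =
     return_pmf (cs, count_query (set_reg w r (neighbor_answer n adj (regs s v) (regs s i)) s))"
| "step w n adj (Seq c d # cs, s) = return_pmf (c # d # cs, s)"
| "step w n adj (Cond r c d # cs, s) =
     return_pmf ((if regs s r \<noteq> 0 then c else d) # cs, s)"
| "step w n adj (While r c # cs, s) =
     return_pmf (if regs s r \<noteq> 0 then c # While r c # cs else cs, s)"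

text \<open>Register \<open>0\<close> initially contains \<open>n\<close>; all other registers and the memory contain \<open>0\<close>.\<close>

definition init_state :: "nat \<Rightarrow> state" where
  "init_state n = \<lparr>regs = (\<lambda>_. 0)(0 := n), mem = (\<lambda>_. 0), queries = 0\<rparr>"

text \<open>Distribution of the configuration after \<open>t\<close> time steps.\<close>

definition run :: "com \<Rightarrow> nat \<Rightarrow> nat \<Rightarrow> (nat \<Rightarrow> nat list) \<Rightarrow> nat \<Rightarrow> config pmf" where
  "run p w n adj t = ((\<lambda>D. bind_pmf D (step w n adj)) ^^ t) (return_pmf ([p], init_state n))"

text \<open>
  Words of length \<open>O(log n)\<close>: \<open>floorlog 2 n\<close> is the number of binary digits of \<open>n\<close>.
\<close>

definition word_length :: "nat \<Rightarrow> nat \<Rightarrow> nat" where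
  "word_length c n = c * floorlog 2 n"

text \<open>
  Memory cell \<open>v\<close> of the final configuration holds the identifier of the cluster of vertex \<open>v\<close>.
\<close>

definition output_clustering :: "nat \<Rightarrow> config \<Rightarrow> nat set set" where
  "output_clustering n \<sigma> =
     (\<lambda>u. {v \<in> {..<n}. mem (snd \<sigma>) v = mem (snd \<sigma>) u}) ` {..<n}"

lemma partition_on_output_clustering:
  "partition_on {..<n} (output_clustering n \<sigma>)"
  by (auto simp: partition_on_def disjoint_def output_clustering_def)

end

theory Submission
  imports Defs
begin

text \<open>
  Let \<open>K\<close> be a large multiple of the number of digits of \<open>n\<close>.  Every vertex draws \<open>2 * K\<close> uniform
  samples from its closed positive neighborhood; they are stored, so that the many tests below cost
  time but no queries.  A vertex \<open>v\<close> that occurs among its own first \<open>K\<close> samples is a candidate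
  center.  Exploring it costs \<open>deg v\<close> queries and happens with probability about \<open>K / deg v\<close>, hence by
  a Chernoff bound a total budget of \<open>3 * n * K\<close> suffices.  The core of \<open>v\<close> consists of the neighbors
  that are not of much smaller degree and have nine tenths of their first samples in the neighborhood
  of \<open>v\<close>.  If the core is nearly the whole neighborhood, then its unlabelled vertices are labelled by
  \<open>v\<close>.  Finally every vertex joins the label held by the majority of its last \<open>K\<close> samples, unless the
  degree of the center is much larger, and is a singleton if there is no such label.  Fresh samples
  are used here because the labels depend on the first ones.

  The cost is compared with an optimal clustering, vertex by vertex.  Output clusters have size
  \<open>O(deg v)\<close> for each member \<open>v\<close>, so a vertex whose neighborhood differs from its optimal cluster in a
  constant fraction (a bad vertex) pays for itself, and the bad vertices of an optimal cluster \<open>Q\<close> pay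
  for all of \<open>Q\<close> if they are a constant fraction of \<open>Q\<close>.  Otherwise all good vertices of \<open>Q\<close> enter the
  same output cluster: the vertices of \<open>Q\<close> missing there are bad, and any additional vertex has a
  number of neighbors in \<open>Q\<close> proportional to the size of \<open>Q\<close>, all of which are errors of the optimum.
\<close>

section \<open>Executing programs\<close>

text \<open>Two requirements of the model shape the construction. The time and query bounds must
  hold for every outcome of the random choices; hence the program itself enforces the budget, and
  only the cost guarantee depends on luck. Moreover, a run is a distribution, whereas reasoning
  about loops wants a single state; so all random choices are made in one initial loop whose passes
  have constant duration, and everything after it is a deterministic function of the sample array.
  The run is then the image of a product distribution, and probabilities concern sample arrays only.

  Sampling estimates fractions of neighborhoods up to 1/20. A threshold of 9/10 thus certifies 85
  percent and is surely passed from 95 percent on; a majority certifies 45 percent and is surely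
  reached from 60 percent on. The comparison with the optimum works with these gaps. The degree
  comparisons, 11/10 for cores and 5/4 for votes, keep a center from attracting vertices of much
  smaller degree, which could not pay for a cluster of its size. With \<open>K\<close> equal to 1200
  times the number of digits, an estimate fails with probability at most
  \<open>2 * exp (- (K / 200))\<close>, which survives a union bound over quadratically many
  estimates.\<close>

locale word_ram =
  fixes w n :: nat and adj :: "nat \<Rightarrow> nat list"
begin

text \<open>\<open>run\<close> appends each step at the end. Peeling off the first step instead lets
  an execution be followed along the command stack.\<close>

fun runs :: "nat \<Rightarrow> config \<Rightarrow> config pmf" where
  "runs 0 \<sigma> = return_pmf \<sigma>"
| "runs (Suc k) \<sigma> = bind_pmf (step w n adj \<sigma>) (runs k)"

lemma runs_add: "runs (j + k) \<sigma> = bind_pmf (runs j \<sigma>) (runs k)"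
  by (induction j arbitrary: \<sigma>)
    (auto simp: bind_return_pmf bind_assoc_pmf intro!: bind_pmf_cong)

lemma runs_1: "runs (Suc 0) = step w n adj"
proof
  have "runs 0 = return_pmf" by (rule ext) simp
  then show "runs (Suc 0) \<sigma> = step w n adj \<sigma>" for \<sigma> by (simp add: bind_return_pmf')
qed

lemma runs_halted: "runs k ([], s) = return_pmf ([], s)"
  by (induction k) (simp_all add: bind_return_pmf)

lemma run_eq_runs: "run p w n adj t = runs t ([p], init_state n)"
proof (induction t)
  case (Suc t)
  have "run p w n adj (Suc t) = bind_pmf (runs t ([p], init_state n)) (step w n adj)"
    using Suc by (simp add: run_def)
  also have "\<dots> = runs (t + Suc 0) ([p], init_state n)" by (simp only: runs_add runs_1)
  finally show ?case by simp
qed (simp add: run_def)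

text \<open>The number of steps \<open>k\<close> must not depend on the random choices.\<close>

definition yields :: "com \<Rightarrow> state \<Rightarrow> nat \<Rightarrow> state pmf \<Rightarrow> bool" where
  "yields c s k D \<longleftrightarrow> (\<forall>cs. runs k (c # cs, s) = map_pmf (Pair cs) D)"

lemma yields_step:
  assumes "\<And>cs. step w n adj (c # cs, s) = map_pmf (Pair cs) D"
  shows "yields c s 1 D"
  using assms by (simp add: yields_def One_nat_def runs_1 del: runs.simps)

lemma yields_Seq:
  assumes "yields c s k D" "\<And>s'. s' \<in> set_pmf D \<Longrightarrow> yields d s' k' (E s')"
  shows "yields (Seq c d) s (Suc (k + k')) (bind_pmf D E)"
proof -
  have "runs (k + k') (c # d # cs, s) = map_pmf (Pair cs) (bind_pmf D E)" for cs
    using assms unfolding yields_def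
    by (simp add: runs_add map_pmf_def bind_assoc_pmf bind_return_pmf cong: bind_pmf_cong)
  then show ?thesis by (simp add: yields_def bind_return_pmf)
qed

lemma yields_While_True:
  assumes "regs s r \<noteq> 0" "yields c s k D" "\<And>s'. s' \<in> set_pmf D \<Longrightarrow> yields (While r c) s' k' (E s')"
  shows "yields (While r c) s (Suc (k + k')) (bind_pmf D E)"
proof -
  have "runs (k + k') (c # While r c # cs, s) = map_pmf (Pair cs) (bind_pmf D E)" for cs
    using assms unfolding yields_def
    by (simp add: runs_add map_pmf_def bind_assoc_pmf bind_return_pmf cong: bind_pmf_cong)
  then show ?thesis using assms(1) by (simp add: yields_def bind_return_pmf)
qed

lemma yields_While_False: "regs s r = 0 \<Longrightarrow> yields (While r c) s 1 (return_pmf s)"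
  by (rule yields_step) simp

lemma yields_Cond:
  assumes "yields (if regs s r \<noteq> 0 then c else d) s k D"
  shows "yields (Cond r c d) s (Suc k) D"
  using assms by (simp add: yields_def bind_return_pmf)

text \<open>
  Weakest preconditions for code without random choices; the first argument of a postcondition is
  the current time.
\<close>

primrec wp :: "com \<Rightarrow> (nat \<Rightarrow> state \<Rightarrow> bool) \<Rightarrow> nat \<Rightarrow> state \<Rightarrow> bool" where
  "wp Skip Q = (\<lambda>t s. Q (Suc t) s)"
| "wp (Imm r k) Q = (\<lambda>t s. Q (Suc t) (set_reg w r k s))"
| "wp (Binop f r a b) Q =
     (\<lambda>t s. Q (Suc t) (set_reg w r (apply_binop f (regs s a) (regs s b)) s))"
| "wp (Load r a) Q = (\<lambda>t s. Q (Suc t) (set_reg w r (mem s (regs s a)) s))"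
| "wp (Store a r) Q = (\<lambda>t s. Q (Suc t) (set_mem (regs s a) (regs s r) s))"
| "wp (Rand r b) Q = (\<lambda>t s. False)"
| "wp (Degree r v) Q =
     (\<lambda>t s. Q (Suc t) (count_query (set_reg w r (degree_answer n adj (regs s v)) s)))"
| "wp (Neighbor r v i) Q =
     (\<lambda>t s. Q (Suc t)
       (count_query (set_reg w r (neighbor_answer n adj (regs s v) (regs s i)) s)))"
| "wp (Seq c d) Q = (\<lambda>t s. wp c (wp d Q) (Suc t) s)"
| "wp (Cond r c d) Q = (\<lambda>t s. if regs s r \<noteq> 0 then wp c Q (Suc t) s else wp d Q (Suc t) s)"
| "wp (While r c) Q =
     lfp (\<lambda>W t s. if regs s r \<noteq> 0 then wp c W (Suc t) s else Q (Suc t) s)"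

lemma wp_mono: "Q \<le> R \<Longrightarrow> wp c Q \<le> wp c R"
proof (induction c arbitrary: Q R)
  case (While r c)
  show ?case unfolding wp.simps
    by (rule lfp_mono) (use While.prems in \<open>auto simp: le_fun_def\<close>)
next
  case (Seq c d)
  from Seq.IH(1)[OF Seq.IH(2)[OF Seq.prems]] show ?case by (auto simp: le_fun_def)
next
  case (Cond r c d)
  from Cond.IH[OF Cond.prems] show ?case by (simp add: le_fun_def)
qed (auto simp: le_fun_def)

lemma wp_While_unfold:
  "wp (While r c) Q t s =
     (if regs s r \<noteq> 0 then wp c (wp (While r c) Q) (Suc t) s else Q (Suc t) s)"
proof -
  have "mono (\<lambda>W t s. if regs s r \<noteq> 0 then wp c W (Suc t) s else Q (Suc t) s)"
  proof (rule monoI)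
    fix W W' :: "nat \<Rightarrow> state \<Rightarrow> bool"
    assume "W \<le> W'"
    from wp_mono[OF this, of c]
    show "(\<lambda>t s. if regs s r \<noteq> 0 then wp c W (Suc t) s else Q (Suc t) s)
        \<le> (\<lambda>t s. if regs s r \<noteq> 0 then wp c W' (Suc t) s else Q (Suc t) s)"
      by (simp add: le_fun_def)
  qed
  from lfp_unfold[OF this] have "wp (While r c) Q =
      (\<lambda>t s. if regs s r \<noteq> 0 then wp c (wp (While r c) Q) (Suc t) s else Q (Suc t) s)"
    unfolding wp.simps .
  from fun_cong[OF fun_cong[OF this]] show ?thesis .
qed

lemma yields_return:
  assumes "\<And>cs. step w n adj (c # cs, s) = return_pmf (cs, s')" "Q (Suc t) s'"
  shows "\<exists>k s'. yields c s k (return_pmf s') \<and> Q (t + k) s'"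
  using yields_step[of c s "return_pmf s'"] assms by (intro exI[of _ "1::nat"] exI[of _ s']) simp

text \<open>Total correctness: the clause for \<open>While\<close> is a least fixed point, so
  \<open>wp\<close> includes termination, and code without random choices reaches a single state
  after a definite number of steps.\<close>

lemma wp_sound:
  "wp c Q t s \<Longrightarrow> \<exists>k s'. yields c s k (return_pmf s') \<and> Q (t + k) s'"
proof (induction c arbitrary: Q t s)
  case (Seq c d)
  from Seq.prems have "wp c (wp d Q) (Suc t) s" by simp
  from Seq.IH(1)[OF this] obtain k s1
    where 1: "yields c s k (return_pmf s1)" "wp d Q (Suc t + k) s1"
    by blast
  from Seq.IH(2)[OF 1(2)] obtain k' s2
    where 2: "yields d s1 k' (return_pmf s2)" "Q (Suc t + k + k') s2"
    by blast
  have "yields (Seq c d) s (Suc (k + k')) (return_pmf s2)"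
    using yields_Seq[OF 1(1), of d k' "\<lambda>_. return_pmf s2"] 2(1) by (simp add: bind_return_pmf)
  with 2(2) show ?case by (metis add.assoc add_Suc_shift)
next
  case (Cond r c d)
  have "\<exists>k s'. yields (if regs s r \<noteq> 0 then c else d) s k (return_pmf s') \<and> Q (Suc t + k) s'"
    using Cond.IH(1)[of Q "Suc t" s] Cond.IH(2)[of Q "Suc t" s] Cond.prems
    by (cases "regs s r = 0") simp_all
  then obtain k s' where "yields (if regs s r \<noteq> 0 then c else d) s k (return_pmf s')"
    and Q: "Q (Suc t + k) s'"
    by blast
  from yields_Cond[OF this(1)] Q show ?case by (metis add.assoc add_Suc_shift)
next
  case (While r c)
  let ?P = "\<lambda>t s. \<exists>k s'. yields (While r c) s k (return_pmf s') \<and> Q (t + k) s'"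
  \<comment> \<open>Soundness, read as a predicate of time and state, is a prefixed point of the
    loop functional and hence lies above the least fixed point.\<close>
  have "wp (While r c) Q \<le> ?P"
    unfolding wp.simps
  proof (rule lfp_lowerbound, intro le_funI le_boolI)
    fix t s assume *: "if regs s r \<noteq> 0 then wp c ?P (Suc t) s else Q (Suc t) s"
    show "?P t s"
    proof (cases "regs s r = 0")
      case True
      with * have "Q (Suc t) s" by simp
      with yields_While_False[OF True] show ?thesis
        by (intro exI[of _ "1::nat"] exI[of _ s]) simp
    next
      case False
      with * have "wp c ?P (Suc t) s" by simp
      from While.IH[OF this] obtain k s1
        where 1: "yields c s k (return_pmf s1)" and "?P (Suc t + k) s1"
        by blast
      then obtain k' s2
        where 2: "yields (While r c) s1 k' (return_pmf s2)" "Q (Suc t + k + k') s2"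
        by blast
      have "yields (While r c) s (Suc (k + k')) (return_pmf s2)"
        using yields_While_True[OF False 1(1), of k' "\<lambda>_. return_pmf s2"] 2(1)
        by (simp add: bind_return_pmf)
      with 2(2) show ?thesis by (metis add.assoc add_Suc_shift)
    qed
  qed
  with While.prems show ?case by (simp add: le_fun_def)
next
  case Skip
  then show ?case
    by (intro yields_return[of _ _ "s"]) simp_all
next
  case (Imm r k)
  then show ?case
    by (intro yields_return[of _ _ "set_reg w r k s"]) simp_all
next
  case (Binop f r a b)
  then show ?case
    by (intro yields_return[of _ _ "set_reg w r (apply_binop f (regs s a) (regs s b)) s"]) simp_all
next
  case (Load r a)
  then show ?case
    by (intro yields_return[of _ _ "set_reg w r (mem s (regs s a)) s"]) simp_all
next
  case (Store a r)
  then show ?case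
    by (intro yields_return[of _ _ "set_mem (regs s a) (regs s r) s"]) simp_all
next
  case (Degree r v)
  then show ?case
    by (intro yields_return[of _ _ "count_query (set_reg w r (degree_answer n adj (regs s v)) s)"]) simp_all
next
  case (Neighbor r v i)
  then show ?case
    by (intro yields_return[of _ _ "count_query (set_reg w r (neighbor_answer n adj (regs s v) (regs s i)) s)"]) simp_all
qed simp

lemma wp_weaken: "wp c Q t s \<Longrightarrow> (\<And>t s. Q t s \<Longrightarrow> R t s) \<Longrightarrow> wp c R t s"
  using wp_mono[of Q R c] by (auto simp: le_fun_def)

end

text \<open>Register \<open>7\<close> is assumed to contain \<open>1\<close>.\<close>

definition loop_rest :: "reg \<Rightarrow> reg \<Rightarrow> com \<Rightarrow> com" where
  "loop_rest i b c = While 39 (Seq c (Seq (Binop Add i i 7) (Binop Less 39 i b)))"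

text \<open>All loops share the flag register \<open>39\<close>, even when nested: it is recomputed
  after each pass of the body, immediately before it is tested again.\<close>

definition forloop :: "reg \<Rightarrow> reg \<Rightarrow> com \<Rightarrow> com" where
  "forloop i b c = Seq (Imm i 0) (Seq (Binop Less 39 i b) (loop_rest i b c))"

context word_ram
begin

lemma wp_loop_rest:
  "wp (loop_rest i b c) Q t s =
     (if regs s 39 \<noteq> 0
      then wp c (wp (Seq (Binop Add i i 7) (Binop Less 39 i b)) (wp (loop_rest i b c) Q)) (Suc (Suc t)) s
      else Q (Suc t) s)"
  unfolding loop_rest_def
  by (subst wp_While_unfold) (simp del: wp.simps(11))

text \<open>The invariant carries the clock. Setting up the loop takes four steps, and each pass
  spends two steps before the body and three after it. \<open>stable\<close> makes the invariant
  insensitive to the counter and the flag, which the loop itself overwrites.\<close>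

lemma wp_forloop:
  assumes regs: "regs s b = N" "N < 2 ^ w" "regs s 7 = 1"
    and ib: "b \<noteq> i" "b \<noteq> 39" "i \<noteq> 39" "i \<noteq> 7"
    and init: "I 0 (Suc (Suc (Suc (Suc t)))) s"
    and stable: "\<And>k t s x y. I k t s \<Longrightarrow> I k t (s\<lparr>regs := (regs s)(i := x, 39 := y)\<rparr>)"
    and step: "\<And>k t s. k < N \<Longrightarrow> I k t s \<Longrightarrow> regs s i = k \<Longrightarrow> regs s b = N \<Longrightarrow> regs s 7 = 1 \<Longrightarrow>
        wp c (\<lambda>t' s'. I (Suc k) (Suc (Suc (Suc t'))) s' \<and> regs s' i = k \<and> regs s' b = N \<and> regs s' 7 = 1)
          (Suc (Suc t)) s"
    and final: "\<And>t s. I N t s \<Longrightarrow> regs s b = N \<Longrightarrow> regs s 7 = 1 \<Longrightarrow> Q (Suc t) s"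
  shows "wp (forloop i b c) Q t s"
proof -
  have w: "1 < (2::nat) ^ w" if "0 < N" using regs(2) that by linarith
  have loop: "wp (loop_rest i b c) Q t s"
    if "N - k = m" "k \<le> N" "I k t s" "regs s i = k" "regs s b = N" "regs s 7 = 1"
       "regs s 39 = (if k < N then 1 else 0)"
    for m k t s
    using that
  proof (induction m arbitrary: k t s)
    case 0
    with final show ?case by (simp add: wp_loop_rest)
  next
    case (Suc m)
    have k: "k < N" using Suc.prems by simp
    have mods: "Suc k mod 2 ^ w = Suc k" "1 mod 2 ^ w = (1::nat)"
      using k regs(2) by (simp, cases w) auto
    have "wp c (wp (Seq (Binop Add i i 7) (Binop Less 39 i b)) (wp (loop_rest i b c) Q)) (Suc (Suc t)) s"
    proof (rule wp_weaken[OF step[OF k Suc.prems(3-6)]])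
      fix t' s'
      assume *: "I (Suc k) (Suc (Suc (Suc t'))) s' \<and> regs s' i = k \<and> regs s' b = N \<and> regs s' 7 = 1"
      define s2 where "s2 = s'\<lparr>regs := (regs s')(i := Suc k, 39 := if Suc k < N then 1 else 0)\<rparr>"
      have I: "I (Suc k) (Suc (Suc (Suc t'))) s2" unfolding s2_def by (intro stable) (use * in simp)
      have "wp (loop_rest i b c) Q (Suc (Suc (Suc t'))) s2"
      proof (rule Suc.IH[of "Suc k"])
        show "N - Suc k = m" "Suc k \<le> N" using Suc.prems(1) k by simp_all
        show "regs s2 i = Suc k" "regs s2 b = N" "regs s2 7 = 1"
          "regs s2 39 = (if Suc k < N then 1 else 0)"
          using * ib by (simp_all add: s2_def)
      qed (fact I)
      moreover have "set_reg w 39 (if Suc k < N then 1 else 0) (set_reg w i (Suc k) s') = s2"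
        using mods by (simp add: s2_def set_reg_def)
      moreover have "regs (set_reg w i (Suc k) s') i = Suc k" "regs (set_reg w i (Suc k) s') b = N"
        using mods * ib by (simp_all add: set_reg_def)
      ultimately show "wp (Seq (Binop Add i i 7) (Binop Less 39 i b))
          (wp (loop_rest i b c) Q) t' s'"
        using * by simp
    qed
    with k Suc.prems(7) show ?case by (simp add: wp_loop_rest)
  qed
  define s2 where "s2 = s\<lparr>regs := (regs s)(i := 0, 39 := if 0 < N then 1 else 0)\<rparr>"
  have "wp (loop_rest i b c) Q (Suc (Suc (Suc (Suc t)))) s2"
  proof (rule loop[of 0 N])
    show "I 0 (Suc (Suc (Suc (Suc t)))) s2" unfolding s2_def by (rule stable[OF init])
    show "regs s2 i = 0" "regs s2 b = N" "regs s2 7 = 1" "regs s2 39 = (if 0 < N then 1 else 0)"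
      using regs ib by (simp_all add: s2_def)
  qed simp_all
  moreover have "set_reg w 39 (if 0 < N then 1 else 0) (set_reg w i 0 s) = s2"
    using w by (auto simp: s2_def set_reg_def)
  moreover have "regs (set_reg w i 0 s) i = 0" "regs (set_reg w i 0 s) b = N"
    using regs ib by (simp_all add: set_reg_def)
  moreover have "wp (forloop i b c) Q t s =
      wp (loop_rest i b c) Q (Suc (Suc (Suc (Suc t)))) (set_reg w 39
        (if regs (set_reg w i 0 s) i < regs (set_reg w i 0 s) b then 1 else 0) (set_reg w i 0 s))"
    unfolding forloop_def wp.simps apply_binop.simps by (rule refl)
  ultimately show ?thesis by (simp only:)
qed

end

section \<open>The program\<close>

fun seqs :: "com list \<Rightarrow> com" where
  "seqs [] = Skip"
| "seqs [c] = c"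
| "seqs (c # d # cs) = Seq c (seqs (d # cs))"

text \<open>
  Registers \<open>0\<close>, \<open>2\<close>, \<open>3\<close>, \<open>5\<close>, \<open>6\<close> and \<open>7\<close> contain \<open>n\<close>, \<open>K\<close>, \<open>2 * K\<close>, \<open>4\<close>, \<open>2 * n * K\<close> and \<open>1\<close>
  throughout; register \<open>4\<close> contains the rest of the exploration budget.
  Four arrays are interleaved in the memory behind the output cells: the samples (tag \<open>0\<close>), the
  labels (tag \<open>1\<close>), the marks (tag \<open>2\<close>) and the flags (tag \<open>3\<close>).  Marks and flags are
  set to \<open>v + 1\<close> when the candidate center \<open>v\<close> is processed, so that they need not be cleared.
\<close>

definition aread :: "reg \<Rightarrow> nat \<Rightarrow> reg \<Rightarrow> com" where
  "aread r tag i =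
     seqs [Binop Mul 30 i 5, Binop Add 30 30 0, Imm 31 tag, Binop Add 30 30 31, Load r 30]"

definition awrite :: "nat \<Rightarrow> reg \<Rightarrow> reg \<Rightarrow> com" where
  "awrite tag i r =
     seqs [Binop Mul 30 i 5, Binop Add 30 30 0, Imm 31 tag, Binop Add 30 30 31, Store 30 r]"

text \<open>
  Register \<open>12\<close> contains the degree of \<open>v\<close>.  At this index the query is ill-formed and yields \<open>0\<close>,
  so the result is \<open>v\<close> itself: the code enumerates the closed neighborhood.
\<close>

definition get_nbr :: "reg \<Rightarrow> reg \<Rightarrow> reg \<Rightarrow> com" where
  "get_nbr r v i =
     seqs [Neighbor r v i, Binop Eq 20 i 12, Binop Mul 20 20 v, Binop Add r r 20]"

text \<open>Register \<open>14\<close> holds the first index of a block of \<open>K\<close> samples,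
  register \<open>11\<close> the value sought. With tag \<open>2\<close> this counts the samples
  marked by the current candidate, with tag \<open>1\<close> the votes for a label.\<close>

definition count :: "nat \<Rightarrow> com" where
  "count tag = Seq (Imm 15 0) (forloop 24 2
     (seqs [Binop Add 25 14 24, aread 25 0 25, aread 25 tag 25, Binop Eq 25 25 11,
        Binop Add 15 15 25]))"

definition parameters :: com where
  "parameters = seqs [Imm 7 1, Imm 20 2, Imm 21 0, Binop Add 22 0 21,
     While 22 (Seq (Binop Div 22 22 20) (Binop Add 21 21 7)),
     Imm 23 1200, Binop Mul 2 23 21, Binop Mul 3 20 2, Imm 23 3, Binop Mul 4 0 2,
     Binop Mul 4 4 23, Imm 5 4, Binop Mul 6 0 3]"

definition sampling_phase :: com where
  "sampling_phase = forloop 10 6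
     (Seq (seqs [Binop Div 11 10 3, Degree 12 11, Binop Add 13 12 7])
       (Seq (Rand 16 13) (Seq (get_nbr 17 11 16) (awrite 0 10 17))))"

definition mark_nbrs :: com where
  "mark_nbrs = forloop 16 13 (Seq (get_nbr 17 10 16) (awrite 2 17 11))"

text \<open>Register \<open>21\<close> adds up the flags of the two ways to fail, so it is zero
  exactly for core vertices.\<close>

definition test_nbrs :: com where
  "test_nbrs = forloop 16 13
     (seqs [get_nbr 17 10 16, Binop Mul 14 17 3, count 2, Degree 19 17, Binop Add 19 19 7,
        Imm 20 10, Binop Mul 21 20 15, Imm 22 9, Binop Mul 22 22 2, Binop Less 21 21 22,
        Binop Mul 20 20 13, Imm 22 11, Binop Mul 22 22 19, Binop Less 22 22 20,
        Binop Add 21 21 22, Cond 21 Skip (Seq (Binop Add 18 18 7) (awrite 3 17 11))])"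

text \<open>A separate pass over the flags left by \<open>test_nbrs\<close>: whether labels are
  written at all depends on the size of the whole core.\<close>

definition label_nbrs :: com where
  "label_nbrs = forloop 16 13
     (seqs [get_nbr 17 10 16, aread 21 3 17, Binop Eq 21 21 11, aread 22 1 17,
        Cond 21 (Cond 22 Skip (awrite 1 17 11)) Skip])"

definition explore :: com where
  "explore = seqs [Binop Sub 4 4 13, mark_nbrs, Imm 18 0, test_nbrs, Imm 20 10,
     Binop Mul 20 20 18, Imm 21 9, Binop Mul 21 21 13, Binop Less 20 20 21,
     Cond 20 Skip label_nbrs]"

text \<open>
  At the first count \<open>v\<close> is the only vertex with the mark \<open>v + 1\<close>, so \<open>v\<close> becomes a candidate
  center if it occurs among its own samples.
\<close>

definition clustering_phase :: com where
  "clustering_phase = forloop 10 0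
     (seqs [Binop Add 11 10 7, Degree 12 10, Binop Add 13 12 7, awrite 2 10 11,
        Binop Mul 14 10 3, count 2,
        Cond 15 (Seq (Binop Less 20 4 13) (Cond 20 Skip explore)) Skip])"

text \<open>Labels serve directly as cluster identifiers. The default \<open>u + n + 1\<close>
  exceeds all of them, so a vertex without an elected label becomes a singleton. Only labels of the
  ballots themselves are tried, each with a full count; these \<open>n * K\<close> counts of
  \<open>K\<close> votes are one source of the squared logarithm in the time bound.\<close>

definition voting_phase :: com where
  "voting_phase = forloop 10 0
     (seqs [Degree 12 10, Binop Add 13 12 7, Binop Mul 14 10 3, Binop Add 14 14 2,
        Binop Add 11 10 0, Binop Add 11 11 7, Store 10 11,
        forloop 16 2
         (seqs [Binop Add 17 14 16, aread 17 0 17, aread 11 1 17, count 1, Binop Add 18 15 15,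
            Binop Less 19 2 18, Binop Sub 21 11 7, Degree 22 21, Binop Add 22 22 7, Imm 23 4,
            Binop Mul 22 22 23, Imm 23 5, Binop Mul 23 23 13, Binop Less 23 23 22,
            Cond 11 (Cond 19 (Cond 23 Skip (Store 10 11)) Skip) Skip])])"

definition program :: com where
  "program = seqs [parameters, sampling_phase, clustering_phase, voting_phase]"

section \<open>Verification of the program\<close>

text \<open>\<open>word_bound\<close> leaves room for all addresses, counters and products in the
  tests, so that reductions modulo \<open>2 ^ w\<close> can be simplified away.\<close>

locale instance_ram = word_ram +
  fixes K :: nat
  assumes n_pos: "0 < n"
    and adj_distinct: "v < n \<Longrightarrow> distinct (adj v)"
    and adj_subset: "v < n \<Longrightarrow> set (adj v) \<subseteq> {..<n} - {v}"
    and word_bound: "100 * ((n + 1) * (K + 1)) < 2 ^ w"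
begin

section \<open>Memory layout and closed neighborhoods\<close>

definition "addr i tag = n + 4 * i + tag"

lemma addr_eq_iff:
  "tag < 4 \<Longrightarrow> tag' < 4 \<Longrightarrow> addr i tag = addr j tag' \<longleftrightarrow> i = j \<and> tag = tag'"
  unfolding addr_def by presburger

lemma addr_ge: "n \<le> addr i tag"
  by (simp add: addr_def)

definition arr :: "state \<Rightarrow> nat \<Rightarrow> nat \<Rightarrow> nat" where
  "arr s tag i = mem s (addr i tag)"

lemma arr_simps [simp]:
  "arr (s\<lparr>regs := f\<rparr>) = arr s" "arr (s\<lparr>queries := q\<rparr>) = arr s"
  by (auto simp: arr_def fun_eq_iff)

lemma bounds:
  "n < 2 ^ w" "K < 2 ^ w" "20 * n < 2 ^ w" "40 * K < 2 ^ w" "50 * (n * K) < 2 ^ w" "90 < (2::nat) ^ w"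
proof -
  have "100 * ((n + 1) * (K + 1)) = 100 * (n * K) + 100 * n + 100 * K + 100"
    by (simp add: algebra_simps)
  with word_bound show "n < 2 ^ w" "K < 2 ^ w" "20 * n < 2 ^ w" "40 * K < 2 ^ w"
    "50 * (n * K) < 2 ^ w" "90 < (2::nat) ^ w"
    by linarith+
qed

lemma w_pos [simp]: "0 < w"
  using bounds(6) by (cases w) auto

text \<open>The vertex itself is counted, so that \<open>deg v\<close> is positive and equals the
  size of the closed neighborhood.\<close>

definition deg :: "nat \<Rightarrow> nat" where
  "deg v = Suc (length (adj v))"

definition nb :: "nat \<Rightarrow> nat \<Rightarrow> nat" where
  "nb v i = (if i < length (adj v) then adj v ! i else v)"

definition nbhd :: "nat \<Rightarrow> nat set" where
  "nbhd v = insert v (set (adj v))"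

lemma nb_image: "nb v ` {..<deg v} = nbhd v"
proof -
  have "nb v ` {..<deg v} = insert (nb v (length (adj v))) (nb v ` {..<length (adj v)})"
    by (auto simp: deg_def lessThan_Suc)
  also have "nb v ` {..<length (adj v)} = (!) (adj v) ` {..<length (adj v)}"
    by (intro image_cong) (auto simp: nb_def)
  also have "\<dots> = set (adj v)" by (auto simp: set_conv_nth)
  finally show ?thesis by (simp add: nb_def nbhd_def)
qed

lemma nbhd_subset: "v < n \<Longrightarrow> nbhd v \<subseteq> {..<n}"
  using adj_subset by (auto simp: nbhd_def)

lemma finite_nbhd [simp]: "finite (nbhd v)"
  by (simp add: nbhd_def)

lemma card_nbhd: "v < n \<Longrightarrow> card (nbhd v) = deg v"
  using adj_subset[of v] adj_distinct[of v]
  by (auto simp: nbhd_def deg_def distinct_card card_insert_if)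

lemma deg_le: "v < n \<Longrightarrow> deg v \<le> n"
  using card_mono[OF _ nbhd_subset, of v] by (simp add: card_nbhd)

lemma inj_on_nb: "v < n \<Longrightarrow> inj_on (nb v) {..<deg v}"
  by (rule eq_card_imp_inj_on) (simp_all add: nb_image card_nbhd)

lemma nb_less: "v < n \<Longrightarrow> i < deg v \<Longrightarrow> nb v i < n"
  using nb_image[of v] nbhd_subset[of v] by auto

lemma add_Suc_time:
  "9 + t = Suc (Suc (Suc (Suc (Suc (Suc (Suc (Suc (Suc (t)))))))))"
  "7 + t = Suc (Suc (Suc (Suc (Suc (Suc (Suc (t)))))))"
  by simp_all

declare wp.simps [simp del]

lemma wp_steps [simp]:
  "wp Skip Q t s = Q (Suc t) s"
  "wp (Imm r k) Q t s = Q (Suc t) (set_reg w r k s)"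
  "wp (Binop f r a b) Q t s =
     Q (Suc t) (set_reg w r (apply_binop f (regs s a) (regs s b)) s)"
  "wp (Load r a) Q t s = Q (Suc t) (set_reg w r (mem s (regs s a)) s)"
  "wp (Store a r) Q t s = Q (Suc t) (set_mem (regs s a) (regs s r) s)"
  "wp (Degree r v) Q t s =
     Q (Suc t) (count_query (set_reg w r (degree_answer n adj (regs s v)) s))"
  "wp (Neighbor r v i) Q t s =
     Q (Suc t) (count_query (set_reg w r (neighbor_answer n adj (regs s v) (regs s i)) s))"
  "wp (Seq c d) Q t s = wp c (wp d Q) (Suc t) s"
  "wp (Cond r c d) Q t s = (if regs s r \<noteq> 0 then wp c Q (Suc t) s else wp d Q (Suc t) s)"
  "wp (seqs [c]) Q t s = wp c Q t s"
  "wp (seqs (c # d # cs)) Q t s = wp c (wp (seqs (d # cs)) Q) (Suc t) s"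
  by (simp_all add: wp.simps)

declare seqs.simps [simp del]

lemma wp_cong [cong]: "t = t' \<Longrightarrow> s = s' \<Longrightarrow> wp c Q t s = wp c Q t' s'"
  by simp

text \<open>There is no array with tag \<open>4\<close>; \<open>addr i 4\<close> serves as a common
  bound for the addresses of entry \<open>i\<close> in all four arrays.\<close>

lemma wp_aread [simp]:
  assumes "regs s 0 = n" "regs s 5 = 4" "tag < 4" "addr (regs s i) 4 < 2 ^ w"
    "arr s tag (regs s i) < 2 ^ w" "i \<noteq> 30" "i \<noteq> 31"
  shows "wp (aread r tag i) Q t s =
     Q (9 + t) (s\<lparr>regs := (regs s)(31 := tag, 30 := addr (regs s i) tag, r := arr s tag (regs s i))\<rparr>)"
  unfolding add_Suc_time aread_def using assms
  by (simp add: set_reg_def arr_def addr_def add_ac mult.commute[of _ 4])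

lemma wp_awrite [simp]:
  assumes "regs s 0 = n" "regs s 5 = 4" "tag < 4" "addr (regs s i) 4 < 2 ^ w"
    "i \<noteq> 30" "i \<noteq> 31" "r \<noteq> 30" "r \<noteq> 31"
  shows "wp (awrite tag i r) Q t s =
     Q (9 + t) (s\<lparr>regs := (regs s)(31 := tag, 30 := addr (regs s i) tag),
       mem := (mem s)(addr (regs s i) tag := regs s r)\<rparr>)"
  unfolding add_Suc_time awrite_def using assms
  by (simp add: set_reg_def set_mem_def addr_def add_ac mult.commute[of _ 4])

text \<open>What \<open>get_nbr\<close> leaves in register \<open>20\<close>: the correction that
  turns the answer to the ill-formed query into \<open>v\<close>. Naming it allows the final state
  to be stated exactly.\<close>

definition self_index :: "nat \<Rightarrow> nat \<Rightarrow> nat" where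
  "self_index v i = (if i = length (adj v) then v else 0)"

lemma wp_get_nbr [simp]:
  assumes "regs s 12 = length (adj (regs s v))" "regs s v < n" "regs s i < deg (regs s v)"
    "r \<noteq> 20" "v \<noteq> 20" "v \<noteq> r" "i \<noteq> r" "i \<noteq> 20" "r \<noteq> 12"
  shows "wp (get_nbr r v i) Q t s =
     Q (7 + t) (s\<lparr>queries := Suc (queries s),
       regs := (regs s)(20 := self_index (regs s v) (regs s i),
         r := nb (regs s v) (regs s i))\<rparr>)"
proof -
  have *: "nb (regs s v) (regs s i) < 2 ^ w" "regs s v < 2 ^ w"
    using nb_less[OF assms(2,3)] assms(2) bounds by linarith+
  from * assms show ?thesis
    unfolding add_Suc_time get_nbr_def
    by (auto simp: set_reg_def count_query_def neighbor_answer_def nb_def deg_def self_index_def)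
qed

definition env :: "state \<Rightarrow> bool" where
  "env s \<longleftrightarrow> regs s 0 = n \<and> regs s 2 = K \<and> regs s 3 = 2 * K \<and> regs s 5 = 4 \<and>
     regs s 6 = n * (2 * K) \<and> regs s 7 = 1"

definition wf_mem :: "(nat \<Rightarrow> nat) \<Rightarrow> state \<Rightarrow> bool" where
  "wf_mem X s \<longleftrightarrow> (\<forall>x < n * (2 * K). arr s 0 x = X x \<and> X x < n) \<and>
     (\<forall>u<n. arr s 1 u \<le> n \<and> arr s 2 u \<le> n \<and> arr s 3 u \<le> n)"

lemma addr_bound: "i < n * (2 * K) \<Longrightarrow> addr i 4 < 2 ^ w" "i < n \<Longrightarrow> addr i 4 < 2 ^ w"
  using bounds by (simp_all add: addr_def)

lemma card_less_Suc_conj: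
  "card {j. j < Suc k \<and> P j} = card {j. j < k \<and> P j} + (if P k then 1 else 0)"
proof -
  have "{j. j < Suc k \<and> P j} = {j. j < k \<and> P j} \<union> (if P k then {k} else {})"
    by (auto simp: less_Suc_eq)
  then show ?thesis by (auto simp: card_insert_if)
qed

lemma card_less_le: "card {j. j < k \<and> P j} \<le> k"
  using card_mono[of "{..<k}" "{j. j < k \<and> P j}"] by auto

lemma wp_count:
  fixes s :: state
  assumes env: "env s" and mem: "wf_mem X s" and tag: "tag = 1 \<or> tag = 2"
    and base: "regs s 14 = b" "b + K \<le> n * (2 * K)"
    and Q: "\<And>t' s'. t' \<le> t + 40 * (K + 1) \<Longrightarrow> mem s' = mem s \<Longrightarrow> queries s' = queries s \<Longrightarrow>
        \<forall>r. r \<notin> {15, 24, 25, 30, 31, 39} \<longrightarrow> regs s' r = regs s r \<Longrightarrow>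
        regs s' 15 = card {j. j < K \<and> arr s tag (X (b + j)) = regs s 11} \<Longrightarrow> Q t' s'"
  shows "wp (count tag) Q t s"
proof -
  define c where "c k = card {j. j < k \<and> arr s tag (X (b + j)) = regs s 11}" for k
  define I where "I k t' s' \<longleftrightarrow> t' \<le> t + 6 + 40 * k \<and> mem s' = mem s \<and> queries s' = queries s \<and>
     (\<forall>r. r \<notin> {15, 24, 25, 30, 31, 39} \<longrightarrow> regs s' r = regs s r) \<and> regs s' 15 = c k" for k t' and s' :: state
  have "wp (forloop 24 2 (seqs [Binop Add 25 14 24, aread 25 0 25, aread 25 tag 25, Binop Eq 25 25 11,
      Binop Add 15 15 25])) Q (Suc (Suc t)) (set_reg w 15 0 s)"
  proof (rule wp_forloop[where N = K and I = I])
    fix k t1 s1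
    assume k: "k < K" and I: "I k t1 s1" and i: "regs s1 24 = k" "regs s1 2 = K" "regs s1 7 = 1"
    have x: "b + k < n * (2 * K)" using k base by simp
    have e: "regs s1 0 = n" "regs s1 5 = 4" "regs s1 14 = b" "regs s1 11 = regs s 11"
      using I env base by (simp_all add: I_def env_def)
    have a: "arr s1 = arr s" using I by (auto simp: I_def arr_def fun_eq_iff)
    have X: "arr s 0 (b + k) = X (b + k)" "X (b + k) < n" "X (b + k) < 2 ^ w"
      using mem x bounds(1) by (auto simp: wf_mem_def)
    have l: "arr s tag (X (b + k)) < 2 ^ w"
      using mem X(2) tag bounds(1) by (fastforce simp: wf_mem_def)
    have tag4: "tag < 4" using tag by auto
    have bk: "b + k < 2 ^ w" using x bounds by linarith
    have ck: "c k \<le> k" unfolding c_def by (rule card_less_le)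
    then have cw: "Suc (c k) < 2 ^ w" "c k < 2 ^ w" using k bounds by linarith+
    show "wp (seqs [Binop Add 25 14 24, aread 25 0 25, aread 25 tag 25, Binop Eq 25 25 11,
        Binop Add 15 15 25]) (\<lambda>t' s'. I (Suc k) (Suc (Suc (Suc t'))) s' \<and> regs s' 24 = k \<and>
        regs s' 2 = K \<and> regs s' 7 = 1) (Suc (Suc t1)) s1"
      using I i e X l a tag4 addr_bound(1)[OF x] addr_bound(2)[OF X(2)] bk cw
      by (simp add: set_reg_def I_def card_less_Suc_conj[of k "\<lambda>j. arr s tag (X (b + j)) = regs s 11",
            folded c_def])
  next
    show "I 0 (Suc (Suc (Suc (Suc (Suc (Suc t)))))) (set_reg w 15 0 s)"
      by (simp add: I_def set_reg_def c_def)
  next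
    fix k t1 s1 x y
    assume "I k t1 s1"
    then show "I k t1 (s1\<lparr>regs := (regs s1)(24 := x, 39 := y)\<rparr>)" by (simp add: I_def)
  next
    fix t1 s1
    assume "I K t1 s1"
    then show "Q (Suc t1) s1" by (intro Q) (simp_all add: I_def c_def)
  qed (use env bounds in \<open>simp_all add: env_def set_reg_def\<close>)
  then show ?thesis unfolding count_def by simp
qed

section \<open>Exploring a candidate center and the clustering phase\<close>

definition hits :: "(nat \<Rightarrow> nat) \<Rightarrow> nat \<Rightarrow> nat set \<Rightarrow> nat" where
  "hits X u A = card {j. j < K \<and> X (u * (2 * K) + j) \<in> A}"

text \<open>The threshold 9/10 lies one sampling error of 1/20 above the 85 percent of
  \<open>core_sound\<close> and one below the 95 percent of \<open>core_complete\<close>.\<close>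

definition core :: "(nat \<Rightarrow> nat) \<Rightarrow> nat \<Rightarrow> nat set" where
  "core X v = {u \<in> nbhd v. 9 * K \<le> 10 * hits X u (nbhd v) \<and> 10 * deg v \<le> 11 * deg u}"

definition frame :: "reg set \<Rightarrow> state \<Rightarrow> state \<Rightarrow> bool" where
  "frame R s s' \<longleftrightarrow> (\<forall>r. r \<notin> R \<longrightarrow> regs s' r = regs s r)"

text \<open>One array is replaced as a whole while the other arrays and the output cells stay. The
  reference state \<open>s\<close> remains fixed, so the stores of a loop accumulate in
  \<open>f\<close> alone.\<close>

definition arr_upd :: "nat \<Rightarrow> (nat \<Rightarrow> nat) \<Rightarrow> state \<Rightarrow> state \<Rightarrow> bool" where
  "arr_upd tag f s s' \<longleftrightarrow> (\<forall>a<n. mem s' a = mem s a) \<and>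
     (\<forall>tag'<4. \<forall>i. arr s' tag' i = (if tag' = tag then f i else arr s tag' i))"

lemma arr_upd_refl: "tag < 4 \<Longrightarrow> mem s' = mem s \<Longrightarrow> f = arr s tag \<Longrightarrow> arr_upd tag f s s'"
  by (auto simp: arr_upd_def arr_def)

lemma arr_upd_store:
  assumes "arr_upd tag f s s'" "tag < 4" "f' = f(i := x)" "mem s2 = (mem s')(addr i tag := x)"
  shows "arr_upd tag f' s s2"
  using assms addr_ge[of i tag] by (auto simp: arr_upd_def arr_def addr_eq_iff)

lemma arr_upd_cong_mem: "arr_upd tag f s s' \<Longrightarrow> mem s2 = mem s' \<Longrightarrow> arr_upd tag f s s2"
  by (simp add: arr_upd_def arr_def)

lemma arr_upd_wf:
  assumes "arr_upd tag f s s'" "wf_mem X s" "tag \<noteq> 0" "\<And>i. i < n \<Longrightarrow> f i \<le> n"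
  shows "wf_mem X s'"
  using assms by (auto simp: arr_upd_def wf_mem_def)

lemma frame_env: "frame R s s' \<Longrightarrow> env s \<Longrightarrow> R \<inter> {0, 2, 3, 5, 6, 7} = {} \<Longrightarrow> env s'"
  unfolding frame_def env_def by (metis disjoint_iff insertCI)

lemma nb_image_Suc: "nb v ` {..<Suc k} = insert (nb v k) (nb v ` {..<k})"
  by (simp add: lessThan_Suc)

lemma wp_mark_nbrs:
  fixes s :: state
  assumes env: "env s" and v: "v < n" and mem: "wf_mem X s"
    and r: "regs s 10 = v" "regs s 11 = Suc v" "regs s 12 = length (adj v)" "regs s 13 = deg v"
    and Q: "\<And>t' s'. t' \<le> t + 10 + 40 * deg v \<Longrightarrow>
        arr_upd 2 (\<lambda>u. if u \<in> nbhd v then Suc v else arr s 2 u) s s' \<Longrightarrow>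
        queries s' = queries s + deg v \<Longrightarrow> frame {16, 17, 20, 30, 31, 39} s s' \<Longrightarrow> Q t' s'"
  shows "wp mark_nbrs Q t s"
proof -
  define f where "f k u = (if u \<in> nb v ` {..<k} then Suc v else arr s 2 u)" for k u
  define I where "I k t' s' \<longleftrightarrow> t' \<le> t + 5 + 40 * k \<and> arr_upd 2 (f k) s s' \<and>
     queries s' = queries s + k \<and> frame {16, 17, 20, 30, 31, 39} s s'" for k t' and s' :: state
  show ?thesis
    unfolding mark_nbrs_def
  proof (rule wp_forloop[where N = "deg v" and I = I])
    fix k t1 s1
    assume k: "k < deg v" and I: "I k t1 s1" and i: "regs s1 16 = k" "regs s1 13 = deg v" "regs s1 7 = 1"
    have e: "regs s1 0 = n" "regs s1 5 = 4" "regs s1 10 = v" "regs s1 11 = Suc v"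
       "regs s1 12 = length (adj v)"
      using I env r by (simp_all add: I_def env_def frame_def)
    note u = nb_less[OF v k]
    have fs: "f (Suc k) = (f k)(nb v k := Suc v)"
      by (auto simp: f_def nb_image_Suc fun_eq_iff)
    have st: "arr_upd 2 (f (Suc k)) s s2" if "mem s2 = (mem s1)(addr (nb v k) 2 := Suc v)" for s2
      by (rule arr_upd_store[OF _ _ fs that]) (use I in \<open>simp_all add: I_def\<close>)
    show "wp (Seq (get_nbr 17 10 16) (awrite 2 17 11))
        (\<lambda>t' s'. I (Suc k) (Suc (Suc (Suc t'))) s' \<and> regs s' 16 = k \<and>
          regs s' 13 = deg v \<and> regs s' 7 = 1) (Suc (Suc t1)) s1"
      using I i e v k u addr_bound(2)[OF u] st
      by (simp add: I_def frame_def)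
  next
    show "I 0 (Suc (Suc (Suc (Suc t)))) s"
      by (auto simp: I_def f_def fun_eq_iff frame_def intro!: arr_upd_refl)
  next
    fix k t1 s1 x y
    assume "I k t1 s1"
    then show "I k t1 (s1\<lparr>regs := (regs s1)(16 := x, 39 := y)\<rparr>)"
      by (auto simp: I_def frame_def intro: arr_upd_cong_mem)
  next
    fix t1 s1
    assume "I (deg v) t1 s1"
    moreover have "f (deg v) = (\<lambda>u. if u \<in> nbhd v then Suc v else arr s 2 u)"
      by (auto simp: f_def nb_image)
    ultimately show "Q (Suc t1) s1" by (intro Q) (simp_all add: I_def)
  qed (use env bounds deg_le[OF v] r in \<open>simp_all add: env_def\<close>)
qed

lemma wf_mem_simps [simp]:
  "wf_mem X (s\<lparr>regs := f\<rparr>) = wf_mem X s" "wf_mem X (s\<lparr>queries := q\<rparr>) = wf_mem X s"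
  by (simp_all add: wf_mem_def)

lemma arr_cong: "mem s' = mem s \<Longrightarrow> arr s' = arr s"
  by (auto simp: arr_def fun_eq_iff)

lemma mult_add_less: "u < n \<Longrightarrow> j < k \<Longrightarrow> u * k + j < n * (k :: nat)"
  using mult_le_mono1[of "Suc u" n k] by simp

lemma wp_test_nbrs:
  fixes s :: state
  assumes env: "env s" and v: "v < n" and mem: "wf_mem X s"
    and marks: "\<And>u. u < n \<Longrightarrow> arr s 2 u = Suc v \<longleftrightarrow> u \<in> nbhd v"
    and r: "regs s 10 = v" "regs s 11 = Suc v" "regs s 12 = length (adj v)" "regs s 13 = deg v"
       "regs s 18 = 0"
    and Q: "\<And>t' s'. t' \<le> t + 10 + (200 + 40 * K) * deg v \<Longrightarrow>
        arr_upd 3 (\<lambda>u. if u \<in> core X v then Suc v else arr s 3 u) s s' \<Longrightarrow>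
        queries s' = queries s + 2 * deg v \<Longrightarrow> regs s' 18 = card (core X v) \<Longrightarrow>
        frame {14, 15, 16, 17, 18, 19, 20, 21, 22, 24, 25, 30, 31, 39} s s' \<Longrightarrow> Q t' s'"
  shows "wp test_nbrs Q t s"
proof -
  let ?R = "{14, 15, 16, 17, 18, 19, 20, 21, 22, 24, 25, 30, 31, 39 :: reg}"
  define C where "C = core X v"
  have CN: "C \<subseteq> nbhd v" by (auto simp: C_def core_def)
  define f where "f k u = (if u \<in> nb v ` {..<k} \<inter> C then Suc v else arr s 3 u)" for k u
  define c where "c k = card {i. i < k \<and> nb v i \<in> C}" for k
  define I where "I k t' s' \<longleftrightarrow> t' \<le> t + 5 + (200 + 40 * K) * k \<and> arr_upd 3 (f k) s s' \<and>
     queries s' = queries s + 2 * k \<and> regs s' 18 = c k \<and> frame ?R s s'" for k t' and s' :: state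
  show ?thesis
    unfolding test_nbrs_def
  proof (rule wp_forloop[where N = "deg v" and I = I])
    fix k t1 s1
    assume k: "k < deg v" and I: "I k t1 s1" and i: "regs s1 16 = k" "regs s1 13 = deg v" "regs s1 7 = 1"
    have fr: "frame ?R s s1" using I by (simp add: I_def)
    have env1: "env s1" using fr env by (rule frame_env) simp
    have e: "regs s1 0 = n" "regs s1 2 = K" "regs s1 3 = 2 * K" "regs s1 5 = 4"
       "regs s1 6 = n * (2 * K)" "regs s1 10 = v" "regs s1 11 = Suc v"
       "regs s1 12 = length (adj v)" "regs s1 18 = c k"
      using I env1 r by (simp_all add: I_def env_def frame_def)
    define u where "u = nb v k"
    have u: "u < n" unfolding u_def by (rule nb_less[OF v k])
    have fs: "f (Suc k) = (if u \<in> C then (f k)(u := Suc v) else f k)"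
      by (auto simp: f_def nb_image_Suc fun_eq_iff u_def)
    have fle: "f k i \<le> n" if "i < n" for i
      using mem v that by (simp add: f_def wf_mem_def)
    have wf1: "wf_mem X s1"
      by (rule arr_upd_wf[where f = "f k" and tag = 3]) (use I mem fle in \<open>simp_all add: I_def\<close>)
    have marks1: "arr s1 2 i = Suc v \<longleftrightarrow> i \<in> nbhd v" if "i < n" for i
      using marks[OF that] I by (simp add: I_def arr_upd_def)
    have b: "u * (2 * K) + K \<le> n * (2 * K)"
      using mult_le_mono1[of "Suc u" n "2 * K"] u by simp
    have "X (u * (2 * K) + j) < n" if "j < K" for j
    proof -
      have "u * (2 * K) + j < n * (2 * K)" using b that by simp
      then show ?thesis using mem by (auto simp: wf_mem_def)
    qed
    then have h: "card {j. j < K \<and> arr s1 2 (X (u * (2 * K) + j)) = Suc v} = hits X u (nbhd v)"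
      unfolding hits_def by (intro arg_cong[where f = card]) (auto simp: marks1)
    have hK: "hits X u (nbhd v) \<le> K" unfolding hits_def by (rule card_less_le)
    have uC: "u \<in> C \<longleftrightarrow> 9 * K \<le> 10 * hits X u (nbhd v) \<and> 10 * deg v \<le> 11 * deg u"
      using nb_image[of v] k by (auto simp: C_def core_def u_def)
    have ck: "c k \<le> k" unfolding c_def by (rule card_less_le)
    have cs: "c (Suc k) = c k + (if u \<in> C then 1 else 0)"
      unfolding c_def u_def by (rule card_less_Suc_conj)
    note d = deg_le[OF v] deg_le[OF u]
    have lt: "Suc (c k) < 2 ^ w" "10 * hits X u (nbhd v) < 2 ^ w" "9 * K < 2 ^ w" "deg u < 2 ^ w"
        "length (adj u) < 2 ^ w" "10 * deg v < 2 ^ w" "11 * deg u < 2 ^ w" "u * (2 * K) < 2 ^ w"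
        "11 < (2::nat) ^ w" "10 < (2::nat) ^ w" "9 < (2::nat) ^ w"
      using bounds ck k d hK b by (linarith | simp add: deg_def)+
    have st: "arr_upd 3 (f (Suc k)) s s2"
      if "mem s2 = (if u \<in> C then (mem s1)(addr u 3 := Suc v) else mem s1)" for s2
    proof (cases "u \<in> C")
      case True
      with that fs show ?thesis using I arr_upd_store[of 3 "f k" s s1 "f (Suc k)" u "Suc v" s2]
        by (simp add: I_def)
    next
      case False
      with that fs show ?thesis using I arr_upd_cong_mem[of 3 "f k" s s1 s2] by (simp add: I_def)
    qed
    show "wp (seqs [get_nbr 17 10 16, Binop Mul 14 17 3, count 2, Degree 19 17, Binop Add 19 19 7,
        Imm 20 10, Binop Mul 21 20 15, Imm 22 9, Binop Mul 22 22 2, Binop Less 21 21 22,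
        Binop Mul 20 20 13, Imm 22 11, Binop Mul 22 22 19, Binop Less 22 22 20,
        Binop Add 21 21 22, Cond 21 Skip (Seq (Binop Add 18 18 7) (awrite 3 17 11))])
        (\<lambda>t' s'. I (Suc k) (Suc (Suc (Suc t'))) s' \<and> regs s' 16 = k \<and>
          regs s' 13 = deg v \<and> regs s' 7 = 1) (Suc (Suc t1)) s1"
      apply (simp add: e i v k u_def[symmetric] set_reg_def lt)
      apply (rule wp_count[where X = X and b = "u * (2 * K)"])
      subgoal using env1 by (simp add: env_def)
      subgoal using wf1 by simp
      subgoal by simp
      subgoal by simp
      subgoal by (rule b)
      subgoal premises prems for t' s'
      proof -
        have s': "regs s' 0 = n" "regs s' 2 = K" "regs s' 3 = 2 * K" "regs s' 5 = 4"
           "regs s' 6 = n * (2 * K)" "regs s' 7 = 1" "regs s' 10 = v" "regs s' 11 = Suc v"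
           "regs s' 12 = length (adj v)" "regs s' 13 = deg v" "regs s' 16 = k" "regs s' 17 = u"
           "regs s' 18 = c k" "regs s' 15 = hits X u (nbhd v)"
           "mem s' = mem s1" "queries s' = Suc (queries s1)"
          using prems e i h by simp_all
        have fr': "frame ?R s s'" using prems(4) fr by (simp add: frame_def)
        have t': "t' \<le> t1 + 60 + 40 * K" using prems(1) by simp
        show ?thesis
          using s' t' I fr' u d lt addr_bound(2)[OF u] st uC cs
          by (auto simp: set_reg_def count_query_def degree_answer_def deg_def[of u] I_def frame_def)
      qed
      done
  next
    show "I 0 (Suc (Suc (Suc (Suc t)))) s"
      using r by (auto simp: I_def f_def c_def fun_eq_iff frame_def intro!: arr_upd_refl)
  next
    fix k t1 s1 x y
    assume "I k t1 s1"
    then show "I k t1 (s1\<lparr>regs := (regs s1)(16 := x, 39 := y)\<rparr>)"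
      by (auto simp: I_def frame_def intro: arr_upd_cong_mem)
  next
    fix t1 s1
    assume I: "I (deg v) t1 s1"
    \<comment> \<open>The program counts indices of neighbors; as neighbor lists have no
      repetitions, this is the number of core vertices.\<close>
    have "bij_betw (nb v) {i. i < deg v \<and> nb v i \<in> C} C"
      using inj_on_nb[OF v] nb_image[of v] CN
      by (intro bij_betw_imageI) (auto simp: inj_on_def)
    then have "c (deg v) = card C" unfolding c_def by (rule bij_betw_same_card)
    moreover have "f (deg v) = (\<lambda>u. if u \<in> C then Suc v else arr s 3 u)"
      using CN by (auto simp: f_def nb_image fun_eq_iff)
    ultimately show "Q (Suc t1) s1" using I by (intro Q) (simp_all add: I_def C_def)
  qed (use env bounds deg_le[OF v] r in \<open>simp_all add: env_def\<close>)
qed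

lemma wp_label_nbrs:
  fixes s :: state
  assumes env: "env s" and v: "v < n" and mem: "wf_mem X s" and CN: "C \<subseteq> nbhd v"
    and flags: "\<And>u. u < n \<Longrightarrow> arr s 3 u = Suc v \<longleftrightarrow> u \<in> C"
    and r: "regs s 10 = v" "regs s 11 = Suc v" "regs s 12 = length (adj v)" "regs s 13 = deg v"
    and Q: "\<And>t' s'. t' \<le> t + 10 + 100 * deg v \<Longrightarrow>
        arr_upd 1 (\<lambda>u. if u \<in> C \<and> arr s 1 u = 0 then Suc v else arr s 1 u) s s' \<Longrightarrow>
        queries s' = queries s + deg v \<Longrightarrow>
        frame {16, 17, 20, 21, 22, 30, 31, 39} s s' \<Longrightarrow> Q t' s'"
  shows "wp label_nbrs Q t s"
proof -
  let ?R = "{16, 17, 20, 21, 22, 30, 31, 39 :: reg}"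
  define f where "f k u = (if u \<in> nb v ` {..<k} \<inter> C \<and> arr s 1 u = 0 then Suc v else arr s 1 u)"
    for k u
  define I where "I k t' s' \<longleftrightarrow> t' \<le> t + 5 + 100 * k \<and> arr_upd 1 (f k) s s' \<and>
     queries s' = queries s + k \<and> frame ?R s s'" for k t' and s' :: state
  show ?thesis
    unfolding label_nbrs_def
  proof (rule wp_forloop[where N = "deg v" and I = I])
    fix k t1 s1
    assume k: "k < deg v" and I: "I k t1 s1" and i: "regs s1 16 = k" "regs s1 13 = deg v" "regs s1 7 = 1"
    have e: "regs s1 0 = n" "regs s1 5 = 4" "regs s1 10 = v" "regs s1 11 = Suc v"
       "regs s1 12 = length (adj v)"
      using I env r by (simp_all add: I_def env_def frame_def)
    define u where "u = nb v k"
    have u: "u < n" unfolding u_def by (rule nb_less[OF v k])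
    have fs: "f (Suc k) = (if u \<in> C \<and> f k u = 0 then (f k)(u := Suc v) else f k)"
      by (auto simp: f_def nb_image_Suc fun_eq_iff u_def)
    have a: "arr s1 3 u = Suc v \<longleftrightarrow> u \<in> C" "arr s1 1 u = f k u" "arr s1 3 u < 2 ^ w" "f k u < 2 ^ w"
      using I flags[OF u] mem u v bounds(1) by (force simp: I_def arr_upd_def wf_mem_def f_def)+
    have st: "arr_upd 1 (f (Suc k)) s s2"
      if "mem s2 = (if u \<in> C \<and> f k u = 0 then (mem s1)(addr u 1 := Suc v) else mem s1)" for s2
    proof (cases "u \<in> C \<and> f k u = 0")
      case True
      with that fs show ?thesis using I arr_upd_store[of 1 "f k" s s1 "f (Suc k)" u "Suc v" s2]
        by (simp add: I_def)
    next
      case False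
      with that fs show ?thesis using I arr_upd_cong_mem[of 1 "f k" s s1 s2] by (auto simp: I_def)
    qed
    show "wp (seqs [get_nbr 17 10 16, aread 21 3 17, Binop Eq 21 21 11, aread 22 1 17,
        Cond 21 (Cond 22 Skip (awrite 1 17 11)) Skip])
        (\<lambda>t' s'. I (Suc k) (Suc (Suc (Suc t'))) s' \<and> regs s' 16 = k \<and>
          regs s' 13 = deg v \<and> regs s' 7 = 1) (Suc (Suc t1)) s1"
      using I i e v k u a addr_bound(2)[OF u] st
      by (simp add: I_def frame_def u_def[symmetric] set_reg_def)
  next
    show "I 0 (Suc (Suc (Suc (Suc t)))) s"
      by (auto simp: I_def f_def fun_eq_iff frame_def intro!: arr_upd_refl)
  next
    fix k t1 s1 x y
    assume "I k t1 s1"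
    then show "I k t1 (s1\<lparr>regs := (regs s1)(16 := x, 39 := y)\<rparr>)"
      by (auto simp: I_def frame_def intro: arr_upd_cong_mem)
  next
    fix t1 s1
    assume I: "I (deg v) t1 s1"
    have "f (deg v) = (\<lambda>u. if u \<in> C \<and> arr s 1 u = 0 then Suc v else arr s 1 u)"
      using CN by (auto simp: f_def nb_image fun_eq_iff)
    with I show "Q (Suc t1) s1" by (intro Q) (simp_all add: I_def)
  qed (use env bounds deg_le[OF v] r in \<open>simp_all add: env_def\<close>)
qed

definition relabel :: "(nat \<Rightarrow> nat) \<Rightarrow> nat \<Rightarrow> (nat \<Rightarrow> nat) \<Rightarrow> nat \<Rightarrow> nat" where
  "relabel X v L =
     (if 9 * deg v \<le> 10 * card (core X v)
      then (\<lambda>u. if u \<in> core X v \<and> L u = 0 then Suc v else L u) else L)"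

lemma arr_upd_arr: "arr_upd tag f s s' \<Longrightarrow> tag' < 4 \<Longrightarrow> arr s' tag' = (if tag' = tag then f else arr s tag')"
  by (auto simp: arr_upd_def fun_eq_iff)

text \<open>\<open>fresh\<close> takes the place of clearing the arrays: entries left by earlier
  candidates are at most \<open>v\<close>, so \<open>Suc v\<close> appears only where it was written
  for \<open>v\<close>. The vertex \<open>v\<close> is excepted for the marks because it has already
  been marked when its own samples were counted.\<close>

lemma wp_explore:
  fixes s :: state
  assumes env: "env s" and v: "v < n" and mem: "wf_mem X s"
    and fresh: "\<And>u. u < n \<Longrightarrow> u \<noteq> v \<Longrightarrow> arr s 2 u \<le> v" "\<And>u. u < n \<Longrightarrow> arr s 3 u \<le> v"
    and r: "regs s 10 = v" "regs s 11 = Suc v" "regs s 12 = length (adj v)" "regs s 13 = deg v"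
       "regs s 4 = b" "deg v \<le> b" "b < 2 ^ w"
    and Q: "\<And>t' s'. t' \<le> t + (500 + 40 * K) * deg v \<Longrightarrow>
        wf_mem X s' \<Longrightarrow> arr s' 1 = relabel X v (arr s 1) \<Longrightarrow>
        (\<And>u. u < n \<Longrightarrow> arr s' 2 u \<le> Suc v \<and> arr s' 3 u \<le> Suc v) \<Longrightarrow>
        queries s' \<le> queries s + 4 * deg v \<Longrightarrow> regs s' 4 = b - deg v \<Longrightarrow> env s' \<Longrightarrow>
        regs s' 10 = v \<Longrightarrow> Q t' s'"
  shows "wp explore Q t s"
proof -
  note fd = frame_def
  have D: "1 \<le> deg v" "deg v \<le> n" using deg_le[OF v] by (simp_all add: deg_def)
  define s0 where "s0 = s\<lparr>regs := (regs s)(4 := b - deg v)\<rparr>"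
  have s0: "env s0" "wf_mem X s0" "regs s0 10 = v" "regs s0 11 = Suc v"
    "regs s0 12 = length (adj v)" "regs s0 13 = deg v" "arr s0 = arr s" "regs s0 4 = b - deg v"
    using env mem r by (simp_all add: s0_def env_def)
  have "wp mark_nbrs (wp (seqs [Imm 18 0, test_nbrs, Imm 20 10,
     Binop Mul 20 20 18, Imm 21 9, Binop Mul 21 21 13, Binop Less 20 20 21,
     Cond 20 Skip label_nbrs]) Q) (Suc (Suc (Suc t))) s0"
  proof (rule wp_mark_nbrs[OF s0(1) v s0(2-6)], goal_cases)
    case (1 t1 s1)
    have env1: "env s1" using 1(4) s0(1) by (rule frame_env) simp
    have wf1: "wf_mem X s1"
      by (rule arr_upd_wf[OF 1(2) s0(2)]) (use mem v s0 in \<open>auto simp: wf_mem_def\<close>)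
    have a1: "arr s1 1 = arr s 1" "arr s1 3 = arr s 3"
      "arr s1 2 = (\<lambda>u. if u \<in> nbhd v then Suc v else arr s 2 u)"
      using arr_upd_arr[OF 1(2)] s0(7) by (simp_all add: fun_eq_iff)
    have r1: "regs s1 10 = v" "regs s1 11 = Suc v" "regs s1 12 = length (adj v)"
      "regs s1 13 = deg v" "regs s1 4 = b - deg v"
      using 1(4) s0 by (simp_all add: fd)
    define s2 where "s2 = s1\<lparr>regs := (regs s1)(18 := 0)\<rparr>"
    have s2: "env s2" "wf_mem X s2" "regs s2 10 = v" "regs s2 11 = Suc v"
      "regs s2 12 = length (adj v)" "regs s2 13 = deg v" "regs s2 18 = 0" "arr s2 = arr s1"
      "regs s2 4 = b - deg v" "queries s2 = queries s + deg v"
      using env1 wf1 r1 1(3) by (simp_all add: s2_def env_def s0_def)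
    have v_nbhd: "v \<in> nbhd v" by (simp add: nbhd_def)
    have marks: "arr s2 2 u = Suc v \<longleftrightarrow> u \<in> nbhd v" if "u < n" for u
      using fresh(1)[OF that] v_nbhd a1 s2(8) by (cases "u = v") auto
    have "wp test_nbrs (wp (seqs [Imm 20 10,
       Binop Mul 20 20 18, Imm 21 9, Binop Mul 21 21 13, Binop Less 20 20 21,
       Cond 20 Skip label_nbrs]) Q) (Suc (Suc (Suc t1))) s2"
    proof (rule wp_test_nbrs[OF s2(1) v s2(2) marks s2(3-7)], assumption, goal_cases)
      case (1 t3 s3)
      have env3: "env s3" using 1(5) s2(1) by (rule frame_env) simp
      have wf3: "wf_mem X s3"
        by (rule arr_upd_wf[OF 1(2) s2(2)]) (use s2(2) v in \<open>auto simp: wf_mem_def\<close>)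
      have a3: "arr s3 1 = arr s 1" "arr s3 2 = arr s1 2"
        "arr s3 3 = (\<lambda>u. if u \<in> core X v then Suc v else arr s 3 u)"
        using arr_upd_arr[OF 1(2)] s2(8) a1 by (simp_all add: fun_eq_iff)
      have m3: "arr s3 2 u \<le> Suc v \<and> arr s3 3 u \<le> Suc v" if "u < n" for u
        using fresh[OF that] a3 a1 v_nbhd by (cases "u = v") (auto simp: le_Suc_eq)
      have r3: "regs s3 10 = v" "regs s3 11 = Suc v" "regs s3 12 = length (adj v)"
        "regs s3 13 = deg v" "regs s3 4 = b - deg v"
        using 1(5) s2 by (simp_all add: fd)
      define s4 where "s4 = s3\<lparr>regs := (regs s3)(21 := 9 * deg v,
        20 := if 10 * card (core X v) < 9 * deg v then 1 else 0)\<rparr>"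
      have s4: "env s4" "wf_mem X s4" "regs s4 10 = v" "regs s4 11 = Suc v"
        "regs s4 12 = length (adj v)" "regs s4 13 = deg v" "arr s4 = arr s3"
        "regs s4 4 = b - deg v" "queries s4 = queries s + 3 * deg v"
        using env3 wf3 r3 1(3) s2(10) by (simp_all add: s4_def env_def)
      have CN: "core X v \<subseteq> nbhd v" by (auto simp: core_def)
      have cc: "card (core X v) \<le> deg v"
        using card_mono[OF finite_nbhd CN] by (simp add: card_nbhd[OF v])
      have lt: "10 * card (core X v) < 2 ^ w" "9 * deg v < 2 ^ w" "10 < (2::nat) ^ w" "9 < (2::nat) ^ w"
        using cc D bounds by linarith+
      have flags: "arr s4 3 u = Suc v \<longleftrightarrow> u \<in> core X v" if "u < n" for u
        using fresh(2)[OF that] a3 s4(7) by auto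
      have tt: "t3 \<le> t + 26 + (240 + 40 * K) * deg v"
        using 1(1) \<open>t1 \<le> _\<close> by (simp add: algebra_simps)
      have finish: "Q t' s'" if "t' \<le> t3 + 40 + 100 * deg v" "frame {16, 17, 20, 21, 22, 30, 31, 39} s4 s'"
        "arr_upd 1 (relabel X v (arr s4 1)) s4 s'" "queries s' \<le> queries s4 + deg v" for t' s'
      proof (rule Q)
        show "t' \<le> t + (500 + 40 * K) * deg v"
          using that(1) tt D by (simp add: algebra_simps)
        show "env s'" using that(2) s4(1) by (rule frame_env) simp
        show "wf_mem X s'"
          by (rule arr_upd_wf[OF that(3) s4(2)]) (use s4(2) v in \<open>auto simp: wf_mem_def relabel_def\<close>)
        show "arr s' 1 = relabel X v (arr s 1)"
          using arr_upd_arr[OF that(3), of 1] s4(7) a3 by simp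
        show "arr s' 2 u \<le> Suc v \<and> arr s' 3 u \<le> Suc v" if "u < n" for u
          using arr_upd_arr[OF \<open>arr_upd 1 _ _ _\<close>] s4(7) m3[OF that] by simp
        show "regs s' 4 = b - deg v" "regs s' 10 = v" using that(2) s4 by (simp_all add: fd)
        show "queries s' \<le> queries s + 4 * deg v" using that(4) s4(9) by simp
      qed
      have "if 10 * card (core X v) < 9 * deg v then Q (Suc (Suc (Suc (Suc (Suc (Suc (Suc (Suc (Suc (Suc (Suc (Suc t3)))))))))))) s4
        else wp label_nbrs Q (Suc (Suc (Suc (Suc (Suc (Suc (Suc (Suc (Suc (Suc (Suc t3))))))))))) s4"
      proof (cases "10 * card (core X v) < 9 * deg v")
        case True
        then have "Q (Suc (Suc (Suc (Suc (Suc (Suc (Suc (Suc (Suc (Suc (Suc (Suc t3)))))))))))) s4"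
          by (intro finish) (auto simp: fd relabel_def intro!: arr_upd_refl)
        with True show ?thesis by simp
      next
        case False
        have "wp label_nbrs Q (Suc (Suc (Suc (Suc (Suc (Suc (Suc (Suc (Suc (Suc (Suc t3))))))))))) s4"
        proof (rule wp_label_nbrs[OF s4(1) v s4(2) CN flags s4(3-6)], assumption, goal_cases)
          case (1 t' s')
          show ?case by (rule finish) (use 1 False in \<open>simp_all add: relabel_def cong: if_cong\<close>)
        qed
        with False show ?thesis by simp
      qed
      then show ?case
        using 1(4) r3 lt by (auto simp: set_reg_def s4_def fun_upd_twist split: if_splits)
    qed
    then show ?case by (simp add: set_reg_def s2_def)
  qed
  then show ?thesis
    unfolding explore_def using r by (simp add: set_reg_def s0_def)
qed


text \<open>Functional model of the clustering phase: the labels and the rest of the budget after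
  the candidates below the given index. A candidate that the rest cannot pay for is skipped, which
  keeps the query bound valid for every sample array.\<close>

primrec label_state :: "(nat \<Rightarrow> nat) \<Rightarrow> nat \<Rightarrow> nat \<Rightarrow> (nat \<Rightarrow> nat) \<times> nat" where
  "label_state X B 0 = (\<lambda>_. 0, B)"
| "label_state X B (Suc v) =
     (if 0 < hits X v {v} \<and> deg v \<le> snd (label_state X B v)
      then (relabel X v (fst (label_state X B v)), snd (label_state X B v) - deg v)
      else label_state X B v)"

text \<open>Amortization with the remaining budget as potential. Exploring \<open>v\<close> spends
  \<open>deg v\<close> units and makes up to four queries per unit: one for marking, two for testing
  and one for labelling. The steps are charged in the same way, \<open>700 + 40 * K\<close> per
  vertex and per unit.\<close>

lemma wp_clustering_phase:
  fixes s :: state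
  assumes env: "env s" and mem: "wf_mem X s" and B: "regs s 4 = B" "B < 2 ^ w"
    and zero: "arr s 1 = (\<lambda>_. 0)" "arr s 2 = (\<lambda>_. 0)" "arr s 3 = (\<lambda>_. 0)"
    and Q: "\<And>t' s'. t' \<le> t + 10 + (700 + 40 * K) * (n + B) \<Longrightarrow> env s' \<Longrightarrow> wf_mem X s' \<Longrightarrow>
        arr s' 1 = fst (label_state X B n) \<Longrightarrow> queries s' \<le> queries s + n + 4 * B \<Longrightarrow> Q t' s'"
  shows "wp clustering_phase Q t s"
proof -
  define I where "I k t' s' \<longleftrightarrow> snd (label_state X B k) \<le> B \<and> regs s' 4 = snd (label_state X B k) \<and>
     arr s' 1 = fst (label_state X B k) \<and> (\<forall>u<n. arr s' 2 u \<le> k \<and> arr s' 3 u \<le> k) \<and> env s' \<and>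
     wf_mem X s' \<and> queries s' + 4 * snd (label_state X B k) \<le> queries s + k + 4 * B \<and>
     t' + (700 + 40 * K) * snd (label_state X B k) \<le> t + 5 + (700 + 40 * K) * (k + B)"
    for k t' and s' :: state
  show ?thesis
    unfolding clustering_phase_def
  proof (rule wp_forloop[where N = n and I = I])
    fix v t1 s1
    assume v: "v < n" and I: "I v t1 s1" and i: "regs s1 10 = v" "regs s1 0 = n" "regs s1 7 = 1"
    define L b where "L = fst (label_state X B v)" and "b = snd (label_state X B v)"
    have e: "regs s1 3 = 2 * K" "regs s1 5 = 4" "regs s1 4 = b"
      using I by (simp_all add: I_def env_def b_def)
    have env1: "env s1" and wf1: "wf_mem X s1" using I by (simp_all add: I_def)
    have D: "1 \<le> deg v" "deg v \<le> n" using deg_le[OF v] by (simp_all add: deg_def)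
    have vK: "v * (2 * K) + K \<le> n * (2 * K)"
      using mult_le_mono1[of "Suc v" n "2 * K"] v by simp
    have lt: "Suc v < 2 ^ w" "deg v < 2 ^ w" "length (adj v) < 2 ^ w" "v * (2 * K) < 2 ^ w"
      using bounds v D vK unfolding deg_def by linarith+
    define s2 where "s2 = s1\<lparr>queries := Suc (queries s1),
      mem := (mem s1)(addr v 2 := Suc v),
      regs := (regs s1)(11 := Suc v, 12 := length (adj v), 13 := deg v, 31 := 2,
        30 := addr v 2, 14 := v * (2 * K))\<rparr>"
    have a2: "arr s2 (Suc 0) = arr s1 (Suc 0)" "arr s2 3 = arr s1 3" "arr s2 2 = (arr s1 2)(v := Suc v)"
      "arr s2 0 = arr s1 0"
      by (auto simp: s2_def arr_def addr_eq_iff fun_eq_iff)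
    have wf2: "wf_mem X s2" using wf1 v by (auto simp: wf_mem_def a2)
    have s2: "env s2" "regs s2 14 = v * (2 * K)" "regs s2 10 = v" "regs s2 11 = Suc v"
      "regs s2 12 = length (adj v)" "regs s2 13 = deg v" "regs s2 4 = b"
      using env1 e i by (simp_all add: s2_def env_def)
    have "X (v * (2 * K) + j) < n" if "j < K" for j
    proof -
      have "v * (2 * K) + j < n * (2 * K)" using vK that by simp
      then show ?thesis using wf1 by (auto simp: wf_mem_def)
    qed
    moreover have m2: "arr s2 2 u = Suc v \<longleftrightarrow> u = v" if "u < n" for u
    proof -
      have "arr s1 2 u \<le> v" using I that by (simp add: I_def)
      then show ?thesis using a2 by auto
    qed
    ultimately have h: "card {j. j < K \<and> arr s2 2 (X (v * (2 * K) + j)) = Suc v} = hits X v {v}"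
      unfolding hits_def using m2 by (intro arg_cong[where f = card]) auto
    have "wp (count 2) (wp (seqs [Cond 15 (Seq (Binop Less 20 4 13) (Cond 20 Skip explore)) Skip])
      (\<lambda>t' s'. I (Suc v) (Suc (Suc (Suc t'))) s' \<and> regs s' 10 = v \<and>
          regs s' 0 = n \<and> regs s' 7 = 1)) (21 + t1) s2"
    proof (rule wp_count[OF s2(1) wf2 disjI2[OF refl] s2(2) vK], goal_cases)
      case (1 t3 s3)
      have r3: "regs s3 10 = v" "regs s3 11 = Suc v" "regs s3 12 = length (adj v)"
        "regs s3 13 = deg v" "regs s3 4 = b" "regs s3 15 = hits X v {v}"
        using 1(4,5) s2 h by simp_all
      have env3: "env s3" using 1(4) s2(1) by (simp add: env_def)
      have a3: "arr s3 = arr s2" using 1(2) by (rule arr_cong)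
      have wf3: "wf_mem X s3" using wf2 a3 by (simp add: wf_mem_def)
      have q3: "queries s3 = Suc (queries s1)" using 1(3) by (simp add: s2_def)
      have fr3: "arr s3 2 u \<le> Suc v \<and> arr s3 3 u \<le> Suc v" if "u < n" for u
        using I that a2 a3 by (auto simp: I_def le_Suc_eq)
      have unchanged: "I (Suc v) t' s' \<and> regs s' 10 = v \<and> regs s' 0 = n \<and> regs s' 7 = 1"
        if "label_state X B (Suc v) = label_state X B v" "t' \<le> t3 + 20"
          "s' = s3 \<or> s' = s3\<lparr>regs := (regs s3)(20 := x)\<rparr>" for t' s' x
        using that(3)
      proof (elim disjE, goal_cases)
        case 1
        show ?case
          using I env3 a3 a2 wf3 fr3 q3 r3 that(1,2) \<open>t3 \<le> _\<close> unfolding 1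
          by (auto simp: I_def env_def b_def)
      next
        case 2
        show ?case
          using I env3 a3 a2 wf3 fr3 q3 r3 that(1,2) \<open>t3 \<le> _\<close> unfolding 2
          by (auto simp: I_def env_def b_def)
      qed
      show ?case
      proof (cases "0 < hits X v {v} \<and> deg v \<le> b")
        case False
        then have "label_state X B (Suc v) = label_state X B v" by (auto simp: b_def)
        from unchanged[OF this _ disjI1[OF refl]] unchanged[OF this _ disjI2[OF refl]] False r3
        show ?thesis by (auto simp: set_reg_def)
      next
        case True
        then have c: "label_state X B (Suc v) = (relabel X v L, b - deg v)"
          by (simp add: b_def L_def)
        define s4 where "s4 = s3\<lparr>regs := (regs s3)(20 := 0)\<rparr>"
        have s4: "env s4" "wf_mem X s4" "arr s4 = arr s2" "regs s4 10 = v" "regs s4 11 = Suc v"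
          "regs s4 12 = length (adj v)" "regs s4 13 = deg v" "regs s4 4 = b" "queries s4 = queries s3"
          using env3 wf3 a3 r3 by (simp_all add: s4_def env_def)
        have bB: "b \<le> B" using I by (simp add: I_def b_def)
        have "wp explore (\<lambda>t' s'. I (Suc v) (Suc (Suc (Suc t'))) s' \<and> regs s' 10 = v \<and>
          regs s' 0 = n \<and> regs s' 7 = 1) (Suc (Suc (Suc (Suc t3)))) s4"
        proof (rule wp_explore[OF s4(1) v s4(2) _ _ s4(4-8)], goal_cases)
          case (5 t5 s5)
          have "t5 \<le> t1 + 80 + 40 * K + (500 + 40 * K) * deg v"
            using 5(1) \<open>t3 \<le> _\<close> by simp
          also have "\<dots> \<le> t1 + (600 + 40 * K) * deg v + 40 * K"
            using D by (simp add: algebra_simps)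
          finally have t5: "t5 + 3 + (700 + 40 * K) * (b - deg v) \<le>
              t1 + (700 + 40 * K) * b + (700 + 40 * K)"
          proof -
            obtain b' where b': "b = deg v + b'" using True by (metis le_add_diff_inverse)
            assume "t5 \<le> t1 + (600 + 40 * K) * deg v + 40 * K"
            then show ?thesis by (simp add: b' algebra_simps)
          qed
          show ?case
            using I 5 c a2 s4 q3 t5 bB True
            by (auto simp: I_def env_def b_def L_def algebra_simps)
        qed (use True I a2 s4 bB B in \<open>auto simp: I_def\<close>)
        with True r3 show ?thesis by (simp add: set_reg_def s4_def)
      qed
    qed
    then show "wp (seqs [Binop Add 11 10 7, Degree 12 10, Binop Add 13 12 7, awrite 2 10 11,
        Binop Mul 14 10 3, count 2, Cond 15 (Seq (Binop Less 20 4 13) (Cond 20 Skip explore)) Skip])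
        (\<lambda>t' s'. I (Suc v) (Suc (Suc (Suc t'))) s' \<and> regs s' 10 = v \<and>
          regs s' 0 = n \<and> regs s' 7 = 1) (Suc (Suc t1)) s1"
      using v i e lt addr_bound(2)[OF v]
      by (simp add: set_reg_def count_query_def degree_answer_def s2_def deg_def)
  next
    show "I 0 (Suc (Suc (Suc (Suc t)))) s"
      using env mem B zero by (simp add: I_def)
  next
    fix k t1 s1 x y
    assume "I k t1 s1"
    then show "I k t1 (s1\<lparr>regs := (regs s1)(10 := x, 39 := y)\<rparr>)"
      by (simp add: I_def env_def)
  next
    fix t1 s1
    assume I: "I n t1 s1"
    then show "Q (Suc t1) s1" by (intro Q) (simp_all add: I_def)
  qed (use env bounds in \<open>simp_all add: env_def\<close>)
qed

section \<open>Majority voting\<close>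

definition votes :: "(nat \<Rightarrow> nat) \<Rightarrow> (nat \<Rightarrow> nat) \<Rightarrow> nat \<Rightarrow> nat \<Rightarrow> nat" where
  "votes X L u l = card {j. j < K \<and> L (X (u * (2 * K) + K + j)) = l}"

text \<open>Label \<open>0\<close> means unlabelled and label \<open>l\<close> belongs to the center
  \<open>l - 1\<close>. The degree condition bounds the size of output clusters by a multiple of the
  degree of each member.\<close>

definition eligible :: "(nat \<Rightarrow> nat) \<Rightarrow> (nat \<Rightarrow> nat) \<Rightarrow> nat \<Rightarrow> nat \<Rightarrow> bool" where
  "eligible X L u l \<longleftrightarrow> 0 < l \<and> K < 2 * votes X L u l \<and> 4 * deg (l - 1) \<le> 5 * deg u"

text \<open>A relation, so that the loop invariant does not rest on the uniqueness of the eligible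
  label; that is supplied by \<open>eligible_unique\<close>.\<close>

definition elected :: "(nat \<Rightarrow> nat) \<Rightarrow> (nat \<Rightarrow> nat) \<Rightarrow> nat \<Rightarrow> nat \<Rightarrow> nat \<Rightarrow> bool" where
  "elected X L m u x \<longleftrightarrow>
     (x = Suc (u + n) \<and> (\<forall>j<m. \<not> eligible X L u (L (X (u * (2 * K) + K + j))))) \<or>
     (eligible X L u x \<and> (\<exists>j<m. x = L (X (u * (2 * K) + K + j))))"

lemma not_eligible_0: "\<not> eligible X L u 0"
  by (simp add: eligible_def)

lemma elected_Suc:
  assumes "elected X L m u x" "l = L (X (u * (2 * K) + K + m))"
  shows "elected X L (Suc m) u (if eligible X L u l then l else x)"
  using assms by (auto simp: elected_def less_Suc_eq)

lemma wp_voting_phase: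
  fixes s :: state
  assumes env: "env s" and mem: "wf_mem X s"
    and Q: "\<And>t' s'. t' \<le> t + 10 + n * (300 + 300 * K + 40 * (K * K)) \<Longrightarrow>
        (\<And>u. u < n \<Longrightarrow> elected X (arr s 1) K u (mem s' u)) \<Longrightarrow>
        queries s' \<le> queries s + n * (K + 1) \<Longrightarrow> Q t' s'"
  shows "wp voting_phase Q t s"
proof -
  define L where "L = arr s (Suc 0)"
  \<comment> \<open>Voting writes only output cells, that is, cells below \<open>n\<close>; the
    arrays that it reads therefore stay constant.\<close>
  define keep where "keep s' \<longleftrightarrow> (\<forall>a\<ge>n. mem s' a = mem s a)" for s' :: state
  have keep: "arr s' = arr s" "wf_mem X s'" if "keep s'" for s'
    using that mem addr_ge by (auto simp: keep_def arr_def fun_eq_iff wf_mem_def)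
  define I where "I k t' s' \<longleftrightarrow> keep s' \<and> env s' \<and> (\<forall>u<k. elected X L K u (mem s' u)) \<and>
     queries s' \<le> queries s + k * (K + 1) \<and>
     t' \<le> t + 5 + k * (300 + 300 * K + 40 * (K * K))" for k t' and s' :: state
  show ?thesis
    unfolding voting_phase_def
  proof (rule wp_forloop[where N = n and I = I])
    fix u t1 s1
    assume u: "u < n" and I: "I u t1 s1" and i: "regs s1 10 = u" "regs s1 0 = n" "regs s1 7 = 1"
    have env1: "env s1" and keep1: "keep s1" using I by (simp_all add: I_def)
    have D: "1 \<le> deg u" "deg u \<le> n" using deg_le[OF u] by (simp_all add: deg_def)
    define b where "b = u * (2 * K) + K"
    have uK: "b + K \<le> n * (2 * K)"
      using mult_le_mono1[of "Suc u" n "2 * K"] u by (simp add: b_def)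
    have lt: "deg u < 2 ^ w" "length (adj u) < 2 ^ w" "u * (2 * K) < 2 ^ w" "b < 2 ^ w"
        "Suc (u + n) < 2 ^ w" "u + n < 2 ^ w"
      using bounds u D uK unfolding deg_def b_def by linarith+
    define s2 where "s2 = s1\<lparr>queries := Suc (queries s1),
      regs := (regs s1)(12 := length (adj u), 13 := deg u, 14 := b, 11 := Suc (u + n)),
      mem := (mem s1)(u := Suc (u + n))\<rparr>"
    let ?R = "{11, 15, 16, 17, 18, 19, 21, 22, 23, 24, 25, 30, 31, 39 :: reg}"
    have s2: "env s2" "keep s2" "regs s2 14 = b" "regs s2 10 = u" "regs s2 13 = deg u"
      using env1 i u keep1 by (simp_all add: s2_def env_def keep_def)
    define J where "J k t' s' \<longleftrightarrow> keep s' \<and> frame ?R s2 s' \<and> (\<forall>a<n. a \<noteq> u \<longrightarrow> mem s' a = mem s1 a) \<and>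
       elected X L k u (mem s' u) \<and> queries s' = queries s2 + k \<and> t' \<le> t1 + 40 + k * (250 + 40 * K)"
      for k t' and s' :: state
    let ?body = "seqs [Binop Add 17 14 16, aread 17 0 17, aread 11 1 17, count 1, Binop Add 18 15 15,
            Binop Less 19 2 18, Binop Sub 21 11 7, Degree 22 21, Binop Add 22 22 7, Imm 23 4,
            Binop Mul 22 22 23, Imm 23 5, Binop Mul 23 23 13, Binop Less 23 23 22,
            Cond 11 (Cond 19 (Cond 23 Skip (Store 10 11)) Skip) Skip]"
    have "wp (forloop 16 2 ?body)
        (\<lambda>t' s'. I (Suc u) (Suc (Suc (Suc t'))) s' \<and> regs s' 10 = u \<and>
          regs s' 0 = n \<and> regs s' 7 = 1) (Suc (Suc (Suc (Suc (Suc (Suc (Suc (Suc (Suc (Suc (Suc (Suc (Suc (Suc (Suc (Suc t1)))))))))))))))) s2"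
    proof (rule wp_forloop[where N = K and I = J])
      fix k t3 s3
      assume k: "k < K" and J: "J k t3 s3" and i3: "regs s3 16 = k" "regs s3 2 = K" "regs s3 7 = 1"
      have fr3: "frame ?R s2 s3" and keep3: "keep s3" using J by (simp_all add: J_def)
      have env3: "env s3" using fr3 s2(1) by (rule frame_env) simp
      have e3: "regs s3 0 = n" "regs s3 5 = 4" "regs s3 14 = b" "regs s3 10 = u" "regs s3 13 = deg u"
        using fr3 env3 s2 by (simp_all add: frame_def env_def)
      have a3: "arr s3 = arr s" using keep3 by (rule keep)
      have x: "b + k < n * (2 * K)" using uK k by simp
      define l where "l = L (X (b + k))"
      have X: "arr s 0 (b + k) = X (b + k)" "X (b + k) < n" "X (b + k) < 2 ^ w"
        using mem x bounds(1) by (auto simp: wf_mem_def)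
      have ln: "l \<le> n" using mem X(2) by (simp add: wf_mem_def l_def L_def)
      have al: "arr s (Suc 0) (X (b + k)) = l" by (simp add: l_def L_def)
      have lt3: "b + k < 2 ^ w" "l < 2 ^ w" using x ln bounds by linarith+
      define s4 where "s4 = s3\<lparr>regs := (regs s3)(17 := X (b + k), 31 := 1,
        30 := addr (X (b + k)) 1, 11 := l)\<rparr>"
      have s4: "env s4" "wf_mem X s4" "regs s4 14 = b" "regs s4 11 = l"
        using env3 e3 keep(2)[OF keep3] by (simp_all add: s4_def env_def)
      have a4: "arr s4 (Suc 0) = L" by (simp add: s4_def a3 L_def)
      have "wp (count 1) (wp (seqs [Binop Add 18 15 15,
            Binop Less 19 2 18, Binop Sub 21 11 7, Degree 22 21, Binop Add 22 22 7, Imm 23 4,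
            Binop Mul 22 22 23, Imm 23 5, Binop Mul 23 23 13, Binop Less 23 23 22,
            Cond 11 (Cond 19 (Cond 23 Skip (Store 10 11)) Skip) Skip])
          (\<lambda>t' s'. J (Suc k) (Suc (Suc (Suc t'))) s' \<and> regs s' 16 = k \<and>
             regs s' 2 = K \<and> regs s' 7 = 1)) (25 + t3) s4"
      proof (rule wp_count[OF s4(1,2) disjI1[OF refl] s4(3) uK], goal_cases)
        case (1 t5 s5)
        have s5: "regs s5 15 = votes X L u l" "regs s5 2 = K" "regs s5 7 = 1" "regs s5 11 = l"
          "regs s5 13 = deg u" "regs s5 10 = u" "regs s5 16 = k" "mem s5 = mem s3"
          "queries s5 = queries s3"
          using 1(2-5) s4 i3 e3 a4 by (simp_all add: s4_def votes_def b_def)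
        have fr5: "frame ?R s2 s5"
          using 1(4) fr3 by (simp add: frame_def s4_def)
        have vK: "votes X L u l \<le> K" unfolding votes_def by (rule card_less_le)
        \<comment> \<open>For label \<open>0\<close> the truncated subtraction leads to a degree
          query for vertex \<open>0\<close>; its answer has no effect because register
          \<open>11\<close> is tested before storing.\<close>
        define m where "m = l - Suc 0"
        have l1: "m < n" using ln n_pos by (simp add: m_def)
        note dl = deg_le[OF l1]
        have lt5: "votes X L u l + votes X L u l < 2 ^ w" "4 * deg (m) < 2 ^ w" "5 * deg u < 2 ^ w"
          "deg (m) < 2 ^ w" "length (adj (m)) < 2 ^ w" "5 < (2::nat) ^ w" "4 < (2::nat) ^ w"
          "m < 2 ^ w"
          using vK dl D l1 bounds(1,3,4,6) by (linarith | simp add: deg_def)+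
        have eligible_iff: "eligible X L u l \<longleftrightarrow>
            0 < l \<and> K < votes X L u l + votes X L u l \<and> \<not> deg u * 5 < deg m * 4"
          by (auto simp: eligible_def m_def)
        have el: "elected X L (Suc k) u (if eligible X L u l then l else mem s3 u)"
          by (rule elected_Suc) (use J in \<open>simp_all add: J_def l_def b_def\<close>)
        have fin: "J (Suc k) t' s'" if "frame ?R s2 s'" "queries s' = Suc (queries s5)" "t' \<le> t5 + 60"
          "mem s' = (if eligible X L u l then (mem s3)(u := l) else mem s3)" for t' s'
          unfolding J_def
        proof (intro conjI)
          show "keep s'" using keep3 that(4) u by (auto simp: keep_def)
          show "\<forall>a<n. a \<noteq> u \<longrightarrow> mem s' a = mem s1 a" using J that(4) by (auto simp: J_def)
          show "elected X L (Suc k) u (mem s' u)" using el that(4) by (auto split: if_splits)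
          show "queries s' = queries s2 + Suc k" using that(2) s5 J by (simp add: J_def)
          show "t' \<le> t1 + 40 + Suc k * (250 + 40 * K)"
            using that(3) 1(1) J by (simp add: J_def)
        qed (fact that(1))
        show ?case
          using s5 lt5 l1 u D fr5
          by (simp add: set_reg_def set_mem_def count_query_def degree_answer_def deg_def[of m, symmetric]
              m_def[symmetric])
            (use fr5 s5(8,9) in \<open>simp add: fin frame_def eligible_iff not_eligible_0\<close>)
      qed
      then show "wp ?body (\<lambda>t' s'. J (Suc k) (Suc (Suc (Suc t'))) s' \<and> regs s' 16 = k \<and>
             regs s' 2 = K \<and> regs s' 7 = 1) (Suc (Suc t3)) s3"
        using i3 e3 a3 X al lt3 addr_bound(1)[OF x] addr_bound(2)[OF X(2)]
        by (simp add: set_reg_def s4_def)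
    next
      show "J 0 (Suc (Suc (Suc (Suc (Suc (Suc (Suc (Suc (Suc (Suc (Suc (Suc (Suc (Suc (Suc (Suc (Suc (Suc (Suc (Suc t1)))))))))))))))))))) s2"
        using s2 by (simp add: J_def frame_def elected_def s2_def)
    next
      fix k t1 s1 x y
      assume "J k t1 s1"
      then show "J k t1 (s1\<lparr>regs := (regs s1)(16 := x, 39 := y)\<rparr>)"
        by (simp add: J_def frame_def keep_def)
    next
      fix t3 s3
      assume J: "J K t3 s3"
      have fr3: "frame ?R s2 s3" using J by (simp add: J_def)
      have env3: "env s3" using fr3 s2(1) by (rule frame_env) simp
      show "I (Suc u) (Suc (Suc (Suc (Suc t3)))) s3 \<and> regs s3 10 = u \<and> regs s3 0 = n \<and> regs s3 7 = 1"
        using env3 J I u fr3 s2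
        by (auto simp: I_def J_def env_def frame_def less_Suc_eq s2_def algebra_simps)
    qed (use s2 bounds in \<open>simp_all add: env_def\<close>)
    then show "wp (seqs [Degree 12 10, Binop Add 13 12 7, Binop Mul 14 10 3, Binop Add 14 14 2,
        Binop Add 11 10 0, Binop Add 11 11 7, Store 10 11, forloop 16 2 ?body])
        (\<lambda>t' s'. I (Suc u) (Suc (Suc (Suc t'))) s' \<and> regs s' 10 = u \<and>
          regs s' 0 = n \<and> regs s' 7 = 1) (Suc (Suc t1)) s1"
      using u i lt env1
      by (simp add: set_reg_def set_mem_def count_query_def degree_answer_def s2_def deg_def env_def
          b_def)
  next
    show "I 0 (Suc (Suc (Suc (Suc t)))) s"
      using env by (simp add: I_def keep_def)
  next
    fix k t1 s1 x y
    assume "I k t1 s1"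
    then show "I k t1 (s1\<lparr>regs := (regs s1)(10 := x, 39 := y)\<rparr>)"
      by (simp add: I_def env_def keep_def)
  next
    fix t1 s1
    assume I: "I n t1 s1"
    then show "Q (Suc t1) s1" by (intro Q) (simp_all add: I_def L_def)
  qed (use env bounds in \<open>simp_all add: env_def\<close>)
qed

end

text \<open>In this order: two queries for each of the \<open>2 * n * K\<close> samples; one degree
  query per vertex and four queries per unit of the budget \<open>3 * n * K\<close>; and
  \<open>K + 1\<close> degree queries per vertex in the voting phase.\<close>

definition query_bound :: "nat \<Rightarrow> nat \<Rightarrow> nat" where
  "query_bound n K = 4 * (n * K) + (n + 12 * (n * K)) + n * (K + 1)"

text \<open>The term \<open>60 * (n * K)\<close> stands for \<open>2 * n * K\<close> passes of the
  sampling loop with 30 steps each; the last two terms belong to the clustering and the voting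
  phase.\<close>

definition time_bound :: "nat \<Rightarrow> nat \<Rightarrow> nat" where
  "time_bound n K = 100 + K + 60 * (n * K) + (700 + 40 * K) * (n + 3 * n * K) +
     n * (300 + 300 * K + 40 * (K * K))"

section \<open>Parameters, sampling, and the distribution of a complete run\<close>

context instance_ram
begin

lemma floorlog_2_div: "0 < x \<Longrightarrow> floorlog 2 x = Suc (floorlog 2 (x div 2))" for x :: nat
  by (subst compute_floorlog) simp

lemma wp_floorlog_loop:
  assumes "regs s 22 = x" "regs s 21 = a" "regs s 20 = 2" "regs s 7 = 1"
    "x < 2 ^ w" "a + floorlog 2 x < 2 ^ w"
    and Q: "\<And>s'. frame {21, 22} s s' \<Longrightarrow> regs s' 21 = a + floorlog 2 x \<Longrightarrow> mem s' = mem s \<Longrightarrow>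
        queries s' = queries s \<Longrightarrow> Q (t + 4 * floorlog 2 x + 1) s'"
  shows "wp (While 22 (Seq (Binop Div 22 22 20) (Binop Add 21 21 7))) Q t s"
  using assms
proof (induction x arbitrary: a t s rule: less_induct)
  case (less x)
  show ?case
  proof (cases "x = 0")
    case True
    have "floorlog 2 x = 0" using True by (simp add: floorlog_eq_zero_iff)
    then have "Q (Suc t) s" using less.prems(7)[of s] less.prems(2) by (simp add: frame_def)
    then show ?thesis using less.prems(1) True by (subst wp_While_unfold) simp
  next
    case False
    define s1 where "s1 = s\<lparr>regs := (regs s)(22 := x div 2, 21 := Suc a)\<rparr>"
    have f: "floorlog 2 x = Suc (floorlog 2 (x div 2))" using False by (intro floorlog_2_div) simp
    have lt: "x div 2 < 2 ^ w" "Suc a < 2 ^ w" using less.prems f by linarith+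
    have "wp (While 22 (Seq (Binop Div 22 22 20) (Binop Add 21 21 7))) Q (Suc (Suc (Suc (Suc t)))) s1"
    proof (rule less.IH[of "x div 2" s1 "Suc a"], goal_cases)
      case (8 s')
      have "Q (t + 4 * floorlog 2 x + 1) s'"
        by (rule less.prems(7)) (use 8 f in \<open>simp_all add: frame_def s1_def\<close>)
      moreover have "t + 4 * floorlog 2 x + 1 = Suc (Suc (Suc (Suc t))) + 4 * floorlog 2 (x div 2) + 1"
        using f by simp
      ultimately show ?case by (simp only:)
    qed (use False less.prems f lt in \<open>simp_all add: s1_def\<close>)
    then show ?thesis
      using less.prems lt False by (subst wp_While_unfold) (simp add: set_reg_def s1_def)
  qed
qed

lemma wp_parameters:
  assumes K: "K = 1200 * floorlog 2 n"
    and Q: "\<And>t s'. t \<le> 40 + K \<Longrightarrow> env s' \<Longrightarrow> regs s' 4 = 3 * n * K \<Longrightarrow> mem s' = (\<lambda>_. 0) \<Longrightarrow>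
        queries s' = 0 \<Longrightarrow> Q t s'"
  shows "wp parameters Q 0 (init_state n)"
proof -
  have l: "0 < floorlog 2 n" using n_pos floorlog_2_div by simp
  have lt: "floorlog 2 n < 2 ^ w" "1200 < (2::nat) ^ w" "K < 2 ^ w" "2 * K < 2 ^ w" "n * K < 2 ^ w"
    "3 * (n * K) < 2 ^ w" "4 < (2::nat) ^ w" "n < 2 ^ w" "2 * (n * K) < 2 ^ w" "3 < (2::nat) ^ w"
    "2 < (2::nat) ^ w"
    using bounds K l by linarith+
  have K': "1200 * floorlog 2 n = K" "4 * floorlog 2 n \<le> K" using K by simp_all
  define s0 where "s0 = (init_state n)\<lparr>regs := (regs (init_state n))(7 := 1, 20 := 2, 21 := 0, 22 := n)\<rparr>"
  have "wp (While 22 (Seq (Binop Div 22 22 20) (Binop Add 21 21 7)))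
     (wp (seqs [Imm 23 1200, Binop Mul 2 23 21, Binop Mul 3 20 2, Imm 23 3, Binop Mul 4 0 2,
     Binop Mul 4 4 23, Imm 5 4, Binop Mul 6 0 3]) Q) (Suc (Suc (Suc (Suc (Suc (Suc (Suc (Suc (Suc 0))))))))) s0"
  proof (rule wp_floorlog_loop[where x = n and a = 0], goal_cases)
    case (7 s')
    have r: "regs s' 0 = n" "regs s' 7 = 1" "regs s' 20 = 2" "regs s' 21 = floorlog 2 n"
        "mem s' = (\<lambda>_. 0)" "queries s' = 0"
      using 7 by (simp_all add: frame_def s0_def init_state_def)
    show ?case
      using r lt K' by (simp add: set_reg_def) (intro Q; simp add: env_def mult_ac)
  qed (use lt bounds in \<open>simp_all add: s0_def init_state_def\<close>)
  then show ?thesis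
    unfolding parameters_def using lt
    by (simp add: set_reg_def s0_def init_state_def)
qed

text \<open>Connects weakest preconditions with distributions: deterministic code acts on a random
  state as a function \<open>h\<close>, provided that its duration \<open>k'\<close> is the same for
  all outcomes.\<close>

lemma yields_wp:
  assumes "yields c s k D" "\<And>s'. s' \<in> set_pmf D \<Longrightarrow> wp d (\<lambda>t s2. t = k' \<and> P s' s2) 0 s'"
    "m = Suc (k + k')"
  shows "\<exists>h. yields (Seq c d) s m (map_pmf h D) \<and> (\<forall>s'\<in>set_pmf D. P s' (h s'))"
proof -
  have "\<forall>s'\<in>set_pmf D. \<exists>s2. yields d s' k' (return_pmf s2) \<and> P s' s2"
    using wp_sound[OF assms(2)] by fastforce
  then obtain h where h: "\<And>s'. s' \<in> set_pmf D \<Longrightarrow> yields d s' k' (return_pmf (h s')) \<and> P s' (h s')"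
    using bchoice[of "set_pmf D"] by metis
  from yields_Seq[OF assms(1), of d k' "\<lambda>s'. return_pmf (h s')"] h assms(3) show ?thesis
    by (intro exI[of _ h]) (simp add: map_pmf_def)
qed

lemma yields_Rand:
  assumes "regs s b \<noteq> 0"
  shows "yields (Rand r b) s 1 (map_pmf (\<lambda>x. set_reg w r x s) (pmf_of_set {..<regs s b}))"
  by (rule yields_step) (use assms in \<open>simp add: pmf.map_comp o_def\<close>)

lemma pmf_of_set_nbhd:
  assumes "v < n"
  shows "pmf_of_set (nbhd v) = map_pmf (nb v) (pmf_of_set {..<deg v})"
proof -
  have "0 \<in> {..<deg v}" by (simp add: deg_def)
  then have "map_pmf (nb v) (pmf_of_set {..<deg v}) = pmf_of_set (nb v ` {..<deg v})"
    by (intro map_pmf_of_set_inj inj_on_nb assms) auto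
  then show ?thesis by (simp add: nb_image)
qed

definition sample_body :: com where
  "sample_body = Seq (Seq (seqs [Binop Div 11 10 3, Degree 12 11, Binop Add 13 12 7])
       (Seq (Rand 16 13) (Seq (get_nbr 17 11 16) (awrite 0 10 17))))
     (Seq (Binop Add 10 10 7) (Binop Less 39 10 6))"

definition sampled :: "nat \<Rightarrow> nat \<Rightarrow> (nat \<Rightarrow> nat) \<Rightarrow> state \<Rightarrow> state \<Rightarrow> bool" where
  "sampled x N X s s' \<longleftrightarrow> env s' \<and> regs s' 4 = regs s 4 \<and> queries s' = queries s + 2 * (N - x) \<and>
     (\<forall>tag<4. \<forall>i. arr s' tag i = (if tag = 0 \<and> x \<le> i \<and> i < N then X i else arr s tag i))"

text \<open>A uniform index yields a uniform vertex because \<open>nb v\<close> is injective on the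
  indices. The 29 steps do not depend on the index drawn, so \<open>yields\<close> applies to the
  loop.\<close>

lemma yields_sample_body:
  assumes env: "env s" and x: "regs s 10 = x" "x < n * (2 * K)"
  obtains G where
    "yields sample_body s 29 (map_pmf G (pmf_of_set (nbhd (x div (2 * K)))))"
    "\<And>y. y \<in> nbhd (x div (2 * K)) \<Longrightarrow> sampled x (Suc x) (\<lambda>_. y) s (G y) \<and>
        regs (G y) 10 = Suc x \<and> regs (G y) 39 = (if Suc x < n * (2 * K) then 1 else 0)"
proof -
  define v where "v = x div (2 * K)"
  have v: "v < n" using x(2) by (simp add: v_def less_mult_imp_div_less)
  note D = deg_le[OF v]
  have D1: "deg v \<noteq> 0" by (simp add: deg_def)
  have e: "regs s 0 = n" "regs s 2 = K" "regs s 3 = 2 * K" "regs s 5 = 4" "regs s 6 = n * (2 * K)"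
    "regs s 7 = 1"
    using env by (simp_all add: env_def)
  have lt: "v < 2 ^ w" "deg v < 2 ^ w" "length (adj v) < 2 ^ w" "Suc x < 2 ^ w"
    using v D bounds x unfolding deg_def by linarith+
  define s1 where "s1 = s\<lparr>queries := Suc (queries s),
    regs := (regs s)(11 := v, 12 := length (adj v), 13 := deg v)\<rparr>"
  have "wp (seqs [Binop Div 11 10 3, Degree 12 11, Binop Add 13 12 7]) (\<lambda>t s2. t = 5 \<and> s2 = s1) 0 s"
    using e x v lt
    by (simp add: set_reg_def count_query_def degree_answer_def s1_def deg_def v_def[symmetric])
  from wp_sound[OF this] have 1: "yields (seqs [Binop Div 11 10 3, Degree 12 11, Binop Add 13 12 7])
      s 5 (return_pmf s1)"
    by auto
  define R where "R i = s1\<lparr>regs := (regs s1)(16 := i)\<rparr>" for i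
  define U where "U = map_pmf R (pmf_of_set {..<deg v})"
  have setU: "set_pmf U = R ` {..<deg v}"
    unfolding U_def using D1 by (subst set_map_pmf, subst set_pmf_of_set) auto
  have "regs s1 13 = deg v" by (simp add: s1_def)
  with yields_Rand[of s1 13 16] D1 have
    "yields (Rand 16 13) s1 1 (map_pmf (\<lambda>x. set_reg w 16 x s1) (pmf_of_set {..<deg v}))" by simp
  also have "map_pmf (\<lambda>x. set_reg w 16 x s1) (pmf_of_set {..<deg v}) = U"
    unfolding U_def R_def set_reg_def
  proof (intro map_pmf_cong refl)
    fix i assume "i \<in> set_pmf (pmf_of_set {..<deg v})"
    then have "i < deg v" using D1 by (subst (asm) set_pmf_of_set) auto
    with lt show "s1\<lparr>regs := (regs s1)(16 := i mod 2 ^ w)\<rparr> = s1\<lparr>regs := (regs s1)(16 := i)\<rparr>" by simp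
  qed
  finally have 2: "yields (Rand 16 13) s1 1 U" .
  define S where "S i = s1\<lparr>queries := Suc (queries s1),
     regs := (regs s1)(16 := i, 20 := self_index v i, 17 := nb v i, 31 := 0, 30 := addr x 0),
     mem := (mem s1)(addr x 0 := nb v i)\<rparr>" for i
  have "wp (Seq (get_nbr 17 11 16) (awrite 0 10 17)) (\<lambda>t s2. t = 17 \<and> s2 = S (regs s' 16)) 0 s'"
    if "s' \<in> set_pmf U" for s'
  proof -
    from that setU obtain i where i: "i < deg v" "s' = R i" by auto
    then show ?thesis
      using e x v addr_bound(1)[OF x(2)] by (simp add: R_def s1_def S_def)
  qed
  then have "\<exists>h. yields (Seq (Rand 16 13) (Seq (get_nbr 17 11 16) (awrite 0 10 17))) s1 19
      (map_pmf h U) \<and> (\<forall>s'\<in>set_pmf U. h s' = S (regs s' 16))"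
    by (rule yields_wp[OF 2]) simp_all
  then obtain h1 where
    h1: "yields (Seq (Rand 16 13) (Seq (get_nbr 17 11 16) (awrite 0 10 17))) s1 19 (map_pmf h1 U)"
    "\<And>s'. s' \<in> set_pmf U \<Longrightarrow> h1 s' = S (regs s' 16)"
    by blast
  have "map_pmf h1 U = map_pmf S (pmf_of_set {..<deg v})"
    using h1(2) setU D1 unfolding U_def pmf.map_comp
    by (intro map_pmf_cong refl) (simp add: R_def set_pmf_of_set lessThan_empty_iff)
  with yields_Seq[OF 1, of _ 19 "\<lambda>_. map_pmf h1 U"] h1(1)
  have 3: "yields (Seq (seqs [Binop Div 11 10 3, Degree 12 11, Binop Add 13 12 7])
       (Seq (Rand 16 13) (Seq (get_nbr 17 11 16) (awrite 0 10 17)))) s 25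
       (map_pmf S (pmf_of_set {..<deg v}))"
    by (simp add: bind_return_pmf)
  define T where "T s' = s'\<lparr>regs := (regs s')(10 := Suc x,
     39 := if Suc x < n * (2 * K) then 1 else 0)\<rparr>" for s' :: state
  have "wp (Seq (Binop Add 10 10 7) (Binop Less 39 10 6)) (\<lambda>t s2. t = 3 \<and> s2 = T s') 0 s'"
    if "s' \<in> set_pmf (map_pmf S (pmf_of_set {..<deg v}))" for s'
  proof -
    from that obtain i where "s' = S i" by auto
    then show ?thesis
      using e x lt by (simp add: S_def s1_def T_def set_reg_def)
  qed
  then have "\<exists>h. yields sample_body s 29 (map_pmf h (map_pmf S (pmf_of_set {..<deg v}))) \<and>
      (\<forall>s'\<in>set_pmf (map_pmf S (pmf_of_set {..<deg v})). h s' = T s')"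
    unfolding sample_body_def by (rule yields_wp[OF 3]) simp_all
  then obtain h2 where
    h2: "yields sample_body s 29 (map_pmf h2 (map_pmf S (pmf_of_set {..<deg v})))"
    "\<And>s'. s' \<in> set_pmf (map_pmf S (pmf_of_set {..<deg v})) \<Longrightarrow> h2 s' = T s'"
    by blast
  \<comment> \<open>The final state also records the index drawn, whereas the claim is about the
    vertex drawn; inverting \<open>nb v\<close> recovers the index.\<close>
  define G where "G y = T (S (inv_into {..<deg v} (nb v) y))" for y
  have "map_pmf h2 (map_pmf S (pmf_of_set {..<deg v})) = map_pmf T (map_pmf S (pmf_of_set {..<deg v}))"
    by (intro map_pmf_cong refl h2(2))
  also have "\<dots> = map_pmf G (map_pmf (nb v) (pmf_of_set {..<deg v}))"
    unfolding pmf.map_comp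
    using D1 inj_on_nb[OF v]
    by (intro map_pmf_cong refl) (simp add: G_def inv_into_f_f set_pmf_of_set lessThan_empty_iff)
  finally have "yields sample_body s 29 (map_pmf G (pmf_of_set (nbhd v)))"
    using h2(1) by (simp add: pmf_of_set_nbhd[OF v])
  moreover have "sampled x (Suc x) (\<lambda>_. y) s (G y) \<and>
        regs (G y) 10 = Suc x \<and> regs (G y) 39 = (if Suc x < n * (2 * K) then 1 else 0)"
    if "y \<in> nbhd v" for y
  proof -
    have "nb v (inv_into {..<deg v} (nb v) y) = y"
      using that nb_image[of v] by (intro f_inv_into_f) simp
    then show ?thesis
      using e by (auto simp: G_def T_def S_def s1_def sampled_def env_def arr_def addr_eq_iff)
  qed
  ultimately show ?thesis using that by (simp add: v_def)
qed

text \<open>Drawing one sample and then running the rest of the loop is the decomposition of a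
  product distribution at its first coordinate; the successive draws thereby become one
  \<open>Pi_pmf\<close>. Each pass takes 29 steps and one test of the flag.\<close>

lemma yields_sampling_loop:
  assumes "env s" "regs s 10 = x" "x \<le> n * (2 * K)" "regs s 39 = (if x < n * (2 * K) then 1 else 0)"
  shows "\<exists>F. yields (While 39 sample_body) s (Suc (30 * (n * (2 * K) - x)))
       (map_pmf F (Pi_pmf {x..<n * (2 * K)} 0 (\<lambda>i. pmf_of_set (nbhd (i div (2 * K)))))) \<and>
     (\<forall>X. (\<forall>i\<in>{x..<n * (2 * K)}. X i \<in> nbhd (i div (2 * K))) \<longrightarrow>
        sampled x (n * (2 * K)) X s (F X))"
  using assms
proof (induction "n * (2 * K) - x" arbitrary: x s)
  case 0
  then have "yields (While 39 sample_body) s 1 (return_pmf s)"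
    by (intro yields_While_False) simp
  with 0 show ?case
    by (intro exI[of _ "\<lambda>_. s"]) (simp add: sampled_def)
next
  case (Suc m)
  let ?N = "n * (2 * K)"
  let ?p = "\<lambda>i. pmf_of_set (nbhd (i div (2 * K)))"
  let ?loop = "While 39 sample_body"
  have x: "x < ?N" using Suc.hyps(2) by simp
  obtain G where
    G: "yields sample_body s 29 (map_pmf G (?p x))"
    "\<And>y. y \<in> nbhd (x div (2 * K)) \<Longrightarrow> sampled x (Suc x) (\<lambda>_. y) s (G y) \<and>
        regs (G y) 10 = Suc x \<and> regs (G y) 39 = (if Suc x < ?N then 1 else 0)"
    using yields_sample_body[OF Suc.prems(1,2) x] by blast
  have ne: "nbhd (x div (2 * K)) \<noteq> {}" by (simp add: nbhd_def)
  have "\<exists>F. yields ?loop (G y) (Suc (30 * (?N - Suc x))) (map_pmf F (Pi_pmf {Suc x..<?N} 0 ?p)) \<and>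
     (\<forall>X. (\<forall>i\<in>{Suc x..<?N}. X i \<in> nbhd (i div (2 * K))) \<longrightarrow> sampled (Suc x) ?N X (G y) (F X))"
    if "y \<in> nbhd (x div (2 * K))" for y
    by (rule Suc.hyps(1)) (use Suc.hyps(2) G(2)[OF that] x in \<open>simp_all add: sampled_def\<close>)
  then obtain F where F: "\<And>y. y \<in> nbhd (x div (2 * K)) \<Longrightarrow>
      yields ?loop (G y) (Suc (30 * (?N - Suc x))) (map_pmf (F y) (Pi_pmf {Suc x..<?N} 0 ?p)) \<and>
     (\<forall>X. (\<forall>i\<in>{Suc x..<?N}. X i \<in> nbhd (i div (2 * K))) \<longrightarrow> sampled (Suc x) ?N X (G y) (F y X))"
    by metis
  have body: "runs 29 (sample_body # cs, s) = map_pmf (Pair cs) (map_pmf G (?p x))" for cs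
    using G(1) by (simp add: yields_def)
  have "yields ?loop s (Suc (29 + Suc (30 * (?N - Suc x))))
    (bind_pmf (?p x) (\<lambda>y. map_pmf (F y) (Pi_pmf {Suc x..<?N} 0 ?p)))"
    unfolding yields_def
  proof
    fix cs
    have "runs (Suc (29 + Suc (30 * (?N - Suc x)))) (?loop # cs, s) =
        bind_pmf (runs 29 (sample_body # ?loop # cs, s)) (runs (Suc (30 * (?N - Suc x))))"
    proof -
      have "runs (Suc j) (?loop # cs, s) = runs j (sample_body # ?loop # cs, s)" for j
        using Suc.prems(4) x by (simp add: bind_return_pmf)
      then show ?thesis by (simp only: runs_add)
    qed
    also have "\<dots> = bind_pmf (?p x) (\<lambda>y. runs (Suc (30 * (?N - Suc x))) (?loop # cs, G y))"
      by (simp add: body map_pmf_def bind_assoc_pmf bind_return_pmf del: runs.simps)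
    also have "\<dots> = bind_pmf (?p x) (\<lambda>y. map_pmf (Pair cs) (map_pmf (F y) (Pi_pmf {Suc x..<?N} 0 ?p)))"
      using F ne by (intro bind_pmf_cong refl) (simp add: set_pmf_of_set yields_def del: runs.simps)
    finally show "runs (Suc (29 + Suc (30 * (?N - Suc x)))) (?loop # cs, s) =
        map_pmf (Pair cs) (bind_pmf (?p x) (\<lambda>y. map_pmf (F y) (Pi_pmf {Suc x..<?N} 0 ?p)))"
      by (simp add: map_bind_pmf)
  qed
  moreover have "Suc (29 + Suc (30 * (?N - Suc x))) = Suc (30 * (?N - x))"
    using x by simp
  \<comment> \<open>Arrays drawn for the remaining indices have the default \<open>0\<close> at
    \<open>x\<close>; hence the reset \<open>X(x := 0)\<close> when the array is split.\<close>
  moreover have "bind_pmf (?p x) (\<lambda>y. map_pmf (F y) (Pi_pmf {Suc x..<?N} 0 ?p)) =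
      map_pmf (\<lambda>X. F (X x) (X(x := 0))) (Pi_pmf {x..<?N} 0 ?p)"
  proof -
    have "{x..<?N} = insert x {Suc x..<?N}" using x by auto
    then have "map_pmf (\<lambda>X. F (X x) (X(x := 0))) (Pi_pmf {x..<?N} 0 ?p) =
        bind_pmf (?p x) (\<lambda>y. map_pmf (\<lambda>f. F y (f(x := 0))) (Pi_pmf {Suc x..<?N} 0 ?p))"
      by (simp add: Pi_pmf_insert' map_pmf_def bind_assoc_pmf bind_return_pmf)
    also have "\<dots> = bind_pmf (?p x) (\<lambda>y. map_pmf (F y) (Pi_pmf {Suc x..<?N} 0 ?p))"
    proof (intro bind_pmf_cong refl map_pmf_cong)
      fix y f assume "f \<in> set_pmf (Pi_pmf {Suc x..<?N} 0 ?p)"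
      with set_Pi_pmf_subset[of "{Suc x..<?N}" 0 ?p] have "f x = 0" by auto
      then have "f(x := 0) = f" by auto
      then show "F y (f(x := 0)) = F y f" by simp
    qed
    finally show ?thesis by simp
  qed
  moreover have "sampled x ?N X s (F (X x) (X(x := 0)))"
    if X: "\<forall>i\<in>{x..<?N}. X i \<in> nbhd (i div (2 * K))" for X
  proof -
    have "X x \<in> nbhd (x div (2 * K))" using X x by simp
    note 1 = G(2)[OF this] and 2 = F[OF this]
    have "sampled (Suc x) ?N (X(x := 0)) (G (X x)) (F (X x) (X(x := 0)))"
      using 2 X by auto
    with 1 x show ?thesis by (auto simp: sampled_def intro!: arg_cong[where f = X])
  qed
  ultimately show ?case
    by (intro exI[of _ "\<lambda>X. F (X x) (X(x := 0))"] conjI allI impI) (simp_all only:)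
qed

lemma yields_sampling_phase:
  assumes "env s"
  obtains F where "yields sampling_phase s (5 + 30 * (n * (2 * K)))
     (map_pmf F (Pi_pmf {..<n * (2 * K)} 0 (\<lambda>i. pmf_of_set (nbhd (i div (2 * K))))))"
    "\<And>X. (\<And>i. i < n * (2 * K) \<Longrightarrow> X i \<in> nbhd (i div (2 * K))) \<Longrightarrow>
        sampled 0 (n * (2 * K)) X s (F X)"
proof -
  define s1 where "s1 = s\<lparr>regs := (regs s)(10 := 0, 39 := if 0 < n * (2 * K) then 1 else 0)\<rparr>"
  have 1: "env s1" "regs s1 10 = 0" "regs s1 39 = (if 0 < n * (2 * K) then 1 else 0)"
    using assms by (simp_all add: s1_def env_def)
  from yields_sampling_loop[OF 1(1,2) le0 1(3)] obtain F where
    F: "yields (While 39 sample_body) s1 (Suc (30 * (n * (2 * K))))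
       (map_pmf F (Pi_pmf {..<n * (2 * K)} 0 (\<lambda>i. pmf_of_set (nbhd (i div (2 * K))))))"
     "\<And>X. (\<forall>i\<in>{..<n * (2 * K)}. X i \<in> nbhd (i div (2 * K))) \<longrightarrow>
        sampled 0 (n * (2 * K)) X s1 (F X)"
    by (auto simp: atLeast0LessThan)
  have "step w n adj (Imm 10 0 # cs, s) = return_pmf (cs, set_reg w 10 0 s)"
    "step w n adj (Binop Less 39 10 6 # cs, set_reg w 10 0 s) = return_pmf (cs, s1)" for cs
    using assms by (simp_all add: s1_def set_reg_def env_def)
  then have "runs (4 + k) (sampling_phase # cs, s) = runs k (While 39 sample_body # cs, s1)" for k cs
    by (simp add: sampling_phase_def forloop_def loop_rest_def sample_body_def eval_nat_numeral
        bind_return_pmf del: step.simps(3,4))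
  from this[of "Suc (30 * (n * (2 * K)))"] F(1)
  have "yields sampling_phase s (5 + 30 * (n * (2 * K)))
     (map_pmf F (Pi_pmf {..<n * (2 * K)} 0 (\<lambda>i. pmf_of_set (nbhd (i div (2 * K))))))"
    by (simp add: yields_def del: runs.simps)
  moreover have "sampled 0 (n * (2 * K)) X s (F X)"
    if "\<And>i. i < n * (2 * K) \<Longrightarrow> X i \<in> nbhd (i div (2 * K))" for X
  proof -
    have s1: "arr s1 = arr s" "regs s1 4 = regs s 4" "queries s1 = queries s"
      by (simp_all add: s1_def)
    show ?thesis using F(2)[of X] that unfolding sampled_def s1 by simp
  qed
  ultimately show ?thesis using that by blast
qed

lemma runs_Seq: "runs (Suc k) (Seq c d # cs, s) = runs k (c # d # cs, s)"
  by (simp add: bind_return_pmf)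

definition sample_space :: "(nat \<Rightarrow> nat) set" where
  "sample_space = {X. \<forall>i < n * (2 * K). X i \<in> nbhd (i div (2 * K))}"

definition samples :: "(nat \<Rightarrow> nat) pmf" where
  "samples = Pi_pmf {..<n * (2 * K)} 0 (\<lambda>i. pmf_of_set (nbhd (i div (2 * K))))"

lemma set_samples: "set_pmf samples \<subseteq> sample_space"
proof
  fix X assume "X \<in> set_pmf samples"
  then have "X \<in> PiE_dflt {..<n * (2 * K)} 0 (set_pmf \<circ> (\<lambda>i. pmf_of_set (nbhd (i div (2 * K)))))"
    unfolding samples_def by (subst (asm) set_Pi_pmf) simp_all
  then show "X \<in> sample_space"
    by (auto simp: PiE_dflt_def sample_space_def set_pmf_of_set nbhd_def)
qed

definition correct :: "(nat \<Rightarrow> nat) \<Rightarrow> state \<Rightarrow> bool" where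
  "correct X s \<longleftrightarrow> queries s \<le> query_bound n K \<and>
     (\<forall>u<n. elected X (fst (label_state X (3 * n * K) n)) K u (mem s u))"

text \<open>Once the samples are in memory the program is deterministic, so the run at the time
  bound is the image of \<open>samples\<close> under a function \<open>F\<close>. Everything said
  later about probabilities refers to \<open>samples\<close>.\<close>

lemma run_program:
  assumes K: "K = 1200 * floorlog 2 n"
  obtains F where "run program w n adj (time_bound n K) = map_pmf (\<lambda>X. ([], F X)) samples"
    "\<And>X. X \<in> sample_space \<Longrightarrow> correct X (F X)"
proof -
  let ?N = "n * (2 * K)"
  have "wp parameters (\<lambda>t s'. t \<le> 40 + K \<and> env s' \<and> regs s' 4 = 3 * n * K \<and> mem s' = (\<lambda>_. 0) \<and>
      queries s' = 0) 0 (init_state n)"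
    by (rule wp_parameters[OF K]) simp
  from wp_sound[OF this] obtain kp sp where
    kp: "yields parameters (init_state n) kp (return_pmf sp)" "kp \<le> 40 + K" and
    sp: "env sp" "regs sp 4 = 3 * n * K" "mem sp = (\<lambda>_. 0)" "queries sp = 0"
    by auto
  obtain F where
    F: "yields sampling_phase sp (5 + 30 * ?N) (map_pmf F samples)"
    "\<And>X. (\<And>i. i < ?N \<Longrightarrow> X i \<in> nbhd (i div (2 * K))) \<Longrightarrow> sampled 0 ?N X sp (F X)"
    using yields_sampling_phase[OF sp(1)] unfolding samples_def by blast
  define tb where "tb = 30 + (700 + 40 * K) * (n + 3 * n * K) + n * (300 + 300 * K + 40 * (K * K))"
  have "\<exists>k s'. yields (seqs [clustering_phase, voting_phase]) (F X) k (return_pmf s') \<and> k \<le> tb \<and> correct X s'"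
    if X: "X \<in> sample_space" for X
  proof -
    have Xi: "X i \<in> nbhd (i div (2 * K))" if "i < ?N" for i
      using X that by (simp add: sample_space_def)
    have Xn: "X i < n" if "i < ?N" for i
      using Xi[OF that] nbhd_subset[OF less_mult_imp_div_less[OF that]] by auto
    have "sampled 0 ?N X sp (F X)" by (rule F(2)) (rule Xi)
    then have s: "env (F X)" "regs (F X) 4 = 3 * n * K" "queries (F X) = 4 * (n * K)"
      "\<And>i. i < ?N \<Longrightarrow> arr (F X) 0 i = X i" "arr (F X) 1 = (\<lambda>_. 0)" "arr (F X) 2 = (\<lambda>_. 0)"
      "arr (F X) 3 = (\<lambda>_. 0)"
      using sp by (auto simp: sampled_def arr_def)
    have wf: "wf_mem X (F X)" using s Xn by (simp add: wf_mem_def)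
    have B: "3 * n * K < 2 ^ w" using bounds by (simp add: mult.assoc)
    have "wp clustering_phase (wp voting_phase (\<lambda>t s'. t \<le> tb \<and> correct X s')) 1 (F X)"
    proof (rule wp_clustering_phase[OF s(1) wf s(2) B s(5-7)], goal_cases)
      case (1 t1 s1)
      show ?case
      proof (rule wp_voting_phase[OF 1(2,3)], goal_cases)
        case (1 t2 s2)
        note 2 = \<open>arr s1 1 = _\<close> \<open>queries s1 \<le> _\<close> \<open>t1 \<le> _\<close>
        show ?case
          using 1 2 s(3) by (auto simp: correct_def tb_def query_bound_def mult.commute[of n K])
      qed
    qed
    then have "wp (seqs [clustering_phase, voting_phase]) (\<lambda>t s'. t \<le> tb \<and> correct X s') 0 (F X)"
      unfolding seqs.simps by simp
    from wp_sound[OF this] show ?thesis by auto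
  qed
  then obtain k G where kG: "\<And>X. X \<in> sample_space \<Longrightarrow>
      yields (seqs [clustering_phase, voting_phase]) (F X) (k X) (return_pmf (G X)) \<and> k X \<le> tb \<and> correct X (G X)"
    by metis
  \<comment> \<open>The durations \<open>k X\<close> differ between sample arrays, but halted
    configurations no longer change; so all executions can be observed at a common time.\<close>
  have fin: "runs (tb + j) ([seqs [clustering_phase, voting_phase]], F X) = return_pmf ([], G X)"
    if "X \<in> sample_space" for X j
  proof -
    have "tb + j = k X + (tb + j - k X)" using kG[OF that] by simp
    then have "runs (tb + j) ([seqs [clustering_phase, voting_phase]], F X) =
        bind_pmf (runs (k X) ([seqs [clustering_phase, voting_phase]], F X)) (runs (tb + j - k X))"
      by (metis runs_add)
    also have "\<dots> = return_pmf ([], G X)"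
      using kG[OF that] by (simp add: yields_def bind_return_pmf runs_halted)
    finally show ?thesis .
  qed
  \<comment> \<open>Idle steps: \<open>j\<close> makes up for parameters computed in fewer than
    \<open>40 + K\<close> steps, and \<open>23\<close> completes the constant \<open>100\<close> of
    \<open>time_bound\<close>.\<close>
  define j where "j = 40 + K - kp"
  have "time_bound n K = Suc (kp + Suc (5 + 30 * ?N + (tb + j + 23)))"
    using kp(2) by (simp add: time_bound_def tb_def j_def)
  moreover have "runs (Suc (kp + Suc (5 + 30 * ?N + (tb + j + 23)))) ([program], init_state n) =
      map_pmf (\<lambda>X. ([], G X)) samples"
  proof -
    have unf: "program = Seq parameters (Seq sampling_phase (seqs [clustering_phase, voting_phase]))"
      by (simp add: program_def seqs.simps)
    have "runs (Suc (kp + Suc (5 + 30 * ?N + (tb + j + 23)))) ([program], init_state n) =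
        runs (kp + Suc (5 + 30 * ?N + (tb + j + 23)))
          ([parameters, Seq sampling_phase (seqs [clustering_phase, voting_phase])], init_state n)"
      unfolding unf by (rule runs_Seq)
    also have "\<dots> = runs (Suc (5 + 30 * ?N + (tb + j + 23))) ([Seq sampling_phase (seqs [clustering_phase, voting_phase])], sp)"
      using kp(1) by (subst runs_add) (simp add: yields_def bind_return_pmf del: runs.simps)
    also have "\<dots> = runs (5 + 30 * ?N + (tb + j + 23)) ([sampling_phase, seqs [clustering_phase, voting_phase]], sp)"
      by (rule runs_Seq)
    also have "\<dots> = bind_pmf samples (\<lambda>X. runs (tb + (j + 23)) ([seqs [clustering_phase, voting_phase]], F X))"
      using F(1) by (subst runs_add)
        (simp add: yields_def map_pmf_def bind_assoc_pmf bind_return_pmf add.assoc del: runs.simps)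
    also have "\<dots> = bind_pmf samples (\<lambda>X. return_pmf ([], G X))"
      using set_samples by (intro bind_pmf_cong refl fin) auto
    finally show ?thesis by (simp add: map_pmf_def)
  qed
  ultimately have "run program w n adj (time_bound n K) = map_pmf (\<lambda>X. ([], G X)) samples"
    by (simp only: run_eq_runs)
  with kG that show ?thesis by blast
qed

end

section \<open>Comparison with an optimal clustering\<close>

definition part_of :: "'a set set \<Rightarrow> 'a \<Rightarrow> 'a set" where
  "part_of P v = \<Union>{A \<in> P. v \<in> A}"

lemma part_of_eq:
  assumes "partition_on V P" "A \<in> P" "v \<in> A"
  shows "part_of P v = A"
proof -
  have "{B \<in> P. v \<in> B} = {A}"
    using assms partition_onD2[OF assms(1)] by (auto simp: disjoint_def)
  then show ?thesis by (simp add: part_of_def)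
qed

lemma part_of_in:
  assumes "partition_on V P" "v \<in> V"
  shows "part_of P v \<in> P" "v \<in> part_of P v"
proof -
  obtain A where "A \<in> P" "v \<in> A" using assms partition_onD1 by blast
  with part_of_eq[OF assms(1)] show "part_of P v \<in> P" "v \<in> part_of P v" by auto
qed

lemma part_of_subset:
  assumes "partition_on V P" "v \<in> V"
  shows "part_of P v \<subseteq> V"
  using part_of_in[OF assms] partition_onD1[OF assms(1)] by blast

lemma same_cluster_iff:
  assumes "partition_on V P" "u \<in> V" "v \<in> V"
  shows "same_cluster P {u, v} \<longleftrightarrow> u \<in> part_of P v"
proof
  assume "same_cluster P {u, v}"
  then obtain A where A: "A \<in> P" "u \<in> A" "v \<in> A" by (auto simp: same_cluster_def)
  with part_of_eq[OF assms(1) A(1,3)] show "u \<in> part_of P v" by simp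
next
  assume "u \<in> part_of P v"
  with part_of_in[OF assms(1,3)] show "same_cluster P {u, v}"
    unfolding same_cluster_def by (intro bexI[of _ "part_of P v"]) auto
qed

lemma sum_edges_double:
  fixes f :: "'a set \<Rightarrow> nat"
  assumes "finite V"
  shows "(\<Sum>v\<in>V. \<Sum>u\<in>V - {v}. f {u, v}) = 2 * (\<Sum>e\<in>edges V. f e)"
proof -
  let ?S = "Sigma V (\<lambda>v. V - {v})"
  let ?g = "\<lambda>(v, u). {u, v}"
  have fS: "finite ?S" using assms by simp
  have fin: "finite (edges V)" using assms by (simp add: edges_def)
  have "(\<Sum>v\<in>V. \<Sum>u\<in>V - {v}. f {u, v}) = (\<Sum>p\<in>?S. f (?g p))"
    using assms by (simp add: sum.Sigma case_prod_unfold)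
  also have "\<dots> = (\<Sum>e\<in>edges V. \<Sum>p\<in>{p \<in> ?S. ?g p = e}. f (?g p))"
    by (rule sum.group[OF fS fin, symmetric]) (auto simp: edges_def card_insert_if)
  also have "\<dots> = (\<Sum>e\<in>edges V. 2 * f e)"
  proof (rule sum.cong[OF refl])
    fix e assume "e \<in> edges V"
    then obtain a b where e: "e = {a, b}" "a \<noteq> b" "a \<in> V" "b \<in> V"
      by (auto simp: edges_def card_2_iff)
    then have "{p \<in> ?S. ?g p = e} = {(a, b), (b, a)}" by (auto simp: doubleton_eq_iff)
    then show "(\<Sum>p\<in>{p \<in> ?S. ?g p = e}. f (?g p)) = 2 * f e"
      using e by (simp add: insert_commute)
  qed
  finally show ?thesis by (simp add: sum_distrib_left)
qed

text \<open>Each vertex is charged with its incident disagreements, so every edge is counted twice.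
  With closed neighborhoods the vertex itself lies in both sets and cancels, which leaves a plain
  symmetric difference.\<close>

lemma cc_cost_eq:
  assumes "finite V" "partition_on V P"
  shows "2 * cc_cost V lab P = (\<Sum>v\<in>V. card (sym_diff (insert v (pos_nbrs V lab v)) (part_of P v)))"
proof -
  have "(\<Sum>u\<in>V - {v}. edge_cost lab P {u, v}) =
      card (sym_diff (insert v (pos_nbrs V lab v)) (part_of P v))" if v: "v \<in> V" for v
  proof -
    let ?D = "sym_diff (insert v (pos_nbrs V lab v)) (part_of P v)"
    have sub: "?D \<subseteq> V - {v}"
      using part_of_subset[OF assms(2) v] part_of_in[OF assms(2) v] v
      by (auto simp: pos_nbrs_def edges_def)
    have "edge_cost lab P {u, v} = (if u \<in> ?D then 1 else 0)" if "u \<in> V - {v}" for u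
      using that v same_cluster_iff[OF assms(2), of u v]
      by (cases "lab {u, v}") (auto simp: edge_cost_def pos_nbrs_def edges_def)
    then have "(\<Sum>u\<in>V - {v}. edge_cost lab P {u, v}) = (\<Sum>u\<in>V - {v}. if u \<in> ?D then 1 else 0)"
      by (intro sum.cong) auto
    also have "\<dots> = card ((V - {v}) \<inter> ?D)"
    proof -
      have "(\<Sum>u\<in>V - {v}. if u \<in> D then 1 else 0) = card ((V - {v}) \<inter> D)" for D
        using assms(1) by (simp add: sum.If_cases)
      then show ?thesis .
    qed
    also have "(V - {v}) \<inter> ?D = ?D" using sub by blast
    finally show ?thesis .
  qed
  then show ?thesis
    unfolding cc_cost_def sum_edges_double[OF assms(1), symmetric] by (rule sum.cong[OF refl])
qed

lemma card_le_card_sym_diff: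
  assumes "finite A" "finite B"
  shows "real (card A) \<le> real (card B) + real (card (sym_diff A B))"
proof -
  have "card A \<le> card (B \<union> sym_diff A B)" using assms by (intro card_mono) auto
  also have "\<dots> \<le> card B + card (sym_diff A B)" by (rule card_Un_le)
  finally show ?thesis by linarith
qed

lemma card_sym_diff_le:
  assumes "finite A" "finite B"
  shows "real (card (sym_diff A B)) \<le> real (card A) + real (card B)"
proof -
  have "card (sym_diff A B) \<le> card (A \<union> B)" using assms by (intro card_mono) auto
  also have "\<dots> \<le> card A + card B" by (rule card_Un_le)
  finally show ?thesis by linarith
qed

lemma sum_card_swap:
  assumes "finite A" "finite B"
  shows "(\<Sum>a\<in>A. card {b \<in> B. R a b}) = (\<Sum>b\<in>B. card {a \<in> A. R a b})"
proof -
  have card: "card {x \<in> S. Q x} = (\<Sum>x\<in>S. of_bool (Q x))" if "finite S" for S :: "'c set" and Q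
    using that by (simp add: of_bool_def sum.If_cases Int_def)
  have "(\<Sum>a\<in>A. card {b \<in> B. R a b}) = (\<Sum>a\<in>A. \<Sum>b\<in>B. of_bool (R a b))"
    using assms(2) by (intro sum.cong refl card)
  also have "\<dots> = (\<Sum>b\<in>B. \<Sum>a\<in>A. of_bool (R a b))" by (rule sum.swap)
  also have "\<dots> = (\<Sum>b\<in>B. card {a \<in> A. R a b})"
    using assms(1) by (intro sum.cong refl card[symmetric])
  finally show ?thesis .
qed

text \<open>
  \<open>nbhd\<close> are the closed positive neighborhoods.  \<open>P\<close> is an arbitrary clustering, later an optimal
  one.  \<open>elig u l\<close> means that \<open>u\<close> is put into the cluster with label \<open>l\<close>.
\<close>

locale clustering_analysis =
  fixes n :: nat and nbhd :: "nat \<Rightarrow> nat set" and P :: "nat set set"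
    and Z :: "nat set" and sel :: "nat \<Rightarrow> bool" and core :: "nat \<Rightarrow> nat set"
    and L :: "nat \<Rightarrow> nat" and elig :: "nat \<Rightarrow> nat \<Rightarrow> bool" and out :: "nat \<Rightarrow> nat"
  assumes nbhd_self: "v < n \<Longrightarrow> v \<in> nbhd v"
    and nbhd_sub: "v < n \<Longrightarrow> nbhd v \<subseteq> {..<n}"
    and nbhd_sym: "u < n \<Longrightarrow> v < n \<Longrightarrow> u \<in> nbhd v \<Longrightarrow> v \<in> nbhd u"
    and P: "partition_on {..<n} P"
    and Z_less: "z \<in> Z \<Longrightarrow> z < n"
    and core_sub: "z < n \<Longrightarrow> core z \<subseteq> nbhd z"
    and core_sound: "z < n \<Longrightarrow> u \<in> core z \<Longrightarrow>
        85 * card (nbhd u) \<le> 100 * card (nbhd u \<inter> nbhd z) \<and> 10 * card (nbhd z) \<le> 11 * card (nbhd u)"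
    and core_complete: "z < n \<Longrightarrow> u \<in> nbhd z \<Longrightarrow>
        95 * card (nbhd u) \<le> 100 * card (nbhd u \<inter> nbhd z) \<Longrightarrow>
        10 * card (nbhd z) \<le> 11 * card (nbhd u) \<Longrightarrow> u \<in> core z"
    and Z_large: "z \<in> Z \<Longrightarrow> 9 * card (nbhd z) \<le> 10 * card (core z)"
    and Z_complete: "z < n \<Longrightarrow> sel z \<Longrightarrow> 9 * card (nbhd z) \<le> 10 * card (core z) \<Longrightarrow> z \<in> Z"
    and label: "u < n \<Longrightarrow>
        L u = (if \<exists>z\<in>Z. u \<in> core z then Suc (LEAST z. z \<in> Z \<and> u \<in> core z) else 0)"
    and elig_sound: "u < n \<Longrightarrow> elig u l \<Longrightarrow> 0 < l \<and>
        45 * card (nbhd u) \<le> 100 * card (nbhd u \<inter> L -` {l}) \<and>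
        4 * card (nbhd (l - 1)) \<le> 5 * card (nbhd u)"
    and elig_complete: "u < n \<Longrightarrow> 0 < l \<Longrightarrow>
        60 * card (nbhd u) \<le> 100 * card (nbhd u \<inter> L -` {l}) \<Longrightarrow>
        4 * card (nbhd (l - 1)) \<le> 5 * card (nbhd u) \<Longrightarrow> elig u l"
    and out_elig: "u < n \<Longrightarrow> elig u l \<Longrightarrow> out u = l"
    and out_not_elig: "u < n \<Longrightarrow> (\<And>l. \<not> elig u l) \<Longrightarrow> out u = Suc (u + n)"
begin

definition d :: "nat \<Rightarrow> real" where
  "d v = real (card (nbhd v))"

definition err :: "nat \<Rightarrow> real" where
  "err v = real (card (sym_diff (nbhd v) (part_of P v)))"

definition good :: "nat \<Rightarrow> bool" where
  "good v \<longleftrightarrow> 100 * err v \<le> d v"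

definition clust :: "nat \<Rightarrow> nat set" where
  "clust u = {v. v < n \<and> out v = out u}"

definition cost :: "nat \<Rightarrow> real" where
  "cost v = real (card (sym_diff (nbhd v) (clust v)))"

lemma finite_nbhd: "v < n \<Longrightarrow> finite (nbhd v)"
  using nbhd_sub finite_subset by blast

lemma finite_core: "z < n \<Longrightarrow> finite (core z)"
  using core_sub finite_nbhd finite_subset by metis

lemma err_nonneg: "0 \<le> err v" and d_nonneg: "0 \<le> d v"
  by (simp_all add: err_def d_def)

lemma d_pos: "v < n \<Longrightarrow> 1 \<le> d v"
  using nbhd_self[of v] finite_nbhd[of v] card_gt_0_iff[of "nbhd v"] by (auto simp: d_def)

lemma labelled:
  assumes "u < n" "L u = Suc z"
  shows "z \<in> Z" "u \<in> core z"
proof -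
  have ex: "\<exists>z. z \<in> Z \<and> u \<in> core z" and z: "z = (LEAST z. z \<in> Z \<and> u \<in> core z)"
    using assms label[of u] by (auto split: if_splits)
  from LeastI_ex[OF ex] z show "z \<in> Z" "u \<in> core z" by auto
qed

lemma elig_center:
  assumes "u < n" "elig u l"
  obtains z where "l = Suc z" "z \<in> Z" "45 * d u \<le> 100 * real (card (nbhd u \<inter> L -` {Suc z}))"
    "4 * d z \<le> 5 * d u"
proof -
  note 1 = elig_sound[OF assms]
  then obtain z where z: "l = Suc z" by (cases l) auto
  have "0 < card (nbhd u)" using d_pos[OF assms(1)] by (simp add: d_def)
  with 1 have "nbhd u \<inter> L -` {l} \<noteq> {}" by auto
  then obtain x where "x \<in> nbhd u" "L x = Suc z" using z by auto
  with nbhd_sub[OF assms(1)] have "z \<in> Z" by (intro labelled(1)[of x]) auto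
  moreover have "45 * d u \<le> 100 * real (card (nbhd u \<inter> L -` {Suc z}))" "4 * d z \<le> 5 * d u"
    using 1 z unfolding d_def by (simp_all add: of_nat_le_iff[where 'a = real, symmetric] del: of_nat_le_iff)
  ultimately show ?thesis using z that by blast
qed

text \<open>Labels are at most \<open>n\<close> and default identifiers exceed \<open>n\<close>, so
  no vertex enters a labelled cluster by default.\<close>

lemma clust_elig:
  assumes "u < n" "elig u l"
  shows "clust u = {v. v < n \<and> elig v l}"
proof -
  obtain z where "l = Suc z" "z \<in> Z" using elig_center[OF assms] by blast
  then have "l \<le> n" using Z_less[of z] by simp
  have "elig v l" if "v < n" "out v = l" for v
  proof (cases "\<exists>l'. elig v l'")
    case True
    with out_elig that show ?thesis by blast
  next
    case False
    with out_not_elig[OF that(1)] that \<open>l \<le> n\<close> show ?thesis by auto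
  qed
  then show ?thesis using out_elig assms by (auto simp: clust_def)
qed

lemma clust_not_elig:
  assumes "u < n" "\<And>l. \<not> elig u l"
  shows "clust u = {u}"
proof -
  have u: "out u = Suc (u + n)" using out_not_elig assms by blast
  have "v = u" if v: "v < n" "out v = out u" for v
  proof (cases "\<exists>l. elig v l")
    case True
    then obtain l where l: "elig v l" by blast
    obtain z where "l = Suc z" "z \<in> Z" using elig_center[OF v(1) l] by blast
    with Z_less[of z] out_elig[OF v(1) l] u v(2) show ?thesis by simp
  next
    case False
    with out_not_elig[OF v(1)] u v(2) show ?thesis by auto
  qed
  with assms(1) show ?thesis by (auto simp: clust_def)
qed

text \<open>Double counting of adjacent pairs between the cluster \<open>E\<close> and the set
  \<open>S\<close> labelled by its center \<open>z\<close>. A member of \<open>E\<close> has at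
  least 45 percent of its neighborhood in \<open>S\<close>, and its degree is at least 4/5 of
  \<open>d z\<close>: this gives \<open>36 / 100 * d z\<close> pairs. A vertex of \<open>S\<close>
  has degree at most \<open>100 / 85 * d z\<close>, and \<open>S\<close> has at most
  \<open>d z\<close> elements. So \<open>E\<close> has fewer than \<open>3.3 * d z\<close> elements,
  and \<open>4 * d z\<close> is at most \<open>5 * d u\<close>.\<close>

lemma card_clust_le:
  assumes u: "u < n"
  shows "real (card (clust u)) \<le> 5 * d u"
proof (cases "\<exists>l. elig u l")
  case False
  then show ?thesis using clust_not_elig[OF u] d_pos[OF u] by auto
next
  case True
  then obtain l where l: "elig u l" by blast
  obtain z where z: "l = Suc z" "z \<in> Z" "4 * d z \<le> 5 * d u"
    using elig_center[OF u l] by blast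
  have zn: "z < n" using z Z_less by blast
  define E where "E = {v. v < n \<and> elig v (Suc z)}"
  define S where "S = {..<n} \<inter> L -` {Suc z}"
  have fin: "finite E" "finite S" by (auto simp: E_def S_def)
  have Sc: "S \<subseteq> core z" using labelled(2) by (auto simp: S_def)
  have "36 * d z * real (card E) \<le> (\<Sum>v\<in>E. 100 * real (card (nbhd v \<inter> S)))"
  proof -
    have "36 * d z \<le> 100 * real (card (nbhd v \<inter> S))" if "v \<in> E" for v
    proof -
      have v: "v < n" "elig v (Suc z)" using that by (auto simp: E_def)
      have "nbhd v \<inter> S = nbhd v \<inter> L -` {Suc z}" using nbhd_sub[OF v(1)] by (auto simp: S_def)
      then show ?thesis using elig_center[OF v] by (force simp: field_simps)
    qed
    then have "(\<Sum>v\<in>E. 36 * d z) \<le> (\<Sum>v\<in>E. 100 * real (card (nbhd v \<inter> S)))"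
      by (rule sum_mono)
    then show ?thesis by (simp add: mult.commute)
  qed
  also have "\<dots> = 100 * real (\<Sum>v\<in>E. card {x \<in> S. x \<in> nbhd v})"
    by (simp add: sum_distrib_left Int_def conj_commute)
  also have "(\<Sum>v\<in>E. card {x \<in> S. x \<in> nbhd v}) = (\<Sum>x\<in>S. card {v \<in> E. x \<in> nbhd v})"
    using fin by (rule sum_card_swap)
  also have "real \<dots> \<le> (\<Sum>x\<in>S. d x)"
  proof -
    have "card {v \<in> E. x \<in> nbhd v} \<le> card (nbhd x)" if "x \<in> S" for x
      using that nbhd_sym finite_nbhd by (intro card_mono) (auto simp: S_def E_def)
    then show ?thesis unfolding d_def of_nat_sum by (intro sum_mono) simp
  qed
  also have "\<dots> \<le> (\<Sum>x\<in>S. 100 / 85 * d z)"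
  proof (intro sum_mono)
    fix x assume x: "x \<in> S"
    then have "85 * card (nbhd x) \<le> 100 * card (nbhd x \<inter> nbhd z)"
      using core_sound[OF zn] Sc by blast
    moreover have "card (nbhd x \<inter> nbhd z) \<le> card (nbhd z)"
      using finite_nbhd[OF zn] by (intro card_mono) auto
    ultimately show "d x \<le> 100 / 85 * d z" unfolding d_def by linarith
  qed
  also have "\<dots> \<le> d z * (100 / 85 * d z)"
  proof -
    have "card S \<le> card (nbhd z)"
      using Sc core_sub[OF zn] finite_nbhd[OF zn] by (intro card_mono) auto
    then show ?thesis by (auto simp: d_def intro!: mult_right_mono)
  qed
  finally have "36 * d z * real (card E) \<le> 100 * (d z * (100 / 85 * d z))" by simp
  then have "d z * (36 * real (card E)) \<le> d z * (10000 / 85 * d z)" by (simp add: algebra_simps)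
  then have "36 * real (card E) \<le> 10000 / 85 * d z"
    using d_pos[OF zn] by (simp add: mult_le_cancel_left)
  moreover have "clust u = E" using clust_elig[OF u l] z by (simp add: E_def)
  ultimately show ?thesis using z(3) by simp
qed

lemma cost_le: "u < n \<Longrightarrow> cost u \<le> 6 * d u"
  using card_sym_diff_le[of "nbhd u" "clust u"] finite_nbhd[of u] card_clust_le[of u]
  by (simp add: cost_def d_def clust_def)

lemma part_sub: "Q \<in> P \<Longrightarrow> Q \<subseteq> {..<n}"
  using partition_onD1[OF P] by auto

lemma part_finite: "Q \<in> P \<Longrightarrow> finite Q" and part_less: "Q \<in> P \<Longrightarrow> v \<in> Q \<Longrightarrow> v < n"
  using part_sub finite_subset by blast+

lemma err_part:
  assumes "Q \<in> P" "v \<in> Q"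
  shows "real (card (nbhd v - Q)) \<le> err v" "real (card (Q - nbhd v)) \<le> err v"
    "d v \<le> card Q + err v" "card Q \<le> d v + err v"
proof -
  have Q: "part_of P v = Q" by (rule part_of_eq[OF P assms])
  have fin: "finite Q" "finite (nbhd v)" using part_finite part_less finite_nbhd assms by blast+
  show "real (card (nbhd v - Q)) \<le> err v" "real (card (Q - nbhd v)) \<le> err v"
    unfolding err_def Q using fin by (auto intro!: card_mono)
  show "d v \<le> card Q + err v"
    using card_le_card_sym_diff[OF fin(2,1)] by (simp add: d_def err_def Q)
  show "card Q \<le> d v + err v"
    using card_le_card_sym_diff[OF fin] by (simp add: d_def err_def Q Un_commute)
qed

lemma bad_err:
  assumes "Q \<in> P" "v \<in> Q" "\<not> good v"
  shows "real (card Q) \<le> 101 * err v"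
  using err_part(4)[OF assms(1,2)] assms(3) by (simp add: good_def)

lemma card_le_Un:
  assumes "A \<subseteq> B \<union> C" "finite B" "finite C"
  shows "real (card A) \<le> real (card B) + real (card C)"
  using card_mono[OF _ assms(1)] card_Un_le[of B C] assms(2,3) by force

text \<open>
  Up to a tiny fraction, all vertices of a dense cluster agree with each other.  The first center
  whose core meets the good part of the cluster therefore captures most of the cluster, and then
  the majority votes of all good vertices agree.
\<close>

lemma dense_part:
  assumes Q: "Q \<in> P" and dense: "100 * real (card {v \<in> Q. \<not> good v}) \<le> real (card Q)"
    and sel: "\<exists>v\<in>Q. good v \<and> sel v"
  obtains z where "\<And>w. w \<in> Q \<Longrightarrow> good w \<Longrightarrow> elig w (Suc z)"
    "\<And>w. w < n \<Longrightarrow> elig w (Suc z) \<Longrightarrow> w \<notin> Q \<Longrightarrow> real (card Q) \<le> 11 * real (card (nbhd w \<inter> Q))"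
proof -
  define m where "m = real (card Q)"
  define G where "G = {v \<in> Q. good v}"
  have finQ: "finite Q" using Q by (rule part_finite)
  have less: "v < n" if "v \<in> Q" for v using Q that by (rule part_less)
  have QG: "100 * real (card (Q - G)) \<le> m"
  proof -
    have "Q - G = {v \<in> Q. \<not> good v}" by (auto simp: G_def)
    with dense show ?thesis by (simp add: m_def)
  qed
  have close: "100 * err v \<le> d v" "d v \<le> m + err v" "m \<le> d v + err v"
    "real (card (nbhd v - Q)) \<le> err v" "real (card (Q - nbhd v)) \<le> err v"
    if "v \<in> G" for v
    using that err_part[OF Q, of v] by (simp_all add: G_def good_def m_def)
  \<comment> \<open>A neighbor of \<open>u\<close> can fail to be one of \<open>v\<close> only by
    lying outside \<open>Q\<close> or by being a vertex of \<open>Q\<close> not adjacent to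
    \<open>v\<close>; there are at most \<open>err u + err v\<close> such vertices.\<close>
  have complete: "u \<in> core v" if u: "u \<in> G" and v: "v \<in> G" and uv: "u \<in> nbhd v" for u v
  proof -
    have ln: "u < n" "v < n" using u v less by (auto simp: G_def)
    have "d u \<le> real (card (nbhd u \<inter> nbhd v)) + real (card ((nbhd u - Q) \<union> (Q - nbhd v)))"
      unfolding d_def using finQ finite_nbhd ln by (intro card_le_Un) auto
    moreover have "real (card ((nbhd u - Q) \<union> (Q - nbhd v))) \<le> err u + err v"
      using card_Un_le[of "nbhd u - Q" "Q - nbhd v"] close(4)[OF u] close(5)[OF v] by linarith
    ultimately have "d u \<le> real (card (nbhd u \<inter> nbhd v)) + err u + err v" by simp
    with close(1-3)[OF u] close(1-3)[OF v]
    have "95 * d u \<le> 100 * real (card (nbhd u \<inter> nbhd v))" "10 * d v \<le> 11 * d u" by linarith+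
    then show ?thesis
      unfolding d_def by (intro core_complete[OF ln(2) uv]) linarith+
  qed
  obtain v where v: "v \<in> G" "sel v" using sel by (auto simp: G_def)
  have vn: "v < n" using v less by (auto simp: G_def)
  \<comment> \<open>Only vertices outside \<open>Q\<close> and bad vertices can be missing in the
    core of the selected good vertex \<open>v\<close>. Hence \<open>v\<close> is accepted, and at
    least one center has a core that meets \<open>G\<close>.\<close>
  have "d v \<le> real (card (core v)) + real (card ((nbhd v - Q) \<union> (Q - G)))"
    unfolding d_def using finQ finite_nbhd[OF vn] finite_core[OF vn] complete[OF _ v(1)]
    by (intro card_le_Un) auto
  moreover have "real (card ((nbhd v - Q) \<union> (Q - G))) \<le> err v + real (card (Q - G))"
    using card_Un_le[of "nbhd v - Q" "Q - G"] close(4)[OF v(1)] by linarith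
  ultimately have "9 * d v \<le> 10 * real (card (core v))"
    using close[OF v(1)] QG by linarith
  then have "v \<in> Z" unfolding d_def by (intro Z_complete[OF vn v(2)]) linarith
  moreover have "v \<in> core v \<inter> G" using complete[OF v(1) v(1) nbhd_self[OF vn]] v by simp
  ultimately have ex: "\<exists>z. z \<in> Z \<and> core z \<inter> G \<noteq> {}" by blast
  define z where "z = (LEAST z. z \<in> Z \<and> core z \<inter> G \<noteq> {})"
  from LeastI_ex[OF ex] have z: "z \<in> Z" "core z \<inter> G \<noteq> {}" by (simp_all add: z_def)
  have zn: "z < n" using z Z_less by blast
  have min: "z \<le> z'" if "z' \<in> Z" "core z' \<inter> G \<noteq> {}" for z'
    unfolding z_def using that by (intro Least_le) simp
  obtain u where u: "u \<in> core z" "u \<in> G" using z by auto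
  have un: "u < n" using u less by (auto simp: G_def)
  \<comment> \<open>By minimality of \<open>z\<close>, the cores of all earlier centers avoid
    \<open>G\<close>, so nothing in \<open>core z \<inter> G\<close> was labelled before.\<close>
  have lab: "L x = Suc z" if "x \<in> core z \<inter> G" for x
  proof -
    have "(LEAST z'. z' \<in> Z \<and> x \<in> core z') = z"
      using that z by (intro Least_equality) (auto intro: min)
    moreover have "x < n" using that less by (auto simp: G_def)
    ultimately show ?thesis using label[of x] that z by auto
  qed
  \<comment> \<open>The center \<open>z\<close> need not be good nor lie in \<open>Q\<close>. What
    ties it to \<open>Q\<close> is the common vertex \<open>u\<close>: 85 percent of the
    neighborhood of \<open>u\<close> lies in that of \<open>z\<close>, and at most 1 percent of it
    lies outside \<open>Q\<close>.\<close>
  define b where "b = real (card (nbhd z \<inter> Q))"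
  have "real (card (nbhd u \<inter> nbhd z)) \<le> b + real (card (nbhd u - Q))"
    unfolding b_def using finite_nbhd un zn by (intro card_le_Un) auto
  moreover have "85 * d u \<le> 100 * real (card (nbhd u \<inter> nbhd z))" "10 * d z \<le> 11 * d u"
    using core_sound[OF zn u(1)] unfolding d_def by linarith+
  ultimately have b: "84 * d u \<le> 100 * b" "10 * d z \<le> 11 * d u"
    using close[OF u(2)] by linarith+
  have D: "d z = b + real (card (nbhd z - Q))"
    unfolding d_def b_def using card_Int_Diff[OF finite_nbhd[OF zn], of Q] by simp
  \<comment> \<open>Since 9/10 of the neighborhood of \<open>z\<close> is core,
    \<open>core z \<inter> G\<close> has at least \<open>b - d z / 10\<close> elements up to the bad
    vertices of \<open>Q\<close>. In units of \<open>d u\<close> this is about 0.84 - 0.11 -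
    0.01.\<close>
  have "real (card (core z)) \<le> real (card (core z \<inter> G)) + real (card ((nbhd z - Q) \<union> (Q - G)))"
    using finQ finite_nbhd[OF zn] finite_core[OF zn] core_sub[OF zn] by (intro card_le_Un) auto
  moreover have "real (card ((nbhd z - Q) \<union> (Q - G))) \<le> real (card (nbhd z - Q)) + real (card (Q - G))"
    using card_Un_le[of "nbhd z - Q" "Q - G"] by linarith
  moreover have "9 * d z \<le> 10 * real (card (core z))"
    using Z_large[OF z(1)] unfolding d_def by linarith
  ultimately have c: "70 * d u \<le> 100 * real (card (core z \<inter> G))"
    using D b QG close(1-3)[OF u(2)] by linarith
  show ?thesis
  proof (rule that[of z])
    fix w assume w: "w \<in> Q" "good w"
    then have wG: "w \<in> G" by (simp add: G_def)
    have wn: "w < n" using w less by blast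
    have "real (card (core z \<inter> G)) \<le> real (card (nbhd w \<inter> L -` {Suc z})) + real (card (Q - nbhd w))"
      using finite_nbhd[OF wn] finQ lab by (intro card_le_Un) (auto simp: G_def)
    then have "60 * d w \<le> 100 * real (card (nbhd w \<inter> L -` {Suc z}))" "4 * d z \<le> 5 * d w"
      using c b close(1-3)[OF u(2)] close[OF wG] by linarith+
    then show "elig w (Suc z)"
      unfolding d_def by (intro elig_complete[OF wn]) (simp | linarith)+
  next
    fix w assume w: "w < n" "elig w (Suc z)" "w \<notin> Q"
    obtain z' where "Suc z = Suc z'" and w2: "45 * d w \<le> 100 * real (card (nbhd w \<inter> L -` {Suc z'}))"
      "4 * d z' \<le> 5 * d w" using elig_center[OF w(1,2)] by blast
    then have z': "z' = z" by simp
    \<comment> \<open>The votes for \<open>z\<close> come from \<open>nbhd z\<close>. An outside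
      voter has at least \<open>36 / 100 * d z\<close> such neighbors, and at most
      \<open>d z - b\<close> of them lie outside \<open>Q\<close>. At least
      \<open>b - 64 / 100 * d z\<close> remain in \<open>Q\<close>, that is 0.84 - 0.64 * 1.1 =
      0.136 in units of \<open>d u\<close>, which exceeds an eleventh of \<open>Q\<close>.\<close>
    have "nbhd w \<inter> L -` {Suc z} \<subseteq> (nbhd w \<inter> Q) \<union> (nbhd z - Q)"
    proof
      fix x assume x: "x \<in> nbhd w \<inter> L -` {Suc z}"
      then have "x < n" "L x = Suc z" using nbhd_sub[OF w(1)] by auto
      then have "x \<in> nbhd z" using labelled core_sub[OF zn] by blast
      with x show "x \<in> (nbhd w \<inter> Q) \<union> (nbhd z - Q)" by blast
    qed
    then have "real (card (nbhd w \<inter> L -` {Suc z})) \<le>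
        real (card (nbhd w \<inter> Q)) + real (card (nbhd z - Q))"
      using finite_nbhd w(1) zn by (intro card_le_Un) auto
    then have "m \<le> 11 * real (card (nbhd w \<inter> Q))"
      using w2[unfolded z'] D b close(1-3)[OF u(2)] d_nonneg[of u] by linarith
    then show "real (card Q) \<le> 11 * real (card (nbhd w \<inter> Q))" by (simp add: m_def)
  qed
qed

text \<open>Bad vertices pay for their own cost. If they exceed one percent of \<open>Q\<close>, the
  good vertices cost at most \<open>7 * m\<close> each, in total less than
  \<open>700 * m * card B\<close>, and each bad vertex has error at least \<open>m / 101\<close>;
  this gives 70700. Otherwise all good vertices share one output cluster \<open>E\<close>. It
  differs from \<open>Q\<close> by bad vertices, which again pay \<open>m\<close> each, and by
  vertices outside \<open>Q\<close>, which send positive edges to at least an eleventh of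
  \<open>Q\<close>.\<close>

lemma sum_cost_part:
  assumes Q: "Q \<in> P"
    and sel: "100 * real (card {v \<in> Q. \<not> good v}) \<le> real (card Q) \<Longrightarrow> \<exists>v\<in>Q. good v \<and> sel v"
  shows "(\<Sum>w\<in>Q. cost w) \<le>
    72000 * (\<Sum>w\<in>Q. err w) + 11 * (\<Sum>w\<in>{..<n} - Q. real (card (nbhd w \<inter> Q)))"
proof -
  define m where "m = real (card Q)"
  define B where "B = {v \<in> Q. \<not> good v}"
  define G where "G = {v \<in> Q. good v}"
  have finQ: "finite Q" using Q by (rule part_finite)
  have fin: "finite B" "finite G" using finQ by (simp_all add: B_def G_def)
  have less: "v < n" if "v \<in> Q" for v using Q that by (rule part_less)
  have split: "(\<Sum>w\<in>Q. f w) = (\<Sum>w\<in>G. f w) + (\<Sum>w\<in>B. f w)" for f :: "nat \<Rightarrow> real"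
  proof -
    have "Q = G \<union> B" "G \<inter> B = {}" by (auto simp: G_def B_def)
    then show ?thesis using fin by (simp add: sum.union_disjoint)
  qed
  have B1: "(\<Sum>w\<in>B. cost w) \<le> 600 * (\<Sum>w\<in>B. err w)"
    unfolding sum_distrib_left
  proof (rule sum_mono)
    fix w assume "w \<in> B"
    then show "cost w \<le> 600 * err w"
      using cost_le[of w] less by (force simp: B_def good_def)
  qed
  have B2: "m * real (card B) \<le> 101 * (\<Sum>w\<in>B. err w)"
  proof -
    have "(\<Sum>w\<in>B. m) \<le> (\<Sum>w\<in>B. 101 * err w)"
      using bad_err[OF Q] by (intro sum_mono) (simp add: B_def m_def)
    then show ?thesis by (simp flip: sum_distrib_left add: mult.commute[of m])
  qed
  have R: "0 \<le> (\<Sum>w\<in>{..<n} - Q. real (card (nbhd w \<inter> Q)))" by (intro sum_nonneg) simp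
  have eB: "0 \<le> (\<Sum>w\<in>B. err w)" "0 \<le> (\<Sum>w\<in>G. err w)" by (intro sum_nonneg err_nonneg)+
  have G: "(\<Sum>w\<in>G. cost w) \<le> (\<Sum>w\<in>G. err w) + 71000 * (\<Sum>w\<in>B. err w) +
      11 * (\<Sum>w\<in>{..<n} - Q. real (card (nbhd w \<inter> Q)))"
  proof (cases "100 * real (card B) \<le> m")
    case False
    have "cost w \<le> 7 * m" if "w \<in> G" for w
      using cost_le[of w] err_part(3)[OF Q, of w] that less[of w] by (simp add: G_def good_def m_def)
    then have "(\<Sum>w\<in>G. cost w) \<le> (\<Sum>w\<in>G. 7 * m)" by (rule sum_mono)
    also have "\<dots> \<le> m * (7 * m)"
    proof -
      have "card G \<le> card Q" using finQ by (intro card_mono) (auto simp: G_def)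
      then show ?thesis by (auto simp: m_def intro!: mult_right_mono)
    qed
    also have "\<dots> \<le> m * (700 * real (card B))"
      using False by (intro mult_left_mono) (simp_all add: m_def)
    also have "\<dots> = 700 * (m * real (card B))" by simp
    also have "\<dots> \<le> 71000 * (\<Sum>w\<in>B. err w)" using B2 eB by linarith
    finally show ?thesis using R eB by linarith
  next
    case True
    then have dense: "100 * real (card {v \<in> Q. \<not> good v}) \<le> real (card Q)"
      by (simp add: B_def m_def)
    obtain z where z: "\<And>w. w \<in> Q \<Longrightarrow> good w \<Longrightarrow> elig w (Suc z)"
      "\<And>w. w < n \<Longrightarrow> elig w (Suc z) \<Longrightarrow> w \<notin> Q \<Longrightarrow> real (card Q) \<le> 11 * real (card (nbhd w \<inter> Q))"
      using dense_part[OF Q dense sel[OF dense]] by blast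
    define E where "E = {v. v < n \<and> elig v (Suc z)}"
    have finE: "finite E" by (simp add: E_def)
    have "cost w \<le> err w + (real (card B) + real (card (E - Q)))" if w: "w \<in> G" for w
    proof -
      have wn: "w < n" "elig w (Suc z)" using w less z(1) by (auto simp: G_def)
      have part: "part_of P w = Q" using w Q part_of_eq[OF P] by (auto simp: G_def)
      have "real (card (sym_diff (nbhd w) E)) \<le>
          real (card (sym_diff (nbhd w) Q)) + real (card (B \<union> (E - Q)))"
        using finite_nbhd[OF wn(1)] finQ finE fin z(1) less
        by (intro card_le_Un) (auto simp: B_def E_def)
      moreover have "real (card (B \<union> (E - Q))) \<le> real (card B) + real (card (E - Q))"
        using card_Un_le[of B "E - Q"] by linarith
      moreover have "clust w = E" using clust_elig[OF wn] by (simp add: E_def)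
      ultimately show ?thesis by (simp add: cost_def err_def part)
    qed
    then have "(\<Sum>w\<in>G. cost w) \<le> (\<Sum>w\<in>G. err w + (real (card B) + real (card (E - Q))))"
      by (rule sum_mono)
    also have "\<dots> = (\<Sum>w\<in>G. err w) + real (card G) * (real (card B) + real (card (E - Q)))"
      by (simp add: sum.distrib)
    also have "\<dots> \<le> (\<Sum>w\<in>G. err w) + m * (real (card B) + real (card (E - Q)))"
    proof -
      have "card G \<le> card Q" using finQ by (intro card_mono) (auto simp: G_def)
      then show ?thesis by (auto simp: m_def intro!: mult_right_mono)
    qed
    also have "m * (real (card B) + real (card (E - Q))) = m * real (card B) + (\<Sum>w\<in>E - Q. m)"
      by (simp add: distrib_left)
    also have "(\<Sum>w\<in>E - Q. m) \<le> (\<Sum>w\<in>E - Q. 11 * real (card (nbhd w \<inter> Q)))"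
      using z(2) by (intro sum_mono) (auto simp: E_def m_def)
    also have "\<dots> \<le> (\<Sum>w\<in>{..<n} - Q. 11 * real (card (nbhd w \<inter> Q)))"
      by (intro sum_mono2) (auto simp: E_def)
    finally have "(\<Sum>w\<in>G. cost w) \<le> (\<Sum>w\<in>G. err w) + (m * real (card B) +
        11 * (\<Sum>w\<in>{..<n} - Q. real (card (nbhd w \<inter> Q))))"
      by (simp add: sum_distrib_left)
    then show ?thesis using B2 eB by linarith
  qed
  show ?thesis
    unfolding split distrib_left using G B1 eB by linarith
qed

text \<open>The edges charged by outside vertices are positive edges cut by \<open>P\<close>. Summed
  over all parts, a vertex \<open>w\<close> contributes the part of its neighborhood outside its own
  cluster, which is at most \<open>err w\<close>; hence 72000 + 11.\<close>

lemma sum_cost: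
  assumes "\<And>Q. Q \<in> P \<Longrightarrow> 100 * real (card {v \<in> Q. \<not> good v}) \<le> real (card Q) \<Longrightarrow>
    \<exists>v\<in>Q. good v \<and> sel v"
  shows "(\<Sum>w<n. cost w) \<le> 72011 * (\<Sum>w<n. err w)"
proof -
  have finP: "finite P" using P finite_elements[of "{..<n}" P] by simp
  have sumP: "(\<Sum>w<n. f w) = (\<Sum>Q\<in>P. \<Sum>w\<in>Q. f w)" for f :: "nat \<Rightarrow> real"
  proof -
    have "sum f (\<Union>P) = (\<Sum>Q\<in>P. sum f Q)"
      using part_finite partition_onD2[OF P]
      by (subst sum.Union_disjoint) (auto simp: disjoint_def)
    then show ?thesis using partition_onD1[OF P] by simp
  qed
  have "(\<Sum>w<n. cost w) \<le>
    (\<Sum>Q\<in>P. 72000 * (\<Sum>w\<in>Q. err w) + 11 * (\<Sum>w\<in>{..<n} - Q. real (card (nbhd w \<inter> Q))))"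
    unfolding sumP
  proof (rule sum_mono)
    fix Q assume Q: "Q \<in> P"
    show "(\<Sum>w\<in>Q. cost w) \<le>
      72000 * (\<Sum>w\<in>Q. err w) + 11 * (\<Sum>w\<in>{..<n} - Q. real (card (nbhd w \<inter> Q)))"
      by (rule sum_cost_part[OF Q assms[OF Q]])
  qed
  also have "\<dots> = 72000 * (\<Sum>w<n. err w) + 11 * (\<Sum>Q\<in>P. \<Sum>w\<in>{..<n} - Q. real (card (nbhd w \<inter> Q)))"
    by (simp add: sum.distrib sum_distrib_left sumP)
  also have "(\<Sum>Q\<in>P. \<Sum>w\<in>{..<n} - Q. real (card (nbhd w \<inter> Q))) =
      (\<Sum>Q\<in>P. \<Sum>w<n. if w \<in> Q then 0 else real (card (nbhd w \<inter> Q)))"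
  proof (rule sum.cong[OF refl])
    fix Q
    have "(\<Sum>w<n. if w \<in> Q then 0 else real (card (nbhd w \<inter> Q))) =
        (\<Sum>w\<in>{..<n} \<inter> - Q. real (card (nbhd w \<inter> Q)))"
      by (simp add: sum.If_cases Int_def)
    then show "(\<Sum>w\<in>{..<n} - Q. real (card (nbhd w \<inter> Q))) =
        (\<Sum>w<n. if w \<in> Q then 0 else real (card (nbhd w \<inter> Q)))"
      by (simp add: Diff_eq)
  qed
  also have "\<dots> = (\<Sum>w<n. \<Sum>Q\<in>P. if w \<in> Q then 0 else real (card (nbhd w \<inter> Q)))"
    by (rule sum.swap)
  also have "\<dots> \<le> (\<Sum>w<n. err w)"
  proof (rule sum_mono)
    fix w assume "w \<in> {..<n}"
    then have w: "w < n" by simp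
    note p = part_of_in[OF P, of w]
    have "(\<Sum>Q\<in>P. if w \<in> Q then 0 else real (card (nbhd w \<inter> Q))) =
        (\<Sum>Q\<in>P - {part_of P w}. real (card (nbhd w \<inter> Q)))"
    proof (rule sum.mono_neutral_cong_right[OF finP])
      show "\<forall>Q\<in>P - (P - {part_of P w}). (if w \<in> Q then 0 else real (card (nbhd w \<inter> Q))) = 0"
        using p w by auto
    next
      fix Q assume "Q \<in> P - {part_of P w}"
      then show "(if w \<in> Q then 0 else real (card (nbhd w \<inter> Q))) = real (card (nbhd w \<inter> Q))"
        using part_of_eq[OF P] by auto
    qed auto
    also have "\<dots> = real (card (\<Union>Q\<in>P - {part_of P w}. nbhd w \<inter> Q))"
      using finP finite_nbhd[OF w] partition_onD2[OF P]
      by (subst card_UN_disjoint) (auto simp: disjoint_def)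
    also have "\<dots> \<le> real (card (nbhd w - part_of P w))"
    proof (intro of_nat_mono card_mono subsetI)
      fix x assume "x \<in> (\<Union>Q\<in>P - {part_of P w}. nbhd w \<inter> Q)"
      then obtain Q where Q: "Q \<in> P" "Q \<noteq> part_of P w" "x \<in> Q" "x \<in> nbhd w" by blast
      have "x \<notin> part_of P w"
        using part_of_eq[OF P Q(1,3)] part_of_eq[OF P p(1), of x] w Q(2) by auto
      with Q(4) show "x \<in> nbhd w - part_of P w" by blast
    qed (use finite_nbhd[OF w] in simp)
    also have "\<dots> \<le> err w" using err_part(1)[OF p] w by simp
    finally show "(\<Sum>Q\<in>P. if w \<in> Q then 0 else real (card (nbhd w \<inter> Q))) \<le> err w" .
  qed
  finally show ?thesis by simp
qed

end

section \<open>Tail bounds\<close>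

text \<open>Two-sided Hoeffding bound for the indicators of hitting \<open>A\<close>. Only the
  coordinates in \<open>T\<close> have to be identically distributed, since other vertices sample
  from other neighborhoods.\<close>

lemma prob_Pi_pmf_count:
  fixes p :: "'a \<Rightarrow> 'b pmf"
  assumes I: "finite I" and T: "T \<subseteq> I" "card T = k" "0 < k"
    and p: "\<And>i. i \<in> T \<Longrightarrow> p i = pmf_of_set N" and N: "finite N" "N \<noteq> {}" and e: "0 \<le> e"
  shows "measure_pmf.prob (Pi_pmf I dflt p)
      {X. e * k \<le> \<bar>real (card {i \<in> T. X i \<in> A}) - k * (real (card (N \<inter> A)) / real (card N))\<bar>}
    \<le> 2 * exp (- (2 * e\<^sup>2 * k))"
proof -
  let ?M = "measure_pmf (Pi_pmf I dflt p)"
  define Y where "Y i X = (if X i \<in> A then 1 else 0 :: real)" for i :: 'a and X :: "'a \<Rightarrow> 'b"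
  have finT: "finite T" using I T(1) finite_subset by blast
  have "prob_space.indep_vars ?M (\<lambda>_. count_space UNIV) (\<lambda>x f. f x) T"
    using prob_space.indep_vars_subset[OF measure_pmf.prob_space_axioms indep_vars_Pi_pmf[OF I] T(1)] .
  from prob_space.indep_vars_compose2[OF measure_pmf.prob_space_axioms this, of "\<lambda>_ x. if x \<in> A then 1 else 0 :: real" "\<lambda>_. borel"]
  have indep: "prob_space.indep_vars ?M (\<lambda>_. borel) Y T" by (simp add: Y_def[abs_def])
  interpret Hoeffding_ineq ?M T Y "\<lambda>_. 0" "\<lambda>_. 1" "\<Sum>i\<in>T. measure_pmf.expectation (Pi_pmf I dflt p) (Y i)"
    by unfold_locales (use finT indep in \<open>auto simp: Y_def\<close>)
  have E: "measure_pmf.expectation (Pi_pmf I dflt p) (Y i) = real (card (N \<inter> A)) / real (card N)"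
    if i: "i \<in> T" for i
  proof -
    have "i \<in> I" using i T by blast
    have "measure_pmf.expectation (Pi_pmf I dflt p) (Y i) =
        measure_pmf.expectation (map_pmf (\<lambda>X. X i) (Pi_pmf I dflt p)) (indicator A)"
    proof -
      have "Y i = indicator ((\<lambda>X. X i) -` A)" by (auto simp: Y_def indicator_def)
      then show ?thesis by simp
    qed
    also have "\<dots> = measure_pmf.prob (pmf_of_set N) A"
      using Pi_pmf_component[OF I, of i dflt p] \<open>i \<in> I\<close> p[OF i] by simp
    also have "\<dots> = real (card (N \<inter> A)) / real (card N)"
      using N by (rule measure_pmf_of_set[rotated])
    finally show ?thesis .
  qed
  have "measure ?M {X \<in> space ?M. e * k \<le> \<bar>(\<Sum>i\<in>T. Y i X) -
      (\<Sum>i\<in>T. measure_pmf.expectation (Pi_pmf I dflt p) (Y i))\<bar>}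
    \<le> 2 * exp (- 2 * (e * k)\<^sup>2 / (\<Sum>i\<in>T. (1 - 0)\<^sup>2))"
    by (rule Hoeffding_ineq_abs_ge) (use e T in simp_all)
  also have "- 2 * (e * k)\<^sup>2 / (\<Sum>i\<in>T. (1 - 0)\<^sup>2) = - (2 * e\<^sup>2 * k)"
    using T by (simp add: power2_eq_square)
  also have "(\<Sum>i\<in>T. measure_pmf.expectation (Pi_pmf I dflt p) (Y i)) =
      k * (real (card (N \<inter> A)) / real (card N))"
    using E T(2) by simp
  also have "(\<lambda>X. \<Sum>i\<in>T. Y i X) = (\<lambda>X. real (card {i \<in> T. X i \<in> A}))"
    using finT by (simp add: Y_def sum.If_cases Int_def)
  finally show ?thesis by simp
qed

text \<open>By independence the probability is a product of factors
  \<open>1 - pmf (p i) (a i)\<close>, each at most \<open>exp (- q i)\<close>.\<close>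

lemma prob_Pi_pmf_avoid:
  assumes I: "finite I" and T: "T \<subseteq> I"
    and p: "\<And>i. i \<in> T \<Longrightarrow> q i \<le> pmf (p i) (a i)"
  shows "measure_pmf.prob (Pi_pmf I dflt p) {X. \<forall>i\<in>T. X i \<noteq> a i} \<le> exp (- (\<Sum>i\<in>T. q i))"
proof -
  have finT: "finite T" using I T finite_subset by blast
  define B where "B i = (if i \<in> T then - {a i} else UNIV)" for i
  have "{X. \<forall>i\<in>T. X i \<noteq> a i} = Pi I B" using T by (auto simp: B_def Pi_def)
  then have "measure_pmf.prob (Pi_pmf I dflt p) {X. \<forall>i\<in>T. X i \<noteq> a i} =
      (\<Prod>i\<in>I. measure_pmf.prob (p i) (B i))"
    using measure_Pi_pmf_Pi[OF I] by simp
  also have "\<dots> = (\<Prod>i\<in>T. measure_pmf.prob (p i) (B i))"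
    using I T by (intro prod.mono_neutral_right) (auto simp: B_def)
  also have "\<dots> \<le> (\<Prod>i\<in>T. exp (- q i))"
  proof (intro prod_mono conjI measure_nonneg)
    fix i assume i: "i \<in> T"
    have "measure_pmf.prob (p i) (- {a i}) = 1 - pmf (p i) (a i)"
      using measure_pmf.prob_compl[of "{a i}" "p i"] by (simp add: measure_pmf_single Compl_eq_Diff_UNIV)
    also have "\<dots> \<le> 1 + (- q i)" using p[OF i] by simp
    also have "\<dots> \<le> exp (- q i)" by (rule exp_ge_add_one_self)
    finally show "measure_pmf.prob (p i) (B i) \<le> exp (- q i)" using i by (simp add: B_def)
  qed
  also have "\<dots> = exp (- (\<Sum>i\<in>T. q i))"
    using finT by (simp add: exp_sum sum_negf[symmetric])
  finally show ?thesis .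
qed

text \<open>Chernoff's method, with \<open>exp c \<le> 1 + 2 * c\<close> for weights \<open>0 \<le> c \<le> 1\<close>.\<close>

lemma prob_Pi_pmf_weighted:
  fixes c :: "'a \<Rightarrow> real"
  assumes I: "finite I" and T: "T \<subseteq> I" and c: "\<And>i. i \<in> T \<Longrightarrow> 0 \<le> c i \<and> c i \<le> 1"
    and fin: "\<And>i. i \<in> I \<Longrightarrow> finite (set_pmf (p i))"
    and mean: "(\<Sum>i\<in>T. c i * pmf (p i) (a i)) \<le> m"
  shows "measure_pmf.prob (Pi_pmf I dflt p) {X. 3 * m \<le> (\<Sum>i\<in>T. if X i = a i then c i else 0)} \<le> exp (- m)"
proof -
  let ?M = "measure_pmf (Pi_pmf I dflt p)"
  have finT: "finite T" using I T finite_subset by blast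
  define f where "f i y = (if i \<in> T \<and> y = a i then exp (c i) else 1)" for i y
  have prod: "exp (\<Sum>i\<in>T. if X i = a i then c i else 0) = (\<Prod>i\<in>I. f i (X i))" for X
  proof -
    have "exp (\<Sum>i\<in>T. if X i = a i then c i else 0) = (\<Prod>i\<in>T. f i (X i))"
      unfolding exp_sum[OF finT] by (intro prod.cong) (auto simp: f_def)
    also have "\<dots> = (\<Prod>i\<in>I. f i (X i))"
      using I T by (intro prod.mono_neutral_left) (auto simp: f_def)
    finally show ?thesis .
  qed
  have int: "integrable (measure_pmf (p i)) (f i)" if "i \<in> I" for i
    using fin[OF that] by (rule integrable_measure_pmf_finite)
  have pos: "0 \<le> f i y" for i y by (simp add: f_def)
  have Ef: "measure_pmf.expectation (p i) (f i) \<le> (if i \<in> T then exp (2 * (c i * pmf (p i) (a i))) else 1)"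
    if i: "i \<in> I" for i
  proof (cases "i \<in> T")
    case False
    then have "f i = (\<lambda>_. 1)" by (auto simp: f_def)
    with False show ?thesis by simp
  next
    case True
    have "exp (c i) \<le> 1 + c i + (c i)\<^sup>2" using c[OF True] by (intro exp_bound) auto
    also have "\<dots> \<le> 1 + 2 * c i"
      using c[OF True] mult_left_mono[of "c i" 1 "c i"] by (simp add: power2_eq_square)
    finally have e: "exp (c i) - 1 \<le> 2 * c i" by simp
    have "f i = (\<lambda>y. 1 + (exp (c i) - 1) * indicator {a i} y)"
      using True by (auto simp: f_def indicator_def)
    then have "measure_pmf.expectation (p i) (f i) = 1 + (exp (c i) - 1) * pmf (p i) (a i)"
      by (simp add: integrable_measure_pmf_finite[OF fin[OF i]] measure_pmf_single)
    also have "\<dots> \<le> 1 + 2 * c i * pmf (p i) (a i)"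
      using e by (intro add_left_mono mult_right_mono) auto
    also have "\<dots> \<le> exp (2 * (c i * pmf (p i) (a i)))"
      using exp_ge_add_one_self[of "2 * (c i * pmf (p i) (a i))"] by (simp add: mult.assoc)
    finally show ?thesis using True by simp
  qed
  have "measure_pmf.expectation (Pi_pmf I dflt p) (\<lambda>X. \<Prod>i\<in>I. f i (X i)) =
      (\<Prod>i\<in>I. measure_pmf.expectation (p i) (f i))"
    by (rule expectation_prod_Pi_pmf[OF I int pos])
  also have "\<dots> \<le> (\<Prod>i\<in>I. if i \<in> T then exp (2 * (c i * pmf (p i) (a i))) else 1)"
    using Ef pos by (intro prod_mono conjI) (auto intro!: integral_nonneg_AE)
  also have "\<dots> = (\<Prod>i\<in>T. exp (2 * (c i * pmf (p i) (a i))))"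
    using I T by (simp add: prod.If_cases Int_absorb1)
  also have "\<dots> = exp (2 * (\<Sum>i\<in>T. c i * pmf (p i) (a i)))"
    using finT by (simp add: exp_sum sum_distrib_left)
  also have "\<dots> \<le> exp (2 * m)" using mean by simp
  finally have E: "measure_pmf.expectation (Pi_pmf I dflt p) (\<lambda>X. \<Prod>i\<in>I. f i (X i)) \<le> exp (2 * m)" .
  have "measure ?M {X \<in> space ?M. exp (3 * m) \<le> (\<Prod>i\<in>I. f i (X i))} \<le>
      measure_pmf.expectation (Pi_pmf I dflt p) (\<lambda>X. \<Prod>i\<in>I. f i (X i)) / exp (3 * m)"
    by (rule integral_Markov_inequality_measure[where A = UNIV])
      (use pos in \<open>auto intro!: integrable_prod_Pi_pmf I int prod_nonneg\<close>)
  also have "\<dots> \<le> exp (2 * m) / exp (3 * m)" using E by (rule divide_right_mono) simp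
  also have "\<dots> = exp (- m)" by (simp add: exp_diff[symmetric])
  finally show ?thesis by (simp add: prod[symmetric])
qed

text \<open>Conditioning on the first component: a bound that holds for each fixed \<open>f\<close>
  also holds when \<open>f\<close> is random.\<close>

lemma prob_pair_pmf_le:
  assumes "\<And>f. f \<in> set_pmf M \<Longrightarrow> measure_pmf.prob N {g. (f, g) \<in> S} \<le> c" "0 \<le> c"
  shows "measure_pmf.prob (pair_pmf M N) S \<le> c"
proof -
  have "emeasure (pair_pmf M N) S = (\<integral>\<^sup>+ f. emeasure (map_pmf (Pair f) N) S \<partial>M)"
    by (simp add: pair_pmf_def map_pmf_def[symmetric])
  also have "\<dots> \<le> (\<integral>\<^sup>+ f. ennreal c \<partial>M)"
  proof (intro nn_integral_mono_AE AE_pmfI)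
    fix f assume "f \<in> set_pmf M"
    with assms(1) show "emeasure (map_pmf (Pair f) N) S \<le> ennreal c"
      by (simp add: measure_pmf.emeasure_eq_measure vimage_def ennreal_leI)
  qed
  also have "\<dots> = ennreal c" by simp
  finally show ?thesis
    using assms(2) by (simp add: measure_pmf.emeasure_eq_measure)
qed

section \<open>Failure probabilities of tests, votes, selection and budget\<close>

context instance_ram
begin

text \<open>
  The indices of the samples of \<open>u\<close>: the first \<open>K\<close> are used for choosing and testing centers,
  the last \<open>K\<close> for voting.
\<close>

definition tests :: "nat \<Rightarrow> nat set" where
  "tests u = (\<lambda>j. u * (2 * K) + j) ` {..<K}"

definition ballots :: "nat \<Rightarrow> nat set" where
  "ballots u = (\<lambda>j. u * (2 * K) + K + j) ` {..<K}"

lemma card_tests: "card (tests u) = K" and card_ballots: "card (ballots u) = K"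
  by (simp_all add: tests_def ballots_def card_image inj_on_def)

lemma tests_div_mod: "i \<in> tests u \<Longrightarrow> i div (2 * K) = u \<and> i mod (2 * K) < K"
  and ballots_div_mod: "i \<in> ballots u \<Longrightarrow> i div (2 * K) = u \<and> K \<le> i mod (2 * K)"
proof -
  assume "i \<in> tests u"
  then obtain j where "i = j + u * (2 * K)" "j < K" by (auto simp: tests_def)
  then show "i div (2 * K) = u \<and> i mod (2 * K) < K"
    by (simp only: div_mult_self1 mod_mult_self1) simp
next
  assume "i \<in> ballots u"
  then obtain j where "i = (K + j) + u * (2 * K)" "j < K" by (auto simp: ballots_def)
  then show "i div (2 * K) = u \<and> K \<le> i mod (2 * K)"
    by (simp only: div_mult_self1 mod_mult_self1) simp
qed

lemma index_less: "u < n \<Longrightarrow> j < 2 * K \<Longrightarrow> u * (2 * K) + j < n * (2 * K)"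
  by (rule mult_add_less)

lemma tests_sub: "u < n \<Longrightarrow> tests u \<subseteq> {..<n * (2 * K)}"
  and ballots_sub: "u < n \<Longrightarrow> ballots u \<subseteq> {..<n * (2 * K)}"
  using index_less[of u] by (auto simp: tests_def ballots_def add.assoc)

lemma hits_eq: "hits X u A = card {i \<in> tests u. X i \<in> A}"
proof -
  have "bij_betw (\<lambda>j. u * (2 * K) + j) {j. j < K \<and> X (u * (2 * K) + j) \<in> A} {i \<in> tests u. X i \<in> A}"
    by (rule bij_betw_imageI) (auto simp: tests_def inj_on_def)
  then show ?thesis unfolding hits_def by (rule bij_betw_same_card)
qed

lemma votes_eq: "votes X L u l = card {i \<in> ballots u. X i \<in> L -` {l}}"
proof -
  have "bij_betw (\<lambda>j. u * (2 * K) + K + j) {j. j < K \<and> L (X (u * (2 * K) + K + j)) = l}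
      {i \<in> ballots u. X i \<in> L -` {l}}"
    by (rule bij_betw_imageI) (auto simp: ballots_def inj_on_def)
  then show ?thesis unfolding votes_def by (rule bij_betw_same_card)
qed

lemma pmf_nbhd_self: "v < n \<Longrightarrow> pmf (pmf_of_set (nbhd v)) v = 1 / real (deg v)"
  by (subst pmf_of_set) (auto simp: nbhd_def card_nbhd[unfolded nbhd_def])

lemma finite_tests [simp]: "finite (tests u)"
  by (simp add: tests_def)

lemma sum_tests:
  fixes f :: "nat \<Rightarrow> real"
  assumes "V \<subseteq> {..<n}"
  shows "(\<Sum>i\<in>(\<Union>v\<in>V. tests v). f (i div (2 * K))) = (\<Sum>v\<in>V. K * f v)"
proof -
  have "finite V" using assms finite_subset by blast
  moreover have "tests u \<inter> tests v = {}" if "u \<noteq> v" for u v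
    using tests_div_mod that by blast
  ultimately have "(\<Sum>i\<in>(\<Union>v\<in>V. tests v). f (i div (2 * K))) =
      (\<Sum>v\<in>V. \<Sum>i\<in>tests v. f (i div (2 * K)))"
    by (intro sum.UNION_disjoint) auto
  also have "\<dots> = (\<Sum>v\<in>V. \<Sum>i\<in>tests v. f v)"
    by (intro sum.cong refl) (simp add: tests_div_mod)
  finally show ?thesis by (simp add: card_tests)
qed

text \<open>The tolerance 1/20 determines the exponent of the tail bounds, since
  \<open>2 * (1 / 20)\<^sup>2 * K\<close> is \<open>K / 200\<close>.\<close>

definition inaccurate :: "nat \<Rightarrow> nat \<Rightarrow> nat set \<Rightarrow> bool" where
  "inaccurate h u A \<longleftrightarrow>
     1 / 20 * K \<le> \<bar>real h - K * (real (card (nbhd u \<inter> A)) / real (card (nbhd u)))\<bar>"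

lemma prob_inaccurate_test:
  assumes "0 < K" "u < n"
  shows "measure_pmf.prob samples {X. inaccurate (hits X u A) u A} \<le> 2 * exp (- (K / 200))"
proof -
  have "measure_pmf.prob samples {X. 1 / 20 * K \<le> \<bar>real (card {i \<in> tests u. X i \<in> A}) -
      K * (real (card (nbhd u \<inter> A)) / real (card (nbhd u)))\<bar>} \<le> 2 * exp (- (2 * (1 / 20)\<^sup>2 * K))"
    unfolding samples_def
    by (rule prob_Pi_pmf_count)
      (use assms tests_sub tests_div_mod card_tests in \<open>auto simp: nbhd_def\<close>)
  also have "2 * (1 / 20)\<^sup>2 * real K = K / 200" by (simp add: power2_eq_square)
  finally show ?thesis by (simp add: inaccurate_def hits_eq)
qed

definition test_part :: "nat set" where
  "test_part = {i. i < n * (2 * K) \<and> i mod (2 * K) < K}"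

lemma hits_cong:
  assumes "u < n" "\<And>i. i \<in> test_part \<Longrightarrow> X i = Y i"
  shows "hits X u A = hits Y u A"
proof -
  have "tests u \<subseteq> test_part"
    using tests_sub[OF assms(1)] tests_div_mod by (auto simp: test_part_def)
  then show ?thesis unfolding hits_eq using assms(2) by (intro arg_cong[where f = card]) auto
qed

text \<open>Labels are functions of the test samples alone; this is what leaves the ballots
  independent of them.\<close>

lemma label_state_cong:
  assumes "\<And>i. i \<in> test_part \<Longrightarrow> X i = Y i"
  shows "k \<le> n \<Longrightarrow> label_state X B k = label_state Y B k"
proof (induction k)
  case (Suc v)
  then have v: "v < n" by simp
  note hits = hits_cong[OF _ assms]
  have "core X v = core Y v"
    unfolding core_def using hits nbhd_subset[OF v] by auto
  then show ?case using Suc hits[OF v] by (simp add: relabel_def)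
qed simp

text \<open>The set of vertices labelled \<open>l\<close> is itself random, so the Hoeffding bound
  does not apply directly. Splitting the product distribution at \<open>test_part\<close> and fixing
  the test samples makes the set constant while the ballots are still fresh.\<close>

lemma prob_inaccurate_vote:
  assumes "0 < K" "u < n"
  shows "measure_pmf.prob samples {X. inaccurate (votes X (fst (label_state X B n)) u l) u
      (fst (label_state X B n) -` {l})} \<le> 2 * exp (- (K / 200))"
proof -
  define S where "S = {X. inaccurate (votes X (fst (label_state X B n)) u l) u (fst (label_state X B n) -` {l})}"
  define R where "R = {..<n * (2 * K)} - test_part"
  let ?p = "\<lambda>i. pmf_of_set (nbhd (i div (2 * K)))"
  let ?merge = "\<lambda>(f, g) i. if i \<in> test_part then f i else g i :: nat"
  have I: "{..<n * (2 * K)} = test_part \<union> R" "test_part \<inter> R = {}"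
    by (auto simp: R_def test_part_def)
  have fin: "finite test_part" "finite R" by (simp_all add: R_def test_part_def)
  have "samples = map_pmf ?merge (pair_pmf (Pi_pmf test_part 0 ?p) (Pi_pmf R 0 ?p))"
    unfolding samples_def I(1) by (rule Pi_pmf_union[OF fin I(2)])
  then have "measure_pmf.prob samples S =
      measure_pmf.prob (pair_pmf (Pi_pmf test_part 0 ?p) (Pi_pmf R 0 ?p)) (?merge -` S)"
    by simp
  also have "\<dots> \<le> 2 * exp (- (K / 200))"
  proof (rule prob_pair_pmf_le)
    fix f
    define L where "L = fst (label_state f B n)"
    have B: "ballots u \<subseteq> R"
      using ballots_sub[OF assms(2)] ballots_div_mod by (fastforce simp: R_def test_part_def)
    have "{g. (f, g) \<in> ?merge -` S} \<subseteq> {g. 1 / 20 * K \<le> \<bar>real (card {i \<in> ballots u. g i \<in> L -` {l}}) -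
        K * (real (card (nbhd u \<inter> L -` {l})) / real (card (nbhd u)))\<bar>}"
    proof
      fix g assume "g \<in> {g. (f, g) \<in> ?merge -` S}"
      then have g: "?merge (f, g) \<in> S" by simp
      have "label_state (?merge (f, g)) B n = label_state f B n"
        by (rule label_state_cong) simp_all
      then have L: "fst (label_state (?merge (f, g)) B n) = L" by (simp add: L_def)
      have "{i \<in> ballots u. ?merge (f, g) i \<in> L -` {l}} = {i \<in> ballots u. g i \<in> L -` {l}}"
        using B I(2) by auto
      with g show "g \<in> {g. 1 / 20 * K \<le> \<bar>real (card {i \<in> ballots u. g i \<in> L -` {l}}) -
        K * (real (card (nbhd u \<inter> L -` {l})) / real (card (nbhd u)))\<bar>}"
        unfolding S_def mem_Collect_eq inaccurate_def L votes_eq by simp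
    qed
    then have "measure_pmf.prob (Pi_pmf R 0 ?p) {g. (f, g) \<in> ?merge -` S} \<le>
        measure_pmf.prob (Pi_pmf R 0 ?p) {g. 1 / 20 * K \<le>
          \<bar>real (card {i \<in> ballots u. g i \<in> L -` {l}}) -
            K * (real (card (nbhd u \<inter> L -` {l})) / real (card (nbhd u)))\<bar>}"
      by (intro measure_pmf.finite_measure_mono) simp_all
    also have "\<dots> \<le> 2 * exp (- (2 * (1 / 20)\<^sup>2 * K))"
      by (rule prob_Pi_pmf_count)
        (use assms fin B ballots_div_mod card_ballots in \<open>auto simp: nbhd_def\<close>)
    also have "2 * (1 / 20)\<^sup>2 * real K = K / 200" by (simp add: power2_eq_square)
    finally show "measure_pmf.prob (Pi_pmf R 0 ?p) {g. (f, g) \<in> ?merge -` S} \<le> 2 * exp (- (K / 200))" .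
  qed simp
  finally show ?thesis by (simp add: S_def)
qed

lemma prob_not_selected:
  assumes V: "V \<subseteq> {..<n}"
  shows "measure_pmf.prob samples {X. \<forall>v\<in>V. hits X v {v} = 0} \<le> exp (- (\<Sum>v\<in>V. K / real (deg v)))"
proof -
  have "{X. \<forall>v\<in>V. hits X v {v} = 0} = {X. \<forall>i\<in>(\<Union>v\<in>V. tests v). X i \<noteq> i div (2 * K)}"
    using tests_div_mod by (auto simp: hits_eq)
  also have "measure_pmf.prob samples \<dots> \<le> exp (- (\<Sum>i\<in>(\<Union>v\<in>V. tests v). 1 / real (deg (i div (2 * K)))))"
    unfolding samples_def
  proof (rule prob_Pi_pmf_avoid)
    show "(\<Union>v\<in>V. tests v) \<subseteq> {..<n * (2 * K)}" using V tests_sub by blast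
    fix i assume "i \<in> (\<Union>v\<in>V. tests v)"
    then obtain v where "v \<in> V" "i \<in> tests v" by blast
    with V tests_div_mod[of i v]
    show "1 / real (deg (i div (2 * K))) \<le> pmf (pmf_of_set (nbhd (i div (2 * K)))) (i div (2 * K))"
      by (auto simp: pmf_nbhd_self)
  qed simp
  also have "(\<Sum>i\<in>(\<Union>v\<in>V. tests v). 1 / real (deg (i div (2 * K)))) = (\<Sum>v\<in>V. K / real (deg v))"
    using sum_tests[OF V, of "\<lambda>v. 1 / real (deg v)"] by simp
  finally show ?thesis .
qed

text \<open>Each of the \<open>K\<close> test samples of \<open>v\<close> hits \<open>v\<close> with
  probability \<open>1 / deg v\<close> and then costs \<open>deg v\<close>, so the expected total is
  \<open>n * K\<close>. The weights are divided by \<open>n\<close> to lie between 0 and 1; the mean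
  becomes \<open>K\<close>, and three times the mean is exceeded with probability at most
  \<open>exp (- K)\<close>.\<close>

lemma prob_budget:
  "measure_pmf.prob samples {X. 3 * n * K \<le> (\<Sum>v<n. deg v * hits X v {v})} \<le> exp (- real K)"
proof -
  let ?T = "\<Union>v\<in>{..<n}. tests v"
  let ?c = "\<lambda>i. real (deg (i div (2 * K))) / real n"
  have T: "i div (2 * K) < n" if "i \<in> ?T" for i using that tests_div_mod by auto
  have "measure_pmf.prob samples {X. 3 * real K \<le> (\<Sum>i\<in>?T. if X i = i div (2 * K) then ?c i else 0)} \<le>
      exp (- real K)"
    unfolding samples_def
  proof (rule prob_Pi_pmf_weighted)
    show "?T \<subseteq> {..<n * (2 * K)}" using tests_sub by blast
    fix i assume "i \<in> ?T"
    with T deg_le[of "i div (2 * K)"] show "0 \<le> ?c i \<and> ?c i \<le> 1" using n_pos by (simp add: divide_le_eq)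
  next
    have "(\<Sum>i\<in>?T. ?c i * pmf (pmf_of_set (nbhd (i div (2 * K)))) (i div (2 * K))) =
        (\<Sum>i\<in>?T. 1 / real n)"
      using T by (intro sum.cong refl) (simp add: pmf_nbhd_self deg_def)
    also have "\<dots> = (\<Sum>v<n. K * (1 / real n))" using sum_tests[of "{..<n}" "\<lambda>_. 1 / real n"] by simp
    also have "\<dots> = K" using n_pos by simp
    finally show "(\<Sum>i\<in>?T. ?c i * pmf (pmf_of_set (nbhd (i div (2 * K)))) (i div (2 * K))) \<le> K" by simp
  next
    fix i assume "i \<in> {..<n * (2 * K)}"
    show "finite (set_pmf (pmf_of_set (nbhd (i div (2 * K)))))"
      by (subst set_pmf_of_set) (auto simp: nbhd_def)
  qed simp
  moreover have "{X. 3 * n * K \<le> (\<Sum>v<n. deg v * hits X v {v})} \<subseteq>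
      {X. 3 * real K \<le> (\<Sum>i\<in>?T. if X i = i div (2 * K) then ?c i else 0)}"
  proof
    fix X assume "X \<in> {X. 3 * n * K \<le> (\<Sum>v<n. deg v * hits X v {v})}"
    then have *: "3 * n * K \<le> (\<Sum>v<n. deg v * hits X v {v})" by simp
    have disj: "tests u \<inter> tests v = {}" if "u \<noteq> v" for u v
      using tests_div_mod that by blast
    have "(\<Sum>i\<in>?T. if X i = i div (2 * K) then ?c i else 0) =
        (\<Sum>v<n. \<Sum>i\<in>tests v. if X i = i div (2 * K) then ?c i else 0)"
      using disj by (intro sum.UNION_disjoint) auto
    also have "\<dots> = (\<Sum>v<n. \<Sum>i\<in>tests v. if X i = v then real (deg v) / real n else 0)"
      by (intro sum.cong refl) (simp add: tests_div_mod)
    also have "\<dots> = (\<Sum>v<n. real (deg v * hits X v {v}) / real n)"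
      by (simp add: sum.If_cases hits_eq Int_def mult.commute)
    also have "\<dots> = real (\<Sum>v<n. deg v * hits X v {v}) / real n"
      by (simp add: sum_divide_distrib)
    also have "\<dots> \<ge> real (3 * n * K) / real n"
      using * by (intro divide_right_mono) (simp_all only: of_nat_le_iff of_nat_0_le_iff)
    also have "real (3 * n * K) / real n = 3 * K" using n_pos by simp
    finally show "X \<in> {X. 3 * real K \<le> (\<Sum>i\<in>?T. if X i = i div (2 * K) then ?c i else 0)}" by simp
  qed
  then have "measure_pmf.prob samples {X. 3 * n * K \<le> (\<Sum>v<n. deg v * hits X v {v})} \<le>
    measure_pmf.prob samples {X. 3 * real K \<le> (\<Sum>i\<in>?T. if X i = i div (2 * K) then ?c i else 0)}"
    by (intro measure_pmf.finite_measure_mono) simp_all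
  ultimately show ?thesis by linarith
qed

section \<open>Labels as first accepted centers\<close>

definition centers :: "(nat \<Rightarrow> nat) \<Rightarrow> nat \<Rightarrow> nat set" where
  "centers X k = {z. z < k \<and> 0 < hits X z {z} \<and> 9 * deg z \<le> 10 * card (core X z)}"

definition first_label :: "(nat \<Rightarrow> nat) \<Rightarrow> nat set \<Rightarrow> nat \<Rightarrow> nat" where
  "first_label X S u =
     (if \<exists>z\<in>S. u \<in> core X z then Suc (LEAST z. z \<in> S \<and> u \<in> core X z) else 0)"

text \<open>A candidate has at least one hit, so the degrees of all candidates sum to at most
  \<open>B\<close> and no candidate is refused. As centers are processed in increasing order and
  labels are never overwritten, the label names the least center whose core contains the
  vertex.\<close>

lemma label_state_eq:
  assumes B: "(\<Sum>v<n. deg v * hits X v {v}) \<le> B"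
  shows "k \<le> n \<Longrightarrow> snd (label_state X B k) + (\<Sum>v<k. if 0 < hits X v {v} then deg v else 0) = B \<and>
    fst (label_state X B k) = first_label X (centers X k)"
proof (induction k)
  case 0
  then show ?case by (simp add: centers_def first_label_def fun_eq_iff)
next
  case (Suc v)
  then have v: "v < n" by simp
  define c where "c = (\<lambda>u. if 0 < hits X u {u} then deg u else 0)"
  have IH: "snd (label_state X B v) + sum c {..<v} = B"
    "fst (label_state X B v) = first_label X (centers X v)"
    using Suc by (simp_all add: c_def)
  have "sum c {..<Suc v} \<le> sum c {..<n}" using v by (intro sum_mono2) auto
  also have "\<dots> \<le> (\<Sum>v<n. deg v * hits X v {v})" by (intro sum_mono) (simp add: c_def)
  finally have le: "sum c {..<v} + c v \<le> B" using B by simp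
  have C: "centers X (Suc v) =
      (if 0 < hits X v {v} \<and> 9 * deg v \<le> 10 * card (core X v) then insert v (centers X v) else centers X v)"
    by (auto simp: centers_def less_Suc_eq)
  show ?case
  proof (cases "0 < hits X v {v}")
    case False
    then have "centers X (Suc v) = centers X v" "label_state X B (Suc v) = label_state X B v"
      using C by simp_all
    with IH False show ?thesis unfolding c_def[symmetric] by (simp add: c_def)
  next
    case True
    then have "deg v \<le> snd (label_state X B v)" using le IH(1) by (simp add: c_def)
    with True have c: "label_state X B (Suc v) = (relabel X v (fst (label_state X B v)), snd (label_state X B v) - deg v)"
      by simp
    have 1: "snd (label_state X B (Suc v)) + sum c {..<Suc v} = B"
      using c True IH(1) \<open>deg v \<le> _\<close> by (simp add: c_def)
    have "relabel X v (fst (label_state X B v)) u = first_label X (centers X (Suc v)) u" for u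
    proof (cases "9 * deg v \<le> 10 * card (core X v)")
      case False
      then show ?thesis using C IH(2) by (simp add: relabel_def)
    next
      case acc: True
      have C': "centers X (Suc v) = insert v (centers X v)" using C True acc by simp
      show ?thesis
      proof (cases "\<exists>z\<in>centers X v. u \<in> core X z")
        case old: True
        then have ex: "\<exists>z. z \<in> centers X v \<and> u \<in> core X z" by blast
        have "(LEAST z. z \<in> centers X (Suc v) \<and> u \<in> core X z) = (LEAST z. z \<in> centers X v \<and> u \<in> core X z)"
        proof (rule Least_equality)
          show "(LEAST z. z \<in> centers X v \<and> u \<in> core X z) \<in> centers X (Suc v) \<and>
              u \<in> core X (LEAST z. z \<in> centers X v \<and> u \<in> core X z)"
            using LeastI_ex[OF ex] C' by auto
        next
          fix y assume y: "y \<in> centers X (Suc v) \<and> u \<in> core X y"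
          show "(LEAST z. z \<in> centers X v \<and> u \<in> core X z) \<le> y"
          proof (cases "y = v")
            case True
            from LeastI_ex[OF ex] have "(LEAST z. z \<in> centers X v \<and> u \<in> core X z) < v"
              by (simp add: centers_def)
            with True show ?thesis by simp
          next
            case False
            with y C' show ?thesis by (intro Least_le) auto
          qed
        qed
        with old acc IH(2) C' show ?thesis by (auto simp: relabel_def first_label_def)
      next
        case new: False
        have "(LEAST z. z \<in> centers X (Suc v) \<and> u \<in> core X z) = v" if "u \<in> core X v"
          using that new C' by (intro Least_equality) auto
        with new acc IH(2) C' show ?thesis by (auto simp: relabel_def first_label_def)
      qed
    qed
    then have "fst (label_state X B (Suc v)) = first_label X (centers X (Suc v))"
      unfolding c fst_conv by (rule ext)
    with 1 show ?thesis unfolding c_def[symmetric] by (rule conjI)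
  qed
qed

lemma accurate_lower:
  fixes a :: real
  assumes "\<not> inaccurate h u A" "0 < K" "u < n" "a * K \<le> real h"
  shows "(a - 1 / 20) * real (card (nbhd u)) \<le> real (card (nbhd u \<inter> A))"
proof -
  define f where "f = real (card (nbhd u \<inter> A)) / real (card (nbhd u))"
  have "real h - K * f < 1 / 20 * K" using assms(1) unfolding inaccurate_def f_def by linarith
  moreover have "(a - 1 / 20) * K = a * K - 1 / 20 * K" by (simp add: algebra_simps)
  ultimately have "(a - 1 / 20) * K < f * K" using assms(4) by (simp add: mult.commute)
  with assms(2) have "a - 1 / 20 \<le> f" by simp
  moreover have "0 < real (card (nbhd u))" using assms(3) by (simp add: card_nbhd deg_def)
  ultimately show ?thesis unfolding f_def by (simp only: pos_le_divide_eq)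
qed

lemma accurate_upper:
  fixes b :: real
  assumes "\<not> inaccurate h u A" "0 < K" "u < n"
    "b * real (card (nbhd u)) \<le> real (card (nbhd u \<inter> A))"
  shows "(b - 1 / 20) * K < real h"
proof -
  define f where "f = real (card (nbhd u \<inter> A)) / real (card (nbhd u))"
  have 1: "K * f - real h < 1 / 20 * K" using assms(1) unfolding inaccurate_def f_def by linarith
  have "0 < real (card (nbhd u))" using assms(3) by (simp add: card_nbhd deg_def)
  then have "b \<le> f" using assms(4) unfolding f_def by (simp only: pos_le_divide_eq)
  then have "b * K \<le> K * f" using mult_right_mono[of b f "real K"] by (simp add: mult.commute)
  moreover have "(b - 1 / 20) * K = b * K - 1 / 20 * K" by (simp add: algebra_simps)
  ultimately show ?thesis using 1 by linarith
qed

text \<open>A majority is never empty. So an eligible label is among those tried by the voting loop,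
  and it is the label of some vertex.\<close>

lemma eligible_vote:
  assumes "eligible X L u l"
  shows "\<exists>j<K. L (X (u * (2 * K) + K + j)) = l"
proof (rule ccontr)
  assume "\<not> ?thesis"
  then have "{j. j < K \<and> L (X (u * (2 * K) + K + j)) = l} = {}" by blast
  with assms show False by (simp add: eligible_def votes_def del: Collect_empty_eq)
qed

lemma eligible_unique:
  assumes "eligible X L u l" "eligible X L u l'"
  shows "l = l'"
proof (rule ccontr)
  assume ne: "l \<noteq> l'"
  let ?S = "\<lambda>l. {j. j < K \<and> L (X (u * (2 * K) + K + j)) = l}"
  have "card (?S l) + card (?S l') = card (?S l \<union> ?S l')"
    using ne by (intro card_Un_disjoint[symmetric]) auto
  also have "\<dots> \<le> card {..<K}" by (intro card_mono) auto
  finally show False using assms by (simp add: eligible_def votes_def)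
qed

end

section \<open>The algorithm succeeds with high probability\<close>

locale graph_ram = instance_ram +
  fixes lab :: "nat set \<Rightarrow> label"
  assumes adj: "adjacency_lists n lab adj"
    and K: "K = 1200 * floorlog 2 n"
begin

lemma nbhd_eq: "v < n \<Longrightarrow> nbhd v = insert v (pos_nbrs {..<n} lab v)"
  using adj by (simp add: nbhd_def adjacency_lists_def)

lemma K_pos: "0 < K"
  using K n_pos floorlog_2_div[of n] by simp

definition opt_part :: "nat set set" where
  "opt_part = (SOME P. partition_on {..<n} P \<and> cc_cost {..<n} lab P = cc_opt {..<n} lab)"

lemma opt_part: "partition_on {..<n} opt_part" "cc_cost {..<n} lab opt_part = cc_opt {..<n} lab"
  using someI_ex[OF cc_opt_attained[of "{..<n}" lab]] by (simp_all add: opt_part_def)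

text \<open>\<open>good\<close> stated without reference to the samples: the probability of missing
  a cluster must be bounded before a sample array is fixed, whereas
  \<open>clustering_analysis\<close> is interpreted for one fixed array. The same applies to
  \<open>dense\<close>.\<close>

definition opt_good :: "nat set \<Rightarrow> nat set" where
  "opt_good Q = {v \<in> Q. 100 * card (sym_diff (nbhd v) Q) \<le> deg v}"

definition dense :: "nat set \<Rightarrow> bool" where
  "dense Q \<longleftrightarrow> 100 * card (Q - opt_good Q) \<le> card Q"

definition label_of :: "(nat \<Rightarrow> nat) \<Rightarrow> nat \<Rightarrow> nat" where
  "label_of X = fst (label_state X (3 * n * K) n)"

text \<open>The deterministic core of the argument: outside four kinds of bad events, the sample
  array gives an interpretation of \<open>clustering_analysis\<close>. Both vertex sums are twice
  the costs, so the factor of \<open>sum_cost\<close> carries over.\<close>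

lemma analysis:
  assumes tests: "\<And>u v. u < n \<Longrightarrow> v < n \<Longrightarrow> \<not> inaccurate (hits X u (nbhd v)) u (nbhd v)"
    and votes: "\<And>u l. u < n \<Longrightarrow> l \<le> n \<Longrightarrow>
        \<not> inaccurate (votes X (label_of X) u l) u (label_of X -` {l})"
    and selected: "\<And>Q. Q \<in> opt_part \<Longrightarrow> dense Q \<Longrightarrow> \<exists>v\<in>opt_good Q. hits X v {v} \<noteq> 0"
    and budget: "\<not> 3 * n * K \<le> (\<Sum>v<n. deg v * hits X v {v})"
    and s: "correct X s"
  shows "real (cc_cost {..<n} lab (output_clustering n ([], s))) \<le> 72011 * real (cc_opt {..<n} lab)"
proof -
  let ?L = "label_of X"
  have L: "?L = first_label X (centers X n)"
    unfolding label_of_def using label_state_eq[of X "3 * n * K" n] budget by simp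
  have L_le: "?L u \<le> n" for u
  proof (cases "\<exists>z. z \<in> centers X n \<and> u \<in> core X z")
    case True
    from LeastI_ex[OF this] show ?thesis by (auto simp: L first_label_def centers_def)
  qed (auto simp: L first_label_def)
  have elected: "elected X ?L K u (mem s u)" if "u < n" for u
    using s that by (simp add: correct_def label_of_def)
  interpret clustering_analysis n nbhd opt_part "centers X n" "\<lambda>v. hits X v {v} \<noteq> 0" "core X" ?L
    "eligible X ?L" "mem s"
  proof
    show "v \<in> nbhd v" for v by (simp add: nbhd_def)
    show "nbhd v \<subseteq> {..<n}" if "v < n" for v using that by (rule nbhd_subset)
    show "v \<in> nbhd u" if "u < n" "v < n" "u \<in> nbhd v" for u v
      using that by (auto simp: nbhd_eq pos_nbrs_def insert_commute)
    show "partition_on {..<n} opt_part" by (rule opt_part)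
    show "z < n" if "z \<in> centers X n" for z using that by (simp add: centers_def)
    show "core X z \<subseteq> nbhd z" for z by (auto simp: core_def)
    show "9 * card (nbhd z) \<le> 10 * card (core X z)" if "z \<in> centers X n" for z
      using that by (simp add: centers_def card_nbhd)
    show "z \<in> centers X n" if "z < n" "hits X z {z} \<noteq> 0" "9 * card (nbhd z) \<le> 10 * card (core X z)" for z
      using that by (simp add: centers_def card_nbhd)
    show "?L u = (if \<exists>z\<in>centers X n. u \<in> core X z
        then Suc (LEAST z. z \<in> centers X n \<and> u \<in> core X z) else 0)" for u
      by (simp add: L first_label_def)
  next
    fix z u assume z: "z < n" and u: "u \<in> core X z"
    then have un: "u < n" using nbhd_subset[OF z] by (auto simp: core_def)
    have "9 / 10 * K \<le> real (hits X u (nbhd z))" using u by (auto simp: core_def)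
    from accurate_lower[OF tests[OF un z] K_pos un this]
    have "85 * card (nbhd u) \<le> 100 * card (nbhd u \<inter> nbhd z)" by simp
    moreover have "10 * card (nbhd z) \<le> 11 * card (nbhd u)"
      using u z un by (simp add: core_def card_nbhd)
    ultimately show "85 * card (nbhd u) \<le> 100 * card (nbhd u \<inter> nbhd z) \<and>
        10 * card (nbhd z) \<le> 11 * card (nbhd u)" ..
  next
    fix z u assume z: "z < n" and u: "u \<in> nbhd z"
      "95 * card (nbhd u) \<le> 100 * card (nbhd u \<inter> nbhd z)" "10 * card (nbhd z) \<le> 11 * card (nbhd u)"
    then have un: "u < n" using nbhd_subset[OF z] by auto
    have "95 / 100 * real (card (nbhd u)) \<le> real (card (nbhd u \<inter> nbhd z))" using u(2) by simp
    from accurate_upper[OF tests[OF un z] K_pos un this] have "9 * K \<le> 10 * hits X u (nbhd z)" by simp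
    then show "u \<in> core X z" using u z un by (simp add: core_def card_nbhd)
  next
    fix u l assume u: "u < n" and e: "eligible X ?L u l"
    have ln: "l \<le> n" using eligible_vote[OF e] L_le by auto
    have "1 / 2 * K \<le> real (votes X ?L u l)" using e by (simp add: eligible_def)
    from accurate_lower[OF votes[OF u ln] K_pos u this]
    have "45 * card (nbhd u) \<le> 100 * card (nbhd u \<inter> ?L -` {l})" by simp
    moreover have "l - 1 < n" using ln n_pos by simp
    ultimately show "0 < l \<and> 45 * card (nbhd u) \<le> 100 * card (nbhd u \<inter> ?L -` {l}) \<and>
        4 * card (nbhd (l - 1)) \<le> 5 * card (nbhd u)"
      using e u by (simp add: eligible_def card_nbhd)
  next
    fix u l assume u: "u < n" and l: "0 < l" "60 * card (nbhd u) \<le> 100 * card (nbhd u \<inter> ?L -` {l})"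
      "4 * card (nbhd (l - 1)) \<le> 5 * card (nbhd u)"
    have "card (nbhd u) \<noteq> 0" using u by (simp add: card_nbhd deg_def)
    then have "nbhd u \<inter> ?L -` {l} \<noteq> {}" using l(2) by (intro notI) simp
    then have ln: "l \<le> n" using L_le by auto
    then have ln': "l - 1 < n" using n_pos by simp
    have "60 / 100 * real (card (nbhd u)) \<le> real (card (nbhd u \<inter> ?L -` {l}))" using l(2) by simp
    from accurate_upper[OF votes[OF u ln] K_pos u this] have "K < 2 * votes X ?L u l"
      using K_pos by simp
    then show "eligible X ?L u l" using l u ln' by (simp add: eligible_def card_nbhd)
  next
    fix u l assume u: "u < n" and e: "eligible X ?L u l"
    from elected[OF u] eligible_vote[OF e] e have "eligible X ?L u (mem s u)"
      by (auto simp: elected_def)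
    from eligible_unique[OF this e] show "mem s u = l" .
  next
    fix u assume "u < n" "\<And>l. \<not> eligible X ?L u l"
    with elected[of u] show "mem s u = Suc (u + n)" by (auto simp: elected_def)
  qed
  have good_eq: "good v \<longleftrightarrow> v \<in> opt_good Q" if "Q \<in> opt_part" "v \<in> Q" for Q v
  proof -
    have "v < n" "part_of opt_part v = Q" using that part_less part_of_eq[OF P] by blast+
    then show ?thesis
      using that(2) unfolding good_def opt_good_def err_def d_def card_nbhd[OF \<open>v < n\<close>] by auto
  qed
  have "(\<Sum>w<n. cost w) \<le> 72011 * (\<Sum>w<n. err w)"
  proof (rule sum_cost)
    fix Q assume Q: "Q \<in> opt_part" "100 * real (card {v \<in> Q. \<not> good v}) \<le> real (card Q)"
    have "{v \<in> Q. \<not> good v} = Q - opt_good Q" using good_eq[OF Q(1)] by auto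
    then have "dense Q" using Q(2) by (simp add: dense_def)
    from selected[OF Q(1) this] obtain v where "v \<in> opt_good Q" "hits X v {v} \<noteq> 0" by blast
    moreover from this have "v \<in> Q" by (simp add: opt_good_def)
    ultimately show "\<exists>v\<in>Q. good v \<and> hits X v {v} \<noteq> 0" using good_eq[OF Q(1)] by blast
  qed
  moreover have "(\<Sum>w<n. err w) = 2 * real (cc_opt {..<n} lab)"
  proof -
    have "2 * cc_opt {..<n} lab = (\<Sum>v<n. card (sym_diff (nbhd v) (part_of opt_part v)))"
      using cc_cost_eq[OF _ opt_part(1), of lab] opt_part(2) by (simp add: nbhd_eq)
    then show ?thesis unfolding err_def by (metis of_nat_mult of_nat_numeral of_nat_sum)
  qed
  moreover have "(\<Sum>w<n. cost w) = 2 * real (cc_cost {..<n} lab (output_clustering n ([], s)))"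
  proof -
    note part = partition_on_output_clustering[of n "([], s)"]
    have "part_of (output_clustering n ([], s)) v = clust v" if "v < n" for v
      by (rule part_of_eq[OF part]) (use that in \<open>auto simp: output_clustering_def clust_def\<close>)
    then have "2 * cc_cost {..<n} lab (output_clustering n ([], s)) =
        (\<Sum>v<n. card (sym_diff (nbhd v) (clust v)))"
      using cc_cost_eq[OF _ part, of lab] by (simp add: nbhd_eq)
    then show ?thesis unfolding cost_def by (metis of_nat_mult of_nat_numeral of_nat_sum)
  qed
  ultimately show ?thesis by simp
qed


text \<open>There are at least \<open>99 / 100 * m\<close> good vertices, each of degree at most
  \<open>100 / 99 * m\<close>. The exponent is therefore at least \<open>9801 / 10000 * K\<close>, a
  constant independent of the size of \<open>Q\<close>; it is weakened to the common bound.\<close>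

lemma prob_dense_missed:
  assumes "Q \<in> opt_part" "dense Q"
  shows "measure_pmf.prob samples {X. \<forall>v\<in>opt_good Q. hits X v {v} = 0} \<le> exp (- (K / 200))"
proof -
  define m where "m = real (card Q)"
  have Q: "Q \<subseteq> {..<n}" "Q \<noteq> {}"
    using opt_part(1) assms(1) by (auto simp: partition_on_def)
  then have finQ: "finite Q" using finite_subset by blast
  then have m: "0 < m" using Q(2) by (simp add: m_def card_gt_0_iff)
  have V: "opt_good Q \<subseteq> {..<n}" using Q by (auto simp: opt_good_def)
  have "99 / 100 * K / m \<le> K / real (deg v)" if v: "v \<in> opt_good Q" for v
  proof -
    have vn: "v < n" using v V by blast
    have "real (deg v) \<le> m + real (card (sym_diff (nbhd v) Q))"
      using card_le_card_sym_diff[of "nbhd v" Q] finQ by (simp add: card_nbhd[OF vn] m_def)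
    moreover have "100 * real (card (sym_diff (nbhd v) Q)) \<le> real (deg v)"
      using v by (simp add: opt_good_def)
    ultimately have "99 / 100 * real (deg v) \<le> m" by linarith
    then have "K * (99 / 100 * real (deg v)) \<le> K * m" by (intro mult_left_mono) simp_all
    then show ?thesis using m by (simp add: field_simps deg_def)
  qed
  then have "(\<Sum>v\<in>opt_good Q. 99 / 100 * K / m) \<le> (\<Sum>v\<in>opt_good Q. K / real (deg v))"
    by (rule sum_mono)
  moreover have "99 / 100 * m \<le> real (card (opt_good Q))"
  proof -
    have "card Q = card (opt_good Q) + card (Q - opt_good Q)"
      using finQ by (subst card_Diff_subset) (auto simp: opt_good_def card_mono)
    then show ?thesis using assms(2) unfolding dense_def m_def by linarith
  qed
  then have "99 / 100 * m * (99 / 100 * K / m) \<le> real (card (opt_good Q)) * (99 / 100 * K / m)"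
    using m by (intro mult_right_mono) simp_all
  moreover have "99 / 100 * m * (99 / 100 * K / m) = 9801 / 10000 * K" using m by simp
  moreover have "(\<Sum>v\<in>opt_good Q. 99 / 100 * K / m) = real (card (opt_good Q)) * (99 / 100 * K / m)"
    by simp
  ultimately have "K / 200 \<le> (\<Sum>v\<in>opt_good Q. K / real (deg v))"
    by linarith
  then have "exp (- (\<Sum>v\<in>opt_good Q. K / real (deg v))) \<le> exp (- (K / 200))" by simp
  with prob_not_selected[OF V] show ?thesis by linarith
qed

text \<open>Origin of the factor 1200: for \<open>l\<close> digits, \<open>K / 200\<close> is
  \<open>6 * l\<close>. Three of the six factors \<open>2 ^ l\<close> absorb \<open>n ^ 3\<close>,
  the other three absorb the constant 8.\<close>

lemma tail_bound: "8 * (real n)\<^sup>2 * exp (- (K / 200)) \<le> 1 / real n"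
proof -
  define l where "l = floorlog 2 n"
  have "n < 2 ^ l" unfolding l_def using floorlog_bounds[of n 2] n_pos by simp
  then have n: "real n \<le> 2 ^ l" by (metis less_imp_le of_nat_le_iff of_nat_numeral of_nat_power)
  have l: "0 < l" using K K_pos by (simp add: l_def)
  have two: "2 \<le> (2::real) ^ l" using l power_increasing[of 1 l "2::real"] by simp
  have "8 * real n ^ 3 \<le> (2 ^ l) ^ 3 * (2 ^ l) ^ 3"
    using power_mono[OF two, of 3] power_mono[OF n, of 3] by (intro mult_mono) simp_all
  also have "\<dots> = (2 ^ l) ^ (6::nat)" by (simp flip: power_add)
  also have "\<dots> \<le> exp (real l) ^ 6"
  proof (rule power_mono)
    have "(2::real) ^ l \<le> exp 1 ^ l" using exp_ge_add_one_self[of 1] by (intro power_mono) simp_all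
    then show "2 ^ l \<le> exp (real l)" by (simp flip: exp_of_nat_mult)
  qed simp
  also have "\<dots> = exp (K / 200)" using K by (simp add: l_def flip: exp_of_nat_mult)
  finally have "8 * real n ^ 3 * exp (- (K / 200)) \<le> 1"
    by (simp add: exp_minus field_simps)
  then show ?thesis using n_pos by (simp add: field_simps power2_eq_square power3_eq_cube)
qed

text \<open>Union bound in units of \<open>e\<close>: two for each of \<open>n * n\<close> tests and
  \<open>n * (n + 1)\<close> votes, one for each of at most \<open>n\<close> dense clusters, and one
  for the budget. Labels up to \<open>n\<close> suffice, which keeps the number of votes
  finite.\<close>

lemma prob_success:
  assumes F: "\<And>X. X \<in> sample_space \<Longrightarrow> correct X (F X)"
  shows "1 - 1 / real n \<le> measure_pmf.prob samples
    {X. real (cc_cost {..<n} lab (output_clustering n ([], F X))) \<le> 72011 * real (cc_opt {..<n} lab)}"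
    (is "_ \<le> measure_pmf.prob samples ?S")
proof -
  define e where "e = exp (- (K / 200))"
  define B1 where "B1 = (\<Union>(u, v)\<in>{..<n} \<times> {..<n}. {X. inaccurate (hits X u (nbhd v)) u (nbhd v)})"
  define B2 where "B2 = (\<Union>(u, l)\<in>{..<n} \<times> {..n}.
      {X. inaccurate (votes X (label_of X) u l) u (label_of X -` {l})})"
  define B3 where "B3 = (\<Union>Q\<in>{Q \<in> opt_part. dense Q}. {X. \<forall>v\<in>opt_good Q. hits X v {v} = 0})"
  define B4 where "B4 = {X. 3 * n * K \<le> (\<Sum>v<n. deg v * hits X v {v})}"
  have union: "measure_pmf.prob samples (\<Union>i\<in>I. A i) \<le> real (card I) * c"
    if "finite I" "\<And>i. i \<in> I \<Longrightarrow> measure_pmf.prob samples (A i) \<le> c"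
    for I :: "'x set" and A c
  proof -
    have "measure_pmf.prob samples (\<Union>i\<in>I. A i) \<le> (\<Sum>i\<in>I. measure_pmf.prob samples (A i))"
      using that(1) by (intro measure_pmf.finite_measure_subadditive_finite) simp_all
    also have "\<dots> \<le> (\<Sum>i\<in>I. c)" using that(2) by (rule sum_mono)
    finally show ?thesis by simp
  qed
  have 1: "measure_pmf.prob samples B1 \<le> real (n * n) * (2 * e)"
    using union[of "{..<n} \<times> {..<n}" "\<lambda>(u, v). {X. inaccurate (hits X u (nbhd v)) u (nbhd v)}" "2 * e"]
      prob_inaccurate_test[OF K_pos] by (auto simp: B1_def e_def)
  have 2: "measure_pmf.prob samples B2 \<le> real (n * (n + 1)) * (2 * e)"
    using union[of "{..<n} \<times> {..n}" "\<lambda>(u, l). {X. inaccurate (votes X (label_of X) u l) u (label_of X -` {l})}"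
        "2 * e"]
      prob_inaccurate_vote[OF K_pos, of _ "3 * n * K"] by (auto simp: B2_def e_def label_of_def)
  have finP: "finite opt_part" using opt_part(1) finite_elements by blast
  have "card opt_part \<le> n"
  proof -
    have "opt_part \<subseteq> part_of opt_part ` {..<n}"
    proof
      fix Q assume Q: "Q \<in> opt_part"
      then have "Q \<subseteq> {..<n}" "Q \<noteq> {}" using opt_part(1) by (auto simp: partition_on_def)
      then obtain v where v: "v \<in> Q" "v < n" by blast
      with part_of_eq[OF opt_part(1) Q v(1)] show "Q \<in> part_of opt_part ` {..<n}" by auto
    qed
    then show ?thesis using surj_card_le[of "{..<n}" opt_part "part_of opt_part"] by simp
  qed
  then have "card {Q \<in> opt_part. dense Q} \<le> n"
    using card_mono[OF finP, of "{Q \<in> opt_part. dense Q}"] by auto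
  then have "real (card {Q \<in> opt_part. dense Q}) * e \<le> real n * e"
    by (intro mult_right_mono) (simp_all add: e_def)
  moreover have "measure_pmf.prob samples B3 \<le> real (card {Q \<in> opt_part. dense Q}) * e"
    unfolding B3_def e_def by (rule union) (use finP prob_dense_missed in auto)
  ultimately have 3: "measure_pmf.prob samples B3 \<le> real n * e" by linarith
  have 4: "measure_pmf.prob samples B4 \<le> e"
  proof -
    have "exp (- real K) \<le> e" by (simp add: e_def)
    with prob_budget show ?thesis unfolding B4_def by linarith
  qed
  \<comment> \<open>The inclusion holds only almost everywhere: \<open>F X\<close> is known to be
    correct only for arrays whose entries lie in the right neighborhoods.\<close>
  have "measure_pmf.prob samples (- ?S) \<le> measure_pmf.prob samples ((B1 \<union> B2) \<union> (B3 \<union> B4))"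
  proof (rule measure_pmf.finite_measure_mono_AE)
    have "X \<in> ?S" if "X \<in> set_pmf samples" "X \<notin> B1" "X \<notin> B2" "X \<notin> B3" "X \<notin> B4" for X
    proof -
      have "correct X (F X)" using F that(1) set_samples by blast
      then show ?thesis
        using that(2-5) unfolding B1_def B2_def B3_def B4_def mem_Collect_eq
        by (intro analysis) (auto simp: dest!: bspec)
    qed
    then show "AE X in measure_pmf samples. X \<in> - ?S \<longrightarrow> X \<in> (B1 \<union> B2) \<union> (B3 \<union> B4)"
      by (auto simp: AE_measure_pmf_iff)
  qed simp
  also have "\<dots> \<le> (measure_pmf.prob samples B1 + measure_pmf.prob samples B2) +
      (measure_pmf.prob samples B3 + measure_pmf.prob samples B4)"
    by (intro order_trans[OF measure_Un_le] add_mono measure_Un_le) simp_all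
  also have "\<dots> \<le> (real (n * n) * (2 * e) + real (n * (n + 1)) * (2 * e)) + (real n * e + e)"
    using 1 2 3 4 by linarith
  also have "\<dots> = (4 * (real n)\<^sup>2 + 3 * real n + 1) * e"
    by (simp add: algebra_simps power2_eq_square)
  also have "\<dots> \<le> (8 * (real n)\<^sup>2) * e"
  proof (rule mult_right_mono)
    have "1 \<le> real n" using n_pos by simp
    then have "real n \<le> (real n)\<^sup>2" by (simp add: power2_eq_square)
    with \<open>1 \<le> real n\<close> show "4 * (real n)\<^sup>2 + 3 * real n + 1 \<le> 8 * (real n)\<^sup>2" by linarith
  qed (simp add: e_def)
  also have "\<dots> \<le> 1 / real n" using tail_bound by (simp add: e_def)
  finally have "measure_pmf.prob samples (- ?S) \<le> 1 / real n" .
  moreover have "measure_pmf.prob samples (- ?S) = 1 - measure_pmf.prob samples ?S"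
    using measure_pmf.prob_compl[of ?S samples] by (simp add: Compl_eq_Diff_UNIV)
  ultimately show ?thesis by linarith
qed

lemma program_correct:
  "(\<forall>\<sigma> \<in> set_pmf (run program w n adj (time_bound n K)). halted \<sigma> \<and> queries (snd \<sigma>) \<le> query_bound n K) \<and>
   measure_pmf.prob (run program w n adj (time_bound n K))
     {\<sigma>. real (cc_cost {..<n} lab (output_clustering n \<sigma>)) \<le> 72011 * real (cc_opt {..<n} lab)}
     \<ge> 1 - 1 / real n"
proof -
  obtain F where F: "run program w n adj (time_bound n K) = map_pmf (\<lambda>X. ([], F X)) samples"
    "\<And>X. X \<in> sample_space \<Longrightarrow> correct X (F X)"
    using run_program[OF K] by blast
  have "halted \<sigma> \<and> queries (snd \<sigma>) \<le> query_bound n K"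
    if "\<sigma> \<in> set_pmf (run program w n adj (time_bound n K))" for \<sigma>
  proof -
    from that obtain X where "X \<in> set_pmf samples" "\<sigma> = ([], F X)" unfolding F(1) by auto
    with F(2)[of X] set_samples show ?thesis by (auto simp: halted_def correct_def)
  qed
  moreover have "1 - 1 / real n \<le> measure_pmf.prob (run program w n adj (time_bound n K))
     {\<sigma>. real (cc_cost {..<n} lab (output_clustering n \<sigma>)) \<le> 72011 * real (cc_opt {..<n} lab)}"
    using prob_success[OF F(2)] unfolding F(1) by (simp add: vimage_def)
  ultimately show ?thesis by blast
qed

end

section \<open>Asymptotic bounds and word length\<close>

lemma floorlog_le_ln:
  assumes "2 \<le> n"
  shows "real (floorlog 2 n) \<le> 4 * ln (real n)" "1 \<le> 2 * ln (real n)"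
proof -
  have n: "2 \<le> real n" using assms by simp
  have l2: "2 / 3 \<le> ln (2::real)" by (rule ln2_ge_two_thirds)
  moreover have "ln 2 \<le> ln (real n)" using n by simp
  ultimately show ln: "1 \<le> 2 * ln (real n)" by linarith
  have "real (floorlog 2 n) \<le> log 2 (real n) + 1"
    using assms by (simp add: floorlog_def of_nat_nat)
  also have "log 2 (real n) \<le> ln (real n) / (2 / 3)"
    unfolding log_def using l2 n by (intro divide_left_mono) simp_all
  finally show "real (floorlog 2 n) \<le> 4 * ln (real n)" using ln by simp
qed

lemma query_bound_bigo:
  "(\<lambda>n. real (query_bound n (1200 * floorlog 2 n))) \<in> O(\<lambda>n. real n * ln (real n))"
proof (rule bigoI[where c = 90000])
  have "real (query_bound n (1200 * floorlog 2 n)) \<le> 90000 * (real n * ln (real n))" if "2 \<le> n" for n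
  proof -
    define K where "K = real (1200 * floorlog 2 n)"
    note l = floorlog_le_ln[OF that]
    have "K \<le> 4800 * ln (real n)" using l by (simp add: K_def)
    then have 1: "real n * K \<le> real n * (4800 * ln (real n))" by (intro mult_left_mono) simp_all
    have 2: "real n * 1 \<le> real n * (2 * ln (real n))" using l(2) by (intro mult_left_mono) simp_all
    have "real (query_bound n (1200 * floorlog 2 n)) = 17 * (real n * K) + 2 * real n"
      by (simp add: query_bound_def K_def algebra_simps)
    with 1 2 show ?thesis by (simp add: algebra_simps)
  qed
  moreover have "0 \<le> real n * ln (real n)" if "2 \<le> n" for n
    using floorlog_le_ln(2)[OF that] by simp
  ultimately show "\<forall>\<^sub>F n in at_top. norm (real (query_bound n (1200 * floorlog 2 n))) \<le>
      90000 * norm (real n * ln (real n))"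
    by (intro eventually_at_top_linorderI[of 2]) (simp only: real_norm_def abs_of_nonneg of_nat_0_le_iff)
qed

lemma time_bound_bigo:
  "(\<lambda>n. real (time_bound n (1200 * floorlog 2 n))) \<in> O(\<lambda>n. real n * (ln (real n))\<^sup>2)"
proof (rule bigoI[where c = "4000 * 4800\<^sup>2"])
  have "real (time_bound n (1200 * floorlog 2 n)) \<le> 4000 * 4800\<^sup>2 * (real n * (ln (real n))\<^sup>2)"
    if n: "2 \<le> n" for n
  proof -
    define K where "K = 1200 * floorlog 2 n"
    have "0 < floorlog 2 n" using n by (simp add: zero_less_iff_neq_zero floorlog_eq_zero_iff)
    then have K: "1 \<le> K" by (simp add: K_def)
    have n1: "1 \<le> n" using n by simp
    have "K * 1 \<le> K * K" using K by (intro mult_left_mono) simp_all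
    then have 1: "n * K \<le> n * (K * K)" by simp
    have 2: "n * 1 \<le> n * K" "1 * K \<le> n * K" using K n1 by (intro mult_mono; simp)+
    have "time_bound n K = 100 + K + 1000 * n + 2500 * (n * K) + 160 * (n * (K * K))"
      by (simp add: time_bound_def algebra_simps)
    also have "\<dots> \<le> 4000 * (n * (K * K))" using 1 2 n1 by linarith
    finally have "real (time_bound n K) \<le> real (4000 * (n * (K * K)))" by (simp only: of_nat_le_iff)
    also have "\<dots> = 4000 * (real n * (real K)\<^sup>2)" by (simp add: power2_eq_square)
    also have "\<dots> \<le> 4000 * (real n * (4800 * ln (real n))\<^sup>2)"
      using floorlog_le_ln(1)[OF n] by (intro mult_left_mono power_mono) (simp_all add: K_def)
    finally show ?thesis by (simp add: K_def power_mult_distrib mult_ac)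
  qed
  then show "\<forall>\<^sub>F n in at_top. norm (real (time_bound n (1200 * floorlog 2 n))) \<le>
      4000 * 4800\<^sup>2 * norm (real n * (ln (real n))\<^sup>2)"
    by (intro eventually_at_top_linorderI[of 2]) simp
qed

lemma graph_ram_word_length:
  assumes n: "1 \<le> n" and adj: "adjacency_lists n lab adj"
  shows "graph_ram (word_length 20 n) n adj (1200 * floorlog 2 n) lab"
proof
  show "0 < n" using n by simp
  show "distinct (adj v)" "set (adj v) \<subseteq> {..<n} - {v}" if "v < n" for v
    using adj that by (auto simp: adjacency_lists_def pos_nbrs_def edges_def)
  define l where "l = floorlog 2 n"
  have nl: "n < 2 ^ l" unfolding l_def using floorlog_bounds[of n 2] n by simp
  have l: "0 < l" using n by (simp add: l_def zero_less_iff_neq_zero floorlog_eq_zero_iff)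
  have "l < (2::nat) ^ l" by (rule less_exp)
  \<comment> \<open>Origin of the word length: the factors are below \<open>2 ^ 7\<close>,
    \<open>2 ^ l\<close> (at most) and \<open>2 ^ (11 + l)\<close> (at most), and
    \<open>18 + 2 * l\<close> is at most \<open>20 * l\<close> for positive
    \<open>l\<close>.\<close>
  then have "1200 * l + 1 \<le> 2048 * 2 ^ l" by linarith
  then have "1200 * l + 1 \<le> 2 ^ 11 * 2 ^ l" by simp
  then have "(n + 1) * (1200 * l + 1) \<le> 2 ^ l * (2 ^ 11 * 2 ^ l)"
    using nl by (intro mult_mono) simp_all
  then have "100 * ((n + 1) * (1200 * l + 1)) \<le> 100 * (2 ^ l * (2 ^ 11 * 2 ^ l))" by simp
  also have "\<dots> < 2 ^ 7 * (2 ^ l * (2 ^ 11 * 2 ^ l))" by simp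
  also have "\<dots> = 2 ^ (7 + (l + (11 + l)))" by (simp only: power_add)
  also have "\<dots> \<le> 2 ^ (20 * l)" using l by (intro power_increasing) simp_all
  finally show "100 * ((n + 1) * (1200 * floorlog 2 n + 1)) < 2 ^ word_length 20 n"
    by (simp add: word_length_def l_def)
qed (use adj in simp_all)

theorem theorem5p1:
  "\<exists>(p :: com) (c :: nat) (\<alpha> :: real) (k :: nat) (Q :: nat \<Rightarrow> nat) (T :: nat \<Rightarrow> nat).
     c \<ge> 1 \<and> k \<ge> 1 \<and>
     (\<lambda>n. real (Q n)) \<in> O(\<lambda>n. real n * ln (real n)) \<and>
     (\<lambda>n. real (T n)) \<in> O(\<lambda>n. real n * (ln (real n))\<^sup>2) \<and>
     (\<forall>n\<ge>1. \<forall>(lab :: nat set \<Rightarrow> label) (adj :: nat \<Rightarrow> nat list).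
        adjacency_lists n lab adj \<longrightarrow>
        (\<forall>\<sigma> \<in> set_pmf (run p (word_length c n) n adj (T n)).
           halted \<sigma> \<and> queries (snd \<sigma>) \<le> Q n) \<and>
        measure_pmf.prob (run p (word_length c n) n adj (T n))
          {\<sigma>. real (cc_cost {..<n} lab (output_clustering n \<sigma>))
                \<le> \<alpha> * real (cc_opt {..<n} lab)}
          \<ge> 1 - 1 / real n ^ k)"
proof (rule exI[of _ program], rule exI[of _ 20], rule exI[of _ 72011], rule exI[of _ 1],
    rule exI[of _ "\<lambda>n. query_bound n (1200 * floorlog 2 n)"],
    rule exI[of _ "\<lambda>n. time_bound n (1200 * floorlog 2 n)"], intro conjI)
  show "\<forall>n\<ge>1. \<forall>(lab :: nat set \<Rightarrow> label) (adj :: nat \<Rightarrow> nat list). adjacency_lists n lab adj \<longrightarrow>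
      (\<forall>\<sigma> \<in> set_pmf (run program (word_length 20 n) n adj (time_bound n (1200 * floorlog 2 n))).
         halted \<sigma> \<and> queries (snd \<sigma>) \<le> query_bound n (1200 * floorlog 2 n)) \<and>
      measure_pmf.prob (run program (word_length 20 n) n adj (time_bound n (1200 * floorlog 2 n)))
        {\<sigma>. real (cc_cost {..<n} lab (output_clustering n \<sigma>)) \<le> 72011 * real (cc_opt {..<n} lab)}
        \<ge> 1 - 1 / real n ^ 1"
    using graph_ram.program_correct[OF graph_ram_word_length] by (simp only: power_one_right) blast
qed (simp_all add: query_bound_bigo time_bound_bigo del: of_nat_mult)

end
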